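(* For every positive integer $n$, the $n$-strand braid group injects naturally into the $n$-strand string link monoid: the map sending the isotopy class of an $n$-strand braid $\beta$ to the equivalence class of $\beta$ regarded as an $n$-strand string link is a well-defined injective homomorphism of monoids.
   Context: We work in the piecewise-linear category. Let $I=[0,1]$ and let $B=I\times I\times I$ (the tangle ball), with coordinates $(x,y,z)$. Fix a positive integer $n$. An $(n,n)$-tangle (without loop components) is a properly embedded subspace of $B$ homeomorphic to $n$ disjoint copies of $I$ (the strands), whose $2n$ endpoints are the points $(0,\frac{i}{n+1},\frac12)$ and $(1,\frac{i}{n+1},\frac12)$, $i=1,\dots,n$, in no particular order. An $n$-strand string link is such a tangle in which each strand has one endpoint on the left face $\{0\}\times I\times I$ and the other on the right face $\{1\}\times I\times I$. String links are not required to be pure: the two endpoints of a strand need not have the same $(y,z)$-coordinates. An $n$-strand braid is a string link whose strands are images of embeddings of $I$ into $B$ along which the first coordinate $x$ is a strictly monotone function on $I$. Thus each level set $x=\mathrm{const}$ meets a braid in $n$ points in the interior of $\{\mathrm{const}\}\times I\times I$. Equivalence: two string links $T,T'$ are equivalent (written $T\cong T'$) if there is a self-homeomorphism of $B$ that is the identity on $\partial B$ and carries $T$ onto $T'$. Isotopy of braids: two braids $\beta,\beta'$ are isotopic (as braids) if there is a continuous family $\beta_t$, $t\in I$, of braids with $\beta_0=\beta$ and $\beta_1=\beta'$. Product: $T\cdot T'$ is obtained by placing $T$ to the left of $T'$ and compressing horizontally, i.e. $T\cdot T'=\{(x/2,y,z):(x,y,z)\in T\}\cup\{((x+1)/2,y,z):(x,y,z)\in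 T'\}$. The identity $\beta_e$ is represented by the $n$ horizontal strands $I\times\{(\frac{i}{n+1},\frac12)\}$. The $n$-strand string link monoid is the set of equivalence classes of $n$-strand string links with this product and identity. The $n$-strand braid group is the set of isotopy classes of $n$-strand braids with the same product and identity. *)

theory Defs
  imports "HOL-Analysis.Analysis" "HOL-Algebra.Group"
begin

text \<open>
  A map on a compact set is PL if the set is a finite union of polytopes (hence a compact
  polyhedron) on each of which the map is affine. Continuity on the union follows, the pieces
  being finitely many closed sets.
\<close>

definition pl_on :: "'a::euclidean_space set \<Rightarrow> ('a \<Rightarrow> 'b::euclidean_space) \<Rightarrow> bool" where
  "pl_on S f \<longleftrightarrow>
     (\<exists>\<C>. finite \<C> \<and> (\<forall>C\<in>\<C>. polytope C) \<and> \<Union>\<C> = S \<and>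
          (\<forall>C\<in>\<C>. \<exists>A b. linear A \<and> (\<forall>x\<in>C. f x = A x + b)))"

definition pl_homeomorphism ::
    "'a::euclidean_space set \<Rightarrow> 'b::euclidean_space set \<Rightarrow> ('a \<Rightarrow> 'b) \<Rightarrow> ('b \<Rightarrow> 'a) \<Rightarrow> bool" where
  "pl_homeomorphism S T f g \<longleftrightarrow> homeomorphism S T f g \<and> pl_on S f \<and> pl_on T g"

type_synonym point = "real \<times> real \<times> real"

definition tangle_ball :: "point set" where
  "tangle_ball = {0..1} \<times> {0..1} \<times> {0..1}"

definition left_face :: "point set" where
  "left_face = {0} \<times> {0..1} \<times> {0..1}"

definition right_face :: "point set" where
  "right_face = {1} \<times> {0..1} \<times> {0..1}"

definition endpoints :: "nat \<Rightarrow> point set" where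
  "endpoints n = {(x, real i / (real n + 1), 1 / 2) | x i. x \<in> {0, 1} \<and> i \<in> {1..n}}"

definition strand_union :: "nat \<Rightarrow> (nat \<Rightarrow> real \<Rightarrow> point) \<Rightarrow> point set" where
  "strand_union n \<gamma> = (\<Union>i\<in>{1..n}. path_image (\<gamma> i))"

text \<open>
  The predicates on families \<open>\<gamma>\<close> speak about PL parametrizations of the strands
  \<open>\<gamma> 1, \<dots>, \<gamma> n\<close> by the unit interval; tangles, string links and braids themselves are the
  underlying point sets, so that neither the numbering nor the parametrization of the strands is
  part of the structure. The last clause of \<open>tangle_strands\<close> is properness: the tangle meets the
  boundary of the ball exactly in the endpoints of its strands.
\<close>

definition tangle_strands :: "nat \<Rightarrow> (nat \<Rightarrow> real \<Rightarrow> point) \<Rightarrow> bool" where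
  "tangle_strands n \<gamma> \<longleftrightarrow>
     (\<forall>i\<in>{1..n}. arc (\<gamma> i) \<and> pl_on {0..1} (\<gamma> i)) \<and>
     disjoint_family_on (\<lambda>i. path_image (\<gamma> i)) {1..n} \<and>
     (\<Union>i\<in>{1..n}. {pathstart (\<gamma> i), pathfinish (\<gamma> i)}) = endpoints n \<and>
     strand_union n \<gamma> \<subseteq> tangle_ball \<and>
     strand_union n \<gamma> \<inter> frontier tangle_ball = endpoints n"

definition string_link_strands :: "nat \<Rightarrow> (nat \<Rightarrow> real \<Rightarrow> point) \<Rightarrow> bool" where
  "string_link_strands n \<gamma> \<longleftrightarrow>
     tangle_strands n \<gamma> \<and>
     (\<forall>i\<in>{1..n}. pathstart (\<gamma> i) \<in> left_face \<and> pathfinish (\<gamma> i) \<in> right_face \<or>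
                 pathstart (\<gamma> i) \<in> right_face \<and> pathfinish (\<gamma> i) \<in> left_face)"

definition braid_strands :: "nat \<Rightarrow> (nat \<Rightarrow> real \<Rightarrow> point) \<Rightarrow> bool" where
  "braid_strands n \<gamma> \<longleftrightarrow>
     string_link_strands n \<gamma> \<and>
     (\<forall>i\<in>{1..n}. strict_mono_on {0..1} (\<lambda>s. fst (\<gamma> i s)) \<or>
                 strict_antimono_on {0..1} (\<lambda>s. fst (\<gamma> i s)))"

definition string_links :: "nat \<Rightarrow> point set set" where
  "string_links n = {T. \<exists>\<gamma>. string_link_strands n \<gamma> \<and> T = strand_union n \<gamma>}"

definition braids :: "nat \<Rightarrow> point set set" where
  "braids n = {T. \<exists>\<gamma>. braid_strands n \<gamma> \<and> T = strand_union n \<gamma>}"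

definition string_link_equivalence :: "nat \<Rightarrow> (point set \<times> point set) set" where
  "string_link_equivalence n =
     {(T, T'). T \<in> string_links n \<and> T' \<in> string_links n \<and>
        (\<exists>h k. pl_homeomorphism tangle_ball tangle_ball h k \<and>
               (\<forall>p\<in>frontier tangle_ball. h p = p) \<and> h ` T = T')}"

text \<open>
  A continuous family of braids \<open>\<beta>\<^sub>t\<close> is one that can be parametrized continuously:
  \<open>\<beta>\<^sub>t = strand_union n (\<lambda>i. H i t)\<close>, with \<open>H i t s\<close> jointly continuous in the time \<open>t\<close> and the
  strand parameter \<open>s\<close>. Each \<open>\<beta>\<^sub>t\<close> is a PL braid, but the dependence on \<open>t\<close> is only required to be
  continuous.
\<close>

definition braid_isotopy :: "nat \<Rightarrow> (point set \<times> point set) set" where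
  "braid_isotopy n =
     {(T, T'). \<exists>H :: nat \<Rightarrow> real \<Rightarrow> real \<Rightarrow> point.
        (\<forall>i\<in>{1..n}. continuous_on ({0..1} \<times> {0..1}) (\<lambda>(t, s). H i t s)) \<and>
        (\<forall>t\<in>{0..1}. braid_strands n (\<lambda>i. H i t)) \<and>
        T = strand_union n (\<lambda>i. H i 0) \<and> T' = strand_union n (\<lambda>i. H i 1)}"

definition stack :: "point set \<Rightarrow> point set \<Rightarrow> point set" where
  "stack T T' = (\<lambda>(x, y, z). (x / 2, y, z)) ` T \<union> (\<lambda>(x, y, z). ((x + 1) / 2, y, z)) ` T'"

definition identity_braid :: "nat \<Rightarrow> point set" where
  "identity_braid n = (\<Union>i\<in>{1..n}. {0..1} \<times> {(real i / (real n + 1), 1 / 2)})"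

text \<open>
  The product of two classes is the union of the classes of all products of representatives, which
  is a single class as soon as the product is compatible with the relation.
\<close>

definition quotient_monoid ::
    "'a set \<Rightarrow> ('a \<times> 'a) set \<Rightarrow> ('a \<Rightarrow> 'a \<Rightarrow> 'a) \<Rightarrow> 'a \<Rightarrow> 'a set monoid" where
  "quotient_monoid S r m e =
     \<lparr>carrier = S // r,
      monoid.mult = (\<lambda>X Y. \<Union>a\<in>X. \<Union>b\<in>Y. r `` {m a b}),
      one = r `` {e}\<rparr>"

definition string_link_monoid :: "nat \<Rightarrow> point set set monoid" where
  "string_link_monoid n =
     quotient_monoid (string_links n) (string_link_equivalence n) stack (identity_braid n)"

definition braid_group :: "nat \<Rightarrow> point set set monoid" where
  "braid_group n = quotient_monoid (braids n) (braid_isotopy n) stack (identity_braid n)"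

definition braid_to_string_link :: "nat \<Rightarrow> point set set \<Rightarrow> point set set" where
  "braid_to_string_link n X = (\<Union>\<beta>\<in>X. string_link_equivalence n `` {\<beta>})"

end

theory Submission
  imports Defs
begin

text \<open>
  A braid is a piecewise-linear path in the space of configurations of \<open>n\<close> labelled points of the open
  square, from the base configuration to a permutation of it. An isotopy of braids is a homotopy of
  such paths relative to the endpoints, up to approximation by interpolation: see
  \<open>isotopy_iff_homotopic\<close>. So the group laws of braids are those of concatenation of paths.

  For string links, products are well defined because homeomorphisms of the two halves of the ball fit
  together, and associativity comes from a reparametrization of the coordinate \<open>x\<close>, damped to the
  identity near the sides of the ball. For the unit law a string link is first straightened near the
  right face, where it consists of finitely many segments transverse to the levels.

  Two facts relate isotopies and level-preserving homeomorphisms of the ball relative to its boundary.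
  Isotopy extension (\<open>homotopic_paths_imp_level_homeo\<close>): isotopic braids are carried to each other by
  such a homeomorphism. It is a composition of small explicit moves of single strands, and it shows that
  isotopic braids are equivalent string links. The Alexander trick (\<open>alexander_trick\<close>): conversely,
  such a homeomorphism does not change the isotopy class of a braid.

  For injectivity it suffices that a braid \<open>H(\<beta>\<^sub>e)\<close>, where \<open>\<beta>\<^sub>e\<close> is the trivial braid and \<open>H\<close> a
  homeomorphism relative to the boundary, is isotopic to \<open>\<beta>\<^sub>e\<close>. Its strands are straightened one at a
  time. Suppose that the first \<open>k\<close> are straight. The next strand of \<open>\<beta>\<^sub>e\<close> is homotopic in the complement of
  the first \<open>k\<close> to a path in the boundary, which \<open>H\<close> fixes; applying \<open>H\<close>, the next strand of
  \<open>H(\<beta>\<^sub>e)\<close> is homotopic to that of \<open>\<beta>\<^sub>e\<close> in the complement of \<open>k\<close> straight strands. Forgetting \<open>x\<close>, this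
  is a homotopy of loops in the square with \<open>k\<close> points removed (\<open>next_strand_homotopic\<close>), that is,
  an isotopy of the first \<open>k + 1\<close> strands, which extends to a level-preserving homeomorphism. Composed
  with \<open>H\<close>, it makes \<open>k + 1\<close> strands straight. When all strands are straight, the Alexander trick ends
  the proof.
\<close>

section \<open>Piecewise-linear maps\<close>

lemma pl_onE:
  assumes "pl_on S f"
  obtains \<C> where "finite \<C>" "\<And>C. C \<in> \<C> \<Longrightarrow> polytope C" "\<Union>\<C> = S"
    "\<And>C. C \<in> \<C> \<Longrightarrow> \<exists>A b. linear A \<and> (\<forall>x\<in>C. f x = A x + b)"
  using assms unfolding pl_on_def by metis

lemma polytope_affine_image:
  assumes "polytope C" "linear A"
  shows "polytope ((\<lambda>x. A x + b) ` C)"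
proof -
  have "(\<lambda>x. A x + b) ` C = (+) b ` (A ` C)"
    by (auto simp: image_iff add.commute)
  then show ?thesis
    using assms by (simp add: polytope_translation_eq polytope_linear_image)
qed

text \<open>
  The preimage is the projection of the intersection of \<open>C \<times> D\<close> with the graph of the affine map.
\<close>

lemma polytope_affine_preimage:
  fixes A :: "'a::euclidean_space \<Rightarrow> 'b::euclidean_space"
  assumes "polytope C" "polytope D" "linear A"
  shows "polytope {x \<in> C. A x + b \<in> D}"
proof -
  have lin: "linear (\<lambda>x. (x, A x))"
    using \<open>linear A\<close> by (auto simp: linear_iff)
  have "polytope ((\<lambda>x. (x, A x) + (0, b)) ` C \<inter> C \<times> D)"
    by (intro polytope_Int polytope_affine_image lin polytope_Times assms)
  then have "polytope (fst ` ((\<lambda>x. (x, A x) + (0, b)) ` C \<inter> C \<times> D))"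
    by (intro polytope_linear_image linear_fst)
  moreover have "fst ` ((\<lambda>x. (x, A x) + (0, b)) ` C \<inter> C \<times> D) = {x \<in> C. A x + b \<in> D}"
    by (force simp: image_iff)
  ultimately show ?thesis by simp
qed

lemma pl_on_cong: "pl_on S f \<Longrightarrow> (\<And>x. x \<in> S \<Longrightarrow> f x = g x) \<Longrightarrow> pl_on S g"
  unfolding pl_on_def
  by (metis UnionI)

lemma pl_on_compose:
  assumes f: "pl_on S f" and g: "pl_on T g" and ST: "\<And>x. x \<in> S \<Longrightarrow> f x \<in> T"
  shows "pl_on S (\<lambda>x. g (f x))"
proof -
  from f obtain \<C> where C: "finite \<C>" "\<And>C. C \<in> \<C> \<Longrightarrow> polytope C" "\<Union>\<C> = S"
    "\<And>C. C \<in> \<C> \<Longrightarrow> \<exists>A b. linear A \<and> (\<forall>x\<in>C. f x = A x + b)" by (rule pl_onE) (rule that; assumption)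
  from g obtain \<D> where D: "finite \<D>" "\<And>C. C \<in> \<D> \<Longrightarrow> polytope C" "\<Union>\<D> = T"
    "\<And>C. C \<in> \<D> \<Longrightarrow> \<exists>A b. linear A \<and> (\<forall>x\<in>C. g x = A x + b)" by (rule pl_onE) (rule that; assumption)
  let ?E = "(\<lambda>(C, D). {x \<in> C. f x \<in> D}) ` (\<C> \<times> \<D>)"
  show ?thesis
    unfolding pl_on_def
  proof (intro exI[of _ ?E] conjI ballI)
    show "finite ?E" using C D by simp
    show "\<Union>?E = S"
      using C(3) D(3) ST by (fastforce simp: image_iff)
  next
    fix P assume "P \<in> ?E"
    then obtain C1 D1 where P: "C1 \<in> \<C>" "D1 \<in> \<D>" "P = {x \<in> C1. f x \<in> D1}" by auto
    obtain A b where A: "linear A" "\<And>x. x \<in> C1 \<Longrightarrow> f x = A x + b" using C(4)[OF P(1)] by blast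
    obtain A' b' where A': "linear A'" "\<And>x. x \<in> D1 \<Longrightarrow> g x = A' x + b'"
      using D(4)[OF P(2)] by blast
    have "P = {x \<in> C1. A x + b \<in> D1}" using P A by auto
    then show "polytope P" using polytope_affine_preimage C(2) D(2) P A by metis
    show "\<exists>A b. linear A \<and> (\<forall>x\<in>P. g (f x) = A x + b)"
    proof (intro exI conjI ballI)
      show "linear (A' \<circ> A)" using A A' by (simp add: linear_compose)
      show "g (f x) = (A' \<circ> A) x + (A' b + b')" if "x \<in> P" for x
      proof -
        have x: "x \<in> C1" "f x \<in> D1" using that P by auto
        then have "g (f x) = A' (A x + b) + b'" using A'(2)[of "f x"] A(2) by simp
        then show ?thesis using linear_add[OF A'(1)] by simp
      qed
    qed
  qed
qed

lemma pl_on_Pair: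
  assumes f: "pl_on S f" and g: "pl_on S g"
  shows "pl_on S (\<lambda>x. (f x, g x))"
proof -
  from f obtain \<C> where C: "finite \<C>" "\<And>C. C \<in> \<C> \<Longrightarrow> polytope C" "\<Union>\<C> = S"
    "\<And>C. C \<in> \<C> \<Longrightarrow> \<exists>A b. linear A \<and> (\<forall>x\<in>C. f x = A x + b)" by (rule pl_onE) (rule that; assumption)
  from g obtain \<D> where D: "finite \<D>" "\<And>C. C \<in> \<D> \<Longrightarrow> polytope C" "\<Union>\<D> = S"
    "\<And>C. C \<in> \<D> \<Longrightarrow> \<exists>A b. linear A \<and> (\<forall>x\<in>C. g x = A x + b)" by (rule pl_onE) (rule that; assumption)
  let ?E = "(\<lambda>(C, D). C \<inter> D) ` (\<C> \<times> \<D>)"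
  show ?thesis
    unfolding pl_on_def
  proof (intro exI[of _ ?E] conjI ballI)
    show "finite ?E" using C D by simp
    show "\<Union>?E = S"
    proof
      show "\<Union>?E \<subseteq> S" using C(3) by auto
      show "S \<subseteq> \<Union>?E"
      proof
        fix x assume "x \<in> S"
        then obtain C1 D1 where "C1 \<in> \<C>" "x \<in> C1" "D1 \<in> \<D>" "x \<in> D1" using C(3) D(3) by blast
        then show "x \<in> \<Union>?E" by (intro UnionI[of "C1 \<inter> D1"]) auto
      qed
    qed
  next
    fix P assume "P \<in> ?E"
    then obtain C1 D1 where P: "C1 \<in> \<C>" "D1 \<in> \<D>" "P = C1 \<inter> D1" by auto
    obtain A b where A: "linear A" "\<And>x. x \<in> C1 \<Longrightarrow> f x = A x + b" using C(4)[OF P(1)] by blast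
    obtain A' b' where A': "linear A'" "\<And>x. x \<in> D1 \<Longrightarrow> g x = A' x + b'"
      using D(4)[OF P(2)] by blast
    show "polytope P" using C(2) D(2) P polytope_Int by metis
    show "\<exists>B c. linear B \<and> (\<forall>x\<in>P. (f x, g x) = B x + c)"
    proof (intro exI conjI ballI)
      show "linear (\<lambda>x. (A x, A' x))" using A A' by (auto simp: linear_iff)
      show "(f x, g x) = (A x, A' x) + (b, b')" if "x \<in> P" for x
        using that P A A' by simp
    qed
  qed
qed

lemma pl_on_linear_compose:
  assumes f: "pl_on S f" and L: "linear L"
  shows "pl_on S (\<lambda>x. L (f x) + c)"
proof -
  from f obtain \<C> where C: "finite \<C>" "\<And>C. C \<in> \<C> \<Longrightarrow> polytope C" "\<Union>\<C> = S"
    "\<And>C. C \<in> \<C> \<Longrightarrow> \<exists>A b. linear A \<and> (\<forall>x\<in>C. f x = A x + b)" by (rule pl_onE) (rule that; assumption)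
  have "\<exists>A' b'. linear A' \<and> (\<forall>x\<in>C. L (f x) + c = A' x + b')" if C': "C \<in> \<C>" for C
  proof -
    obtain A b where A: "linear A" "\<And>x. x \<in> C \<Longrightarrow> f x = A x + b" using C(4)[OF C'] by blast
    show ?thesis
    proof (intro exI conjI ballI)
      show "linear (L \<circ> A)" using A L by (simp add: linear_compose)
      show "L (f x) + c = (L \<circ> A) x + (L b + c)" if "x \<in> C" for x
        using that A L by (simp add: linear_add)
    qed
  qed
  then show ?thesis unfolding pl_on_def using C by blast
qed

lemma pl_on_affine_polytope: "polytope S \<Longrightarrow> linear A \<Longrightarrow> pl_on S (\<lambda>x. A x + b)"
  unfolding pl_on_def by (intro exI[of _ "{S}"]) auto

lemma pl_on_const_polytope: "polytope S \<Longrightarrow> pl_on S (\<lambda>x. c)"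
  using pl_on_affine_polytope[of S "\<lambda>x. 0" c] by (simp add: linear_zero)

lemma pl_on_linear_polytope: "polytope S \<Longrightarrow> linear A \<Longrightarrow> pl_on S A"
  using pl_on_affine_polytope[of S A 0] by simp

lemma pl_on_ident: "polytope S \<Longrightarrow> pl_on S (\<lambda>x. x)"
  by (rule pl_on_linear_polytope) (auto intro: linear_ident)

lemma pl_on_const: "pl_on S f \<Longrightarrow> pl_on S (\<lambda>x. c)"
  using pl_on_linear_compose[of S f "\<lambda>x. 0" c] by (simp add: linear_zero)

lemma pl_on_scaleR: "pl_on S f \<Longrightarrow> pl_on S (\<lambda>x. c *\<^sub>R f x)"
  using pl_on_linear_compose[of S f "\<lambda>x. c *\<^sub>R x" 0] by (simp add: linear_scaleR)

lemma pl_on_scaleR_left: "pl_on S f \<Longrightarrow> pl_on S (\<lambda>x. f x *\<^sub>R c)"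
  using pl_on_linear_compose[of S f "\<lambda>x. x *\<^sub>R c" 0]
  by (simp add: linear_iff scaleR_add_left)

lemma pl_on_mult: "pl_on S f \<Longrightarrow> pl_on S (\<lambda>x. c * f x :: real)"
  using pl_on_scaleR[of S f c] by simp

lemma pl_on_minus: "pl_on S f \<Longrightarrow> pl_on S (\<lambda>x. - f x)"
  using pl_on_scaleR[of S f "-1"] by simp

lemma pl_on_fst: "pl_on S f \<Longrightarrow> pl_on S (\<lambda>x. fst (f x))"
  using pl_on_linear_compose[of S f fst 0] by (simp add: linear_fst)

lemma pl_on_snd: "pl_on S f \<Longrightarrow> pl_on S (\<lambda>x. snd (f x))"
  using pl_on_linear_compose[of S f snd 0] by (simp add: linear_snd)

lemma pl_on_add: "pl_on S f \<Longrightarrow> pl_on S g \<Longrightarrow> pl_on S (\<lambda>x. f x + g x)"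
  using pl_on_linear_compose[OF pl_on_Pair, of S f g "\<lambda>z. fst z + snd z" 0]
  by (simp add: linear_iff algebra_simps)

lemma pl_on_diff: "pl_on S f \<Longrightarrow> pl_on S g \<Longrightarrow> pl_on S (\<lambda>x. f x - g x)"
  using pl_on_add[of S f "\<lambda>x. - g x"] pl_on_minus[of S g] by simp

lemma pl_on_sum:
  assumes "finite J" "pl_on S h" "\<And>j. j \<in> J \<Longrightarrow> pl_on S (f j)"
  shows "pl_on S (\<lambda>x. \<Sum>j\<in>J. f j x)"
  using assms(1,3)
proof (induction J rule: finite_induct)
  case empty
  show ?case using pl_on_const[OF assms(2)] by simp
next
  case (insert j J)
  then show ?case using pl_on_add[of S "f j"] by simp
qed

lemma pl_on_imp_compact: "pl_on S f \<Longrightarrow> compact S"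
  unfolding pl_on_def by (metis compact_Union polytope_imp_compact)

lemma pl_on_imp_continuous_on:
  assumes "pl_on S f" shows "continuous_on S f"
proof -
  from assms obtain \<C> where C: "finite \<C>" "\<And>C. C \<in> \<C> \<Longrightarrow> polytope C" "\<Union>\<C> = S"
    "\<And>C. C \<in> \<C> \<Longrightarrow> \<exists>A b. linear A \<and> (\<forall>x\<in>C. f x = A x + b)" by (rule pl_onE) (rule that; assumption)
  have "continuous_on (\<Union>C\<in>\<C>. C) f"
  proof (rule continuous_on_closed_Union)
    show "continuous_on C f" if C': "C \<in> \<C>" for C
    proof -
      obtain A b where A: "linear A" "\<And>x. x \<in> C \<Longrightarrow> f x = A x + b" using C(4)[OF C'] by blast
      have "continuous_on C (\<lambda>x. A x + b)"
        by (intro continuous_intros linear_continuous_on A linear_conv_bounded_linear[THEN iffD1])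
      then show ?thesis using A by (simp cong: continuous_on_cong)
    qed
  qed (use C polytope_imp_closed in auto)
  then show ?thesis using C(3) by simp
qed

lemma pl_on_Un:
  assumes "pl_on S f" "pl_on T f" shows "pl_on (S \<union> T) f"
proof -
  from assms(1) obtain \<C> where C: "finite \<C>" "\<And>C. C \<in> \<C> \<Longrightarrow> polytope C" "\<Union>\<C> = S"
    "\<And>C. C \<in> \<C> \<Longrightarrow> \<exists>A b. linear A \<and> (\<forall>x\<in>C. f x = A x + b)" by (rule pl_onE) (rule that; assumption)
  from assms(2) obtain \<D> where D: "finite \<D>" "\<And>C. C \<in> \<D> \<Longrightarrow> polytope C" "\<Union>\<D> = T"
    "\<And>C. C \<in> \<D> \<Longrightarrow> \<exists>A b. linear A \<and> (\<forall>x\<in>C. f x = A x + b)" by (rule pl_onE) (rule that; assumption)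
  show ?thesis unfolding pl_on_def
    by (rule exI[of _ "\<C> \<union> \<D>"]) (use C D in blast)
qed

lemma polytope_interval_real: "polytope {a..b::real}"
  using polytope_interval[of a b] by simp

lemma pl_on_reverse:
  fixes f :: "real \<Rightarrow> 'a::euclidean_space"
  assumes "pl_on {0..1} f" shows "pl_on {0..1} (\<lambda>x. f (1 - x))"
proof -
  have "pl_on {0..1} (\<lambda>x::real. -1 *\<^sub>R x + 1)"
    by (intro pl_on_affine_polytope polytope_interval_real linear_scaleR)
  from pl_on_compose[OF this assms] show ?thesis by simp
qed

lemma pl_on_abs:
  fixes f :: "'a::euclidean_space \<Rightarrow> real"
  assumes "pl_on S f" shows "pl_on S (\<lambda>x. \<bar>f x\<bar>)"
proof -
  have "bounded (f ` S)"
    by (intro compact_imp_bounded compact_continuous_image pl_on_imp_continuous_on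
        pl_on_imp_compact[OF assms] assms)
  then obtain M where M: "\<And>x. x \<in> S \<Longrightarrow> \<bar>f x\<bar> \<le> M" by (auto simp: bounded_iff)
  have "pl_on {-M..0} (\<lambda>x. -1 *\<^sub>R x)"
    by (intro pl_on_linear_polytope polytope_interval_real linear_scaleR)
  then have 1: "pl_on {-M..0} abs" by (rule pl_on_cong) auto
  have "pl_on {0..M} (\<lambda>x. x)"
    by (rule pl_on_ident[OF polytope_interval_real])
  then have 2: "pl_on {0..M} abs" by (rule pl_on_cong) auto
  have "f x \<in> {-M..0} \<union> {0..M}" if "x \<in> S" for x using M[OF that] by auto
  then show ?thesis using pl_on_compose[OF assms pl_on_Un[OF 1 2]] by blast
qed

lemma pl_on_max:
  fixes f :: "'a::euclidean_space \<Rightarrow> real"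
  assumes "pl_on S f" "pl_on S g" shows "pl_on S (\<lambda>x. max (f x) (g x))"
proof -
  have "pl_on S (\<lambda>x. (1/2) * (f x + g x + \<bar>f x - g x\<bar>))"
    by (intro pl_on_mult pl_on_add pl_on_abs pl_on_diff assms)
  then show ?thesis by (rule pl_on_cong) (auto simp: max_def abs_if)
qed

lemma pl_on_min:
  fixes f :: "'a::euclidean_space \<Rightarrow> real"
  assumes "pl_on S f" "pl_on S g" shows "pl_on S (\<lambda>x. min (f x) (g x))"
  using pl_on_minus[OF pl_on_max[OF pl_on_minus pl_on_minus, OF assms]]
  by (rule pl_on_cong) (auto simp: max_def min_def)

lemmas pl_intros = pl_on_Pair pl_on_scaleR pl_on_scaleR_left pl_on_mult pl_on_minus pl_on_fst
  pl_on_snd pl_on_add pl_on_diff pl_on_abs pl_on_max pl_on_min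

text \<open>
  On a piece \<open>C\<close> with affine map \<open>x \<mapsto> A x + b\<close>, injectivity on \<open>C\<close> forces \<open>A\<close> to be injective on
  the span of the differences of points of \<open>C\<close>, so \<open>A\<close> has a linear left inverse there even
  if \<open>C\<close> is not full-dimensional.
\<close>

lemma affine_inj_left_inverse:
  fixes A :: "'a::euclidean_space \<Rightarrow> 'b::euclidean_space"
  assumes "convex C" and A: "linear A" and inj: "inj_on (\<lambda>x. A x + b) C"
  shows "\<exists>B c. linear B \<and> (\<forall>x\<in>C. B (A x + b) + c = x)"
proof (cases "C = {}")
  case True
  then show ?thesis using linear_zero by blast
next
  case False
  then obtain a where a: "a \<in> rel_interior C"
    using rel_interior_eq_empty[OF \<open>convex C\<close>] by blast
  then have aC: "a \<in> C" using rel_interior_subset by blast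
  let ?V = "span ((\<lambda>x. x - a) ` C)"
  have "inj_on A ?V"
  proof (subst linear_inj_on_iff_eq_0[OF A], simp, intro ballI impI)
    fix v assume v: "v \<in> ?V" "A v = 0"
    have aff: "affine hull C = (\<lambda>x. a + x) ` ?V"
      using affine_hull_span_gen[of a C] aC hull_inc[of a C affine]
      by (simp add: image_image)
    obtain e where e: "e > 0" "ball a e \<inter> affine hull C \<subseteq> C"
      using a by (auto simp: mem_rel_interior_ball)
    define s where "s = e / (2 * (norm v + 1))"
    have nv: "norm v + 1 > 0" by (simp add: add_nonneg_pos)
    then have s: "s > 0" "s * (norm v + 1) = e / 2"
      using e by (simp_all add: s_def nonzero_divide_eq_eq nonzero_eq_divide_eq)
    then have "s * norm v < e" using e by (simp add: algebra_simps)
    have "a + s *\<^sub>R v \<in> C"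
    proof -
      have "a + s *\<^sub>R v \<in> ball a e" using s \<open>s * norm v < e\<close> by (simp add: dist_norm)
      moreover have "a + s *\<^sub>R v \<in> affine hull C" using v span_scale[of v _ s] by (auto simp: aff)
      ultimately show ?thesis using e by blast
    qed
    moreover have "A (a + s *\<^sub>R v) + b = A a + b"
      using v A by (simp add: linear_add linear_scale)
    ultimately have "a + s *\<^sub>R v = a" using inj_onD[OF inj] aC by blast
    then show "v = 0" using s by simp
  qed
  then obtain B where B: "linear B" "\<And>v. v \<in> ?V \<Longrightarrow> B (A v) = v"
    using linear_exists_left_inverse_on[OF A subspace_span] by blast
  have "B (A x + b) + (a - B (A a + b)) = x" if "x \<in> C" for x
  proof -
    have "x - a \<in> ?V" using that by (intro span_base) auto
    then have "B (A (x - a)) = x - a" using B by simp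
    then show ?thesis using A B by (simp add: linear_diff linear_add algebra_simps)
  qed
  then show ?thesis using B by blast
qed

lemma pl_on_inverse:
  fixes f :: "'a::euclidean_space \<Rightarrow> 'b::euclidean_space"
  assumes f: "pl_on S f" and k: "\<And>x. x \<in> S \<Longrightarrow> k (f x) = x"
  shows "pl_on (f ` S) k"
proof -
  from f obtain \<C> where C: "finite \<C>" "\<And>C. C \<in> \<C> \<Longrightarrow> polytope C" "\<Union>\<C> = S"
    "\<And>C. C \<in> \<C> \<Longrightarrow> \<exists>A b. linear A \<and> (\<forall>x\<in>C. f x = A x + b)" by (rule pl_onE) (rule that; assumption)
  show ?thesis unfolding pl_on_def
  proof (intro exI[of _ "(`) f ` \<C>"] conjI ballI)
    show "finite ((`) f ` \<C>)" "\<Union> ((`) f ` \<C>) = f ` S" using C by auto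
    fix P assume "P \<in> (`) f ` \<C>"
    then obtain C1 where C1: "C1 \<in> \<C>" "P = f ` C1" by auto
    obtain A b where A: "linear A" "\<And>x. x \<in> C1 \<Longrightarrow> f x = A x + b" using C(4)[OF C1(1)] by blast
    have P: "P = (\<lambda>x. A x + b) ` C1" using C1 A by force
    then show "polytope P" using polytope_affine_image C(2)[OF C1(1)] A by blast
    have "inj_on (\<lambda>x. A x + b) C1"
      by (rule inj_on_inverseI[of _ k]) (use A C1 C(3) k in force)
    then obtain B c where B: "linear B" "\<forall>x\<in>C1. B (A x + b) + c = x"
      using affine_inj_left_inverse[OF polytope_imp_convex[OF C(2)[OF C1(1)]] A(1)] by blast
    have "k y = B y + c" if "y \<in> P" for y
      using that C1 A B C(3) k by force
    then show "\<exists>B c. linear B \<and> (\<forall>y\<in>P. k y = B y + c)" using B by blast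
  qed
qed

lemma pl_homeomorphism_ident:
  assumes "polytope S" shows "pl_homeomorphism S S (\<lambda>x. x) (\<lambda>x. x)"
  using assms pl_on_linear_polytope[OF assms linear_ident]
  by (auto simp: pl_homeomorphism_def homeomorphism_def)

lemma pl_homeomorphism_sym: "pl_homeomorphism S T f g \<Longrightarrow> pl_homeomorphism T S g f"
  unfolding pl_homeomorphism_def using homeomorphism_symD by blast

lemma pl_homeomorphism_compose:
  assumes "pl_homeomorphism S T f g" "pl_homeomorphism T U h k"
  shows "pl_homeomorphism S U (\<lambda>x. h (f x)) (\<lambda>x. g (k x))"
proof -
  have "homeomorphism S U (h \<circ> f) (g \<circ> k)"
    using assms homeomorphism_compose unfolding pl_homeomorphism_def by blast
  moreover have "pl_on S (\<lambda>x. h (f x))" "pl_on U (\<lambda>x. g (k x))"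
    using assms unfolding pl_homeomorphism_def homeomorphism_def
    by (auto intro!: pl_on_compose[of _ _ T])
  ultimately show ?thesis by (simp add: pl_homeomorphism_def o_def)
qed

lemma pl_homeomorphismI:
  fixes f :: "'a::euclidean_space \<Rightarrow> 'b::euclidean_space"
  assumes "pl_on S f" "f ` S = T" "inj_on f S"
  shows "pl_homeomorphism S T f (inv_into S f)"
proof -
  have k: "pl_on T (inv_into S f)"
    using pl_on_inverse[OF assms(1), of "inv_into S f"] assms by auto
  have "inv_into S f ` T = S" using assms inv_into_image_cancel[of f S S] by auto
  then have "homeomorphism S T f (inv_into S f)"
    using assms pl_on_imp_continuous_on[OF k] pl_on_imp_continuous_on[OF assms(1)]
    by (intro homeomorphismI) (auto simp: f_inv_into_f)
  then show ?thesis using k assms(1) by (simp add: pl_homeomorphism_def)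
qed

text \<open>
  If \<open>f\<close> missed an interior point, a radial retraction of the complement of that point onto the
  frontier could be composed with \<open>f\<close>, giving a retraction of \<open>S\<close> onto its frontier.
\<close>

lemma image_eq_if_frontier_fixed:
  fixes f :: "'a::euclidean_space \<Rightarrow> 'a"
  assumes S: "compact S" "convex S" and f: "continuous_on S f" "f ` S \<subseteq> S"
    and fixed: "\<And>x. x \<in> frontier S \<Longrightarrow> f x = x"
  shows "f ` S = S"
proof (rule ccontr)
  assume "f ` S \<noteq> S"
  then obtain c where c: "c \<in> S" "c \<notin> f ` S" using f by blast
  have fr: "frontier S \<subseteq> S" using S by (simp add: compact_imp_closed frontier_subset_closed)
  have cint: "c \<in> interior S"
    using c fixed fr by (metis Diff_iff S(1) closure_closed compact_imp_closed frontier_def imageI)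
  then have ne: "interior S \<noteq> {}" by blast
  have ri: "rel_interior S = interior S" using ne by (rule rel_interior_nonempty_interior)
  have ah: "affine hull S = UNIV" using ne by (rule affine_hull_nonempty_interior)
  have "frontier S retract_of (UNIV - {c})"
    using rel_frontier_retract_of_punctured_affine_hull[of S c] S cint ri ah
    by (simp add: compact_imp_bounded rel_frontier_def frontier_def)
  then obtain r where r: "continuous_on (UNIV - {c}) r" "r ` (UNIV - {c}) \<subseteq> frontier S"
    "\<And>x. x \<in> frontier S \<Longrightarrow> r x = x"
    unfolding retract_of_def retraction_def by (auto simp: image_subset_iff_funcset)
  have "S \<subseteq> frontier S"
  proof (rule frontier_subset_retraction[where f = "r \<circ> f"])
    show "bounded S" using S compact_imp_bounded by blast
    have "f ` S \<subseteq> UNIV - {c}" using c by auto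
    then show "continuous_on (closure S) (r \<circ> f)"
      using S f r by (metis closure_closed compact_imp_closed continuous_on_compose continuous_on_subset)
    show "r \<circ> f \<in> S \<rightarrow> frontier S" using r c by (auto simp: image_subset_iff)
    show "(r \<circ> f) x = x" if "x \<in> frontier S" for x using that r fixed by simp
  qed simp
  then show False using c cint by (auto simp: frontier_def)
qed

lemma pl_homeomorphism_frontierI:
  fixes f :: "'a::euclidean_space \<Rightarrow> 'a"
  assumes S: "polytope S" and f: "pl_on S f" "f ` S \<subseteq> S" "inj_on f S"
    and fixed: "\<And>x. x \<in> frontier S \<Longrightarrow> f x = x"
  shows "pl_homeomorphism S S f (inv_into S f)"
proof -
  have "f ` S = S"
    using image_eq_if_frontier_fixed[of S f] assms polytope_imp_compact polytope_imp_convex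
      pl_on_imp_continuous_on by blast
  with f show ?thesis by (intro pl_homeomorphismI) auto
qed

section \<open>Level-preserving homeomorphisms that move strands\<close>

text \<open>
  The interior of a level of the ball, in the coordinates \<open>(y, z)\<close>.
\<close>

definition open_square :: "(real \<times> real) set" where
  "open_square = {0<..<1} \<times> {0<..<1}"

lemma polytope_tangle_ball: "polytope tangle_ball"
  unfolding tangle_ball_def by (intro polytope_Times polytope_interval_real)

lemma mem_tangle_ball: "(x, q) \<in> tangle_ball \<longleftrightarrow> x \<in> {0..1} \<and> q \<in> {0..1} \<times> {0..1}"
  by (simp add: tangle_ball_def)

lemma interior_tangle_ball: "interior tangle_ball = {0<..<1} \<times> open_square"
  by (simp add: tangle_ball_def open_square_def interior_Times)

lemma closure_tangle_ball: "closure tangle_ball = tangle_ball"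
  by (simp add: polytope_tangle_ball polytope_imp_closed)

lemma mem_frontier_tangle_ball:
  "(x, q) \<in> frontier tangle_ball \<longleftrightarrow> (x, q) \<in> tangle_ball \<and> (x = 0 \<or> x = 1 \<or> q \<notin> open_square)"
  by (auto simp: frontier_def closure_tangle_ball interior_tangle_ball mem_tangle_ball)

lemma frontier_tangle_ball_subset: "frontier tangle_ball \<subseteq> tangle_ball"
  by (simp add: frontier_def closure_tangle_ball)

lemma tangle_ballI: "x \<in> {0..1} \<Longrightarrow> q \<in> open_square \<Longrightarrow> (x, q) \<in> tangle_ball"
  by (cases q) (auto simp: mem_tangle_ball open_square_def)

text \<open>The piecewise-linear norm of the plane used to measure distances within a level.\<close>

definition l1 :: "real \<times> real \<Rightarrow> real" where
  "l1 q = \<bar>fst q\<bar> + \<bar>snd q\<bar>"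

lemma l1_zero [simp]: "l1 0 = 0" and l1_nonneg [simp]: "l1 q \<ge> 0"
  by (simp_all add: l1_def)

lemma l1_eq_0: "l1 q \<le> 0 \<Longrightarrow> q = 0"
  by (auto simp: l1_def prod_eq_iff)

lemma l1_minus_commute: "l1 (p - q) = l1 (q - p)"
  by (simp add: l1_def abs_minus_commute)

lemma l1_triangle: "l1 (p - r) \<le> l1 (p - q) + l1 (q - r)"
  by (simp add: l1_def)

lemma l1_le_norm: "l1 q \<le> 2 * norm q"
proof -
  have "\<bar>fst q\<bar> \<le> norm q" "\<bar>snd q\<bar> \<le> norm q"
    using norm_fst_le[of "fst q" "snd q"] norm_snd_le[of "snd q" "fst q"] by auto
  then show ?thesis by (simp add: l1_def)
qed

lemma norm_le_l1: "norm q \<le> l1 q"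
  using norm_Pair_le[of "fst q" "snd q"] by (simp add: l1_def)

text \<open>
  Soft thresholding: \<open>clip c\<close> shrinks a real number towards \<open>0\<close> by \<open>c\<close>. As a function of \<open>c\<close> it is
  \<open>1\<close>-Lipschitz, which makes \<open>push\<close> below injective.
\<close>

definition clip :: "real \<Rightarrow> real \<Rightarrow> real" where
  "clip c t = max 0 (t - c) - max 0 (- t - c)"

lemma clip_0 [simp]: "clip 0 t = t"
  by (auto simp: clip_def max_def)

lemma clip_eq_0: "\<bar>t\<bar> \<le> c \<Longrightarrow> clip c t = 0"
  by (auto simp: clip_def)

lemma abs_clip_le: "c \<ge> 0 \<Longrightarrow> \<bar>clip c t\<bar> \<le> \<bar>t\<bar>"
  by (auto simp: clip_def max_def)

lemma clip_lipschitz: "c \<ge> 0 \<Longrightarrow> c' \<ge> 0 \<Longrightarrow> \<bar>clip c t - clip c' t\<bar> \<le> \<bar>c - c'\<bar>"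
  by (auto simp: clip_def max_def)

text \<open>
  \<open>push a b\<close> is a piecewise-linear injection of the plane into itself that takes \<open>a\<close> to \<open>b\<close> and
  moves only points \<open>q\<close> with \<open>l1 (q - a) < 4 * l1 (b - a)\<close>. It differs from the identity by a map
  that has Lipschitz constant \<open>1/2\<close> for \<open>l1\<close>, each coordinate contributing \<open>1/4\<close>.
\<close>

definition push :: "real \<times> real \<Rightarrow> real \<times> real \<Rightarrow> real \<times> real \<Rightarrow> real \<times> real" where
  "push a b q = q + (clip (l1 (q - a) / 4) (fst (b - a)), clip (l1 (q - a) / 4) (snd (b - a)))"

lemma push_center [simp]: "push a b a = b"
  by (simp add: push_def prod_eq_iff)

lemma push_same [simp]: "push a a q = q"
  by (simp add: push_def clip_eq_0 prod_eq_iff)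

lemma push_far:
  assumes "4 * l1 (b - a) \<le> l1 (q - a)" shows "push a b q = q"
proof -
  have "\<bar>u\<bar> \<le> r / 4" "\<bar>v\<bar> \<le> r / 4" if "4 * (\<bar>u\<bar> + \<bar>v\<bar>) \<le> r" for u v r :: real
    using that by auto
  with assms have "\<bar>fst (b - a)\<bar> \<le> l1 (q - a) / 4" "\<bar>snd (b - a)\<bar> \<le> l1 (q - a) / 4"
    unfolding l1_def by blast+
  then show ?thesis by (simp only: push_def clip_eq_0) (simp add: prod_eq_iff)
qed

lemma l1_push_diff: "l1 (push a b q - q) \<le> l1 (b - a)"
proof -
  have "\<bar>clip (l1 (q - a) / 4) t\<bar> \<le> \<bar>t\<bar>" for t by (rule abs_clip_le) simp
  from add_mono[OF this this] show ?thesis by (simp add: push_def l1_def)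
qed

lemma push_inj:
  assumes "push a b q = push a b q'" shows "q = q'"
proof -
  let ?c = "l1 (q - a) / 4" and ?c' = "l1 (q' - a) / 4"
  have L: "\<bar>clip ?c t - clip ?c' t\<bar> \<le> l1 (q - q') / 4" for t
  proof -
    have "\<bar>clip ?c t - clip ?c' t\<bar> \<le> \<bar>?c - ?c'\<bar>" by (rule clip_lipschitz) auto
    also have "\<dots> \<le> l1 (q - q') / 4"
      using l1_triangle[of q a q'] l1_triangle[of q' a q] l1_minus_commute[of q q'] by linarith
    finally show ?thesis .
  qed
  have "fst q - fst q' = clip ?c' (fst (b - a)) - clip ?c (fst (b - a))"
    "snd q - snd q' = clip ?c' (snd (b - a)) - clip ?c (snd (b - a))"
    using assms by (auto simp: push_def prod_eq_iff)
  then have "l1 (q - q') \<le> l1 (q - q') / 4 + l1 (q - q') / 4"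
    using L[of "fst (b - a)"] L[of "snd (b - a)"] by (simp add: l1_def abs_minus_commute)
  then show ?thesis using l1_eq_0[of "q - q'"] by simp
qed

lemma pl_on_l1: "pl_on S f \<Longrightarrow> pl_on S (\<lambda>x. l1 (f x))"
  unfolding l1_def by (intro pl_intros)

lemma pl_on_clip: "pl_on S c \<Longrightarrow> pl_on S t \<Longrightarrow> pl_on S (\<lambda>x. clip (c x) (t x))"
  unfolding clip_def by (intro pl_on_diff pl_on_max pl_on_minus pl_on_const[of S t 0])

lemma pl_on_push:
  assumes "pl_on S a" "pl_on S b" "pl_on S q"
  shows "pl_on S (\<lambda>x. push (a x) (b x) (q x))"
proof -
  have "pl_on S (\<lambda>x. (1/4) * l1 (q x - a x))" by (intro pl_intros pl_on_l1 assms)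
  then have "pl_on S (\<lambda>x. l1 (q x - a x) / 4)" by simp
  then show ?thesis unfolding push_def by (intro pl_intros pl_on_clip assms)
qed

text \<open>
  \<open>rel_homeo h k\<close>: \<open>h\<close> is a piecewise-linear self-homeomorphism of the ball with inverse \<open>k\<close> that
  fixes the boundary pointwise. For \<open>level_homeo h k\<close> it also maps each level
  \<open>x = const\<close> to itself, so that it maps braids to braids.
\<close>

definition rel_homeo :: "(point \<Rightarrow> point) \<Rightarrow> (point \<Rightarrow> point) \<Rightarrow> bool" where
  "rel_homeo h k \<longleftrightarrow> pl_homeomorphism tangle_ball tangle_ball h k \<and> (\<forall>p\<in>frontier tangle_ball. h p = p)"

definition level_homeo :: "(point \<Rightarrow> point) \<Rightarrow> (point \<Rightarrow> point) \<Rightarrow> bool" where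
  "level_homeo h k \<longleftrightarrow> rel_homeo h k \<and> (\<forall>p\<in>tangle_ball. fst (h p) = fst p)"

lemma rel_homeo_ident: "rel_homeo (\<lambda>p. p) (\<lambda>p. p)"
  by (simp add: rel_homeo_def pl_homeomorphism_ident polytope_tangle_ball)

lemma rel_homeo_compose:
  "rel_homeo h k \<Longrightarrow> rel_homeo h' k' \<Longrightarrow> rel_homeo (\<lambda>p. h' (h p)) (\<lambda>p. k (k' p))"
  unfolding rel_homeo_def using pl_homeomorphism_compose by fastforce

lemma rel_homeo_sym: assumes "rel_homeo h k" shows "rel_homeo k h"
proof -
  have "k p = p" if "p \<in> frontier tangle_ball" for p
    using assms that frontier_tangle_ball_subset
    unfolding rel_homeo_def pl_homeomorphism_def homeomorphism_def by (metis subsetD)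
  then show ?thesis using assms by (auto simp: rel_homeo_def pl_homeomorphism_sym)
qed

lemma rel_homeo_image: "rel_homeo h k \<Longrightarrow> h ` tangle_ball = tangle_ball"
  by (simp add: rel_homeo_def pl_homeomorphism_def homeomorphism_def)

lemma rel_homeo_mem: "rel_homeo h k \<Longrightarrow> p \<in> tangle_ball \<Longrightarrow> h p \<in> tangle_ball"
  using rel_homeo_image by blast

lemma rel_homeo_inv: "rel_homeo h k \<Longrightarrow> p \<in> tangle_ball \<Longrightarrow> k (h p) = p"
  by (simp add: rel_homeo_def pl_homeomorphism_def homeomorphism_def)

lemma rel_homeo_inj_on: "rel_homeo h k \<Longrightarrow> inj_on h tangle_ball"
  by (rule inj_on_inverseI[of _ k]) (rule rel_homeo_inv)

lemma rel_homeo_pl: "rel_homeo h k \<Longrightarrow> pl_on tangle_ball h"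
  by (simp add: rel_homeo_def pl_homeomorphism_def)

lemma rel_homeo_frontier: "rel_homeo h k \<Longrightarrow> p \<in> frontier tangle_ball \<Longrightarrow> h p = p"
  by (simp add: rel_homeo_def)

lemma rel_homeoI:
  assumes "pl_on tangle_ball h" "h ` tangle_ball \<subseteq> tangle_ball" "inj_on h tangle_ball"
    "\<And>p. p \<in> frontier tangle_ball \<Longrightarrow> h p = p"
  shows "rel_homeo h (inv_into tangle_ball h)"
  unfolding rel_homeo_def using pl_homeomorphism_frontierI[OF polytope_tangle_ball assms] assms by auto

lemma level_homeo_ident: "level_homeo (\<lambda>p. p) (\<lambda>p. p)"
  by (simp add: level_homeo_def rel_homeo_ident)

lemma level_homeo_compose:
  "level_homeo h k \<Longrightarrow> level_homeo h' k' \<Longrightarrow> level_homeo (\<lambda>p. h' (h p)) (\<lambda>p. k (k' p))"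
  unfolding level_homeo_def using rel_homeo_compose rel_homeo_mem by metis

text \<open>
  A strand that is the graph of \<open>a\<close> is moved to a nearby graph \<open>b\<close> by applying \<open>push (a x) (b x)\<close>
  in the level \<open>x\<close>. Points at distance at least \<open>4 * e\<close> from the strand do not move, and the others
  stay within distance \<open>5 * e\<close> of it, hence in the open square.
\<close>

lemma move_strand:
  assumes a: "pl_on {0..1} a" and b: "pl_on {0..1} b" and "e > 0"
    and ab: "\<And>x. x \<in> {0..1} \<Longrightarrow> l1 (b x - a x) \<le> e"
    and room: "\<And>x r. x \<in> {0..1} \<Longrightarrow> l1 (r - a x) < 5 * e \<Longrightarrow> r \<in> open_square"
    and ends: "a 0 = b 0" "a 1 = b 1"
  shows "\<exists>h k. level_homeo h k \<and> (\<forall>x\<in>{0..1}. h (x, a x) = (x, b x)) \<and>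
    (\<forall>x\<in>{0..1}. \<forall>q. 4 * e \<le> l1 (q - a x) \<longrightarrow> h (x, q) = (x, q))"
proof -
  define h where "h = (\<lambda>p::point. (fst p, push (a (fst p)) (b (fst p)) (snd p)))"
  have far: "h (x, q) = (x, q)" if "x \<in> {0..1}" "4 * e \<le> l1 (q - a x)" for x q
    using push_far[of "b x" "a x" q] ab[OF that(1)] that(2) by (simp add: h_def)
  have fst: "pl_on tangle_ball fst" "pl_on tangle_ball snd"
    using polytope_tangle_ball by (auto intro!: pl_on_linear_polytope linear_fst linear_snd)
  have "rel_homeo h (inv_into tangle_ball h)"
  proof (rule rel_homeoI)
    show "pl_on tangle_ball h" unfolding h_def
      by (intro pl_on_Pair pl_on_push fst pl_on_compose[OF fst(1) a] pl_on_compose[OF fst(1) b])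
        (auto simp: tangle_ball_def)
    show "inj_on h tangle_ball"
    proof (rule inj_onI)
      fix p p' assume "h p = h p'"
      then have "fst p = fst p'" "snd p = snd p'" by (auto simp: h_def dest: push_inj)
      then show "p = p'" by (rule prod_eqI)
    qed
    show "h ` tangle_ball \<subseteq> tangle_ball"
    proof (rule image_subsetI)
      fix p assume "p \<in> tangle_ball"
      moreover obtain x y z where "p = (x, y, z)" by (rule prod_cases3)
      ultimately have p: "(x, y, z) \<in> tangle_ball" "p = (x, y, z)" by simp_all
      then have x: "x \<in> {0..1}" by (simp add: tangle_ball_def)
      have "h (x, y, z) \<in> tangle_ball"
      proof (cases "4 * e \<le> l1 ((y, z) - a x)")
        case True
        then show ?thesis using far[OF x] p by simp
      next
        case False
        let ?q = "push (a x) (b x) (y, z)"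
        have "l1 (?q - a x) \<le> l1 (?q - (y, z)) + l1 ((y, z) - a x)" by (rule l1_triangle)
        also have "\<dots> < 5 * e" using False l1_push_diff[of "a x" "b x" "(y, z)"] ab[OF x] by linarith
        finally have "?q \<in> open_square" using room[OF x] by blast
        then show ?thesis using tangle_ballI[OF x] by (simp add: h_def)
      qed
      then show "h p \<in> tangle_ball" by (simp add: p)
    qed
    show "h p = p" if "p \<in> frontier tangle_ball" for p
    proof -
      obtain x q where Pair: "p = (x, q)" by (metis surj_pair)
      then have x: "x \<in> {0..1}" and "x = 0 \<or> x = 1 \<or> q \<notin> open_square"
        using that by (auto simp: mem_frontier_tangle_ball mem_tangle_ball)
      moreover have "h (x, q) = (x, q)" if "q \<notin> open_square"
      proof (rule far[OF x])
        show "4 * e \<le> l1 (q - a x)"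
          using room[OF x, of q] that \<open>e > 0\<close> by (cases "l1 (q - a x) < 5 * e") auto
      qed
      ultimately show ?thesis using Pair ends by (auto simp: h_def)
    qed
  qed
  then have "level_homeo h (inv_into tangle_ball h)"
    by (simp add: level_homeo_def h_def)
  moreover have "h (x, a x) = (x, b x)" for x by (simp add: h_def)
  ultimately show ?thesis using far by blast
qed

text \<open>
  Strands that stay apart are moved one after the other. A strand that has been moved already may
  have come closer by \<open>e\<close> to the next one, so the initial distance \<open>5 * e\<close> leaves the \<open>4 * e\<close>
  required to keep it fixed.
\<close>

lemma move_strands:
  fixes f g :: "real \<Rightarrow> nat \<Rightarrow> real \<times> real"
  assumes "finite I" "e > 0"
    and pl: "\<And>i. i \<in> I \<Longrightarrow> pl_on {0..1} (\<lambda>x. f x i)" "\<And>i. i \<in> I \<Longrightarrow> pl_on {0..1} (\<lambda>x. g x i)"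
    and fg: "\<And>x i. x \<in> {0..1} \<Longrightarrow> i \<in> I \<Longrightarrow> l1 (g x i - f x i) \<le> e"
    and room: "\<And>x i r. x \<in> {0..1} \<Longrightarrow> i \<in> I \<Longrightarrow> l1 (r - f x i) < 5 * e \<Longrightarrow> r \<in> open_square"
    and apart: "\<And>x i j. x \<in> {0..1} \<Longrightarrow> i \<in> I \<Longrightarrow> j \<in> I \<Longrightarrow> i \<noteq> j \<Longrightarrow> 5 * e \<le> l1 (f x i - f x j)"
    and ends: "\<And>i. i \<in> I \<Longrightarrow> f 0 i = g 0 i" "\<And>i. i \<in> I \<Longrightarrow> f 1 i = g 1 i"
  shows "\<exists>h k. level_homeo h k \<and> (\<forall>x\<in>{0..1}. \<forall>i\<in>I. h (x, f x i) = (x, g x i))"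
proof -
  have "\<exists>h k. level_homeo h k \<and> (\<forall>x\<in>{0..1}. (\<forall>i\<in>J. h (x, f x i) = (x, g x i)) \<and>
    (\<forall>i\<in>I - J. h (x, f x i) = (x, f x i)))" if "finite J" "J \<subseteq> I" for J
    using that
  proof (induction J rule: finite_induct)
    case empty
    show ?case using level_homeo_ident by (intro exI[of _ "\<lambda>p. p"]) auto
  next
    case (insert j J)
    then obtain h k where hk: "level_homeo h k"
      "\<And>x i. x \<in> {0..1} \<Longrightarrow> i \<in> J \<Longrightarrow> h (x, f x i) = (x, g x i)"
      "\<And>x i. x \<in> {0..1} \<Longrightarrow> i \<in> I - J \<Longrightarrow> h (x, f x i) = (x, f x i)" by blast
    have j: "j \<in> I" using insert by auto
    have "\<exists>h k. level_homeo h k \<and> (\<forall>x\<in>{0..1}. h (x, f x j) = (x, g x j)) \<and>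
      (\<forall>x\<in>{0..1}. \<forall>q. 4 * e \<le> l1 (q - f x j) \<longrightarrow> h (x, q) = (x, q))"
      using pl[OF j] \<open>e > 0\<close> ends[OF j]
      by (intro move_strand) (use fg room j in blast)+
    then obtain h' k' where hk': "level_homeo h' k'"
      "\<And>x. x \<in> {0..1} \<Longrightarrow> h' (x, f x j) = (x, g x j)"
      "\<And>x q. x \<in> {0..1} \<Longrightarrow> 4 * e \<le> l1 (q - f x j) \<Longrightarrow> h' (x, q) = (x, q)" by blast
    have 1: "h' (h (x, f x i)) = (x, g x i)" if "x \<in> {0..1}" "i \<in> insert j J" for x i
    proof (cases "i = j")
      case True
      then show ?thesis using hk(3)[of x j] hk'(2) that insert by auto
    next
      case False
      have "5 * e \<le> l1 (f x i - f x j)" using apart[of x i j] that False insert by auto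
      also have "\<dots> \<le> l1 (f x i - g x i) + l1 (g x i - f x j)" by (rule l1_triangle)
      also have "l1 (f x i - g x i) \<le> e" using fg[of x i] that insert by (auto simp: l1_minus_commute)
      finally show ?thesis using hk(2)[of x i] hk'(3)[of x "g x i"] that False by auto
    qed
    have 2: "h' (h (x, f x i)) = (x, f x i)" if "x \<in> {0..1}" "i \<in> I - insert j J" for x i
      using hk(3)[of x i] hk'(3)[of x "f x i"] apart[of x i j] that insert \<open>e > 0\<close> by auto
    show ?case
      by (intro exI conjI) (rule level_homeo_compose[OF hk(1) hk'(1)], use 1 2 in auto)
  qed
  from this[of I] \<open>finite I\<close> show ?thesis by blast
qed

section \<open>Paths of configurations\<close>

text \<open>
  Configurations of labelled points in the open square. A braid is a path \<open>f\<close> of configurations: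
  at level \<open>x\<close> its strand \<open>i\<close> passes through \<open>f x i\<close>. Labels outside \<open>I\<close> carry the value \<open>0\<close>, so
  that a configuration is determined by its points with labels in \<open>I\<close>. Functions on \<open>nat\<close> carry the
  product topology; hence \<open>homotopic_paths (config I)\<close> is homotopy of paths relative to the endpoints
  in a configuration space.
\<close>

definition config :: "nat set \<Rightarrow> (nat \<Rightarrow> real \<times> real) set" where
  "config I = {v. (\<forall>i\<in>I. v i \<in> open_square) \<and> inj_on v I \<and> (\<forall>i. i \<notin> I \<longrightarrow> v i = 0)}"

text \<open>
  Piecewise linearity is required of each strand, since a configuration is not a vector of finite
  dimension.
\<close>

definition pl_path :: "nat set \<Rightarrow> (real \<Rightarrow> nat \<Rightarrow> real \<times> real) \<Rightarrow> bool" where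
  "pl_path I f \<longleftrightarrow> (\<forall>i\<in>I. pl_on {0..1} (\<lambda>x. f x i))"

text \<open>In the norm \<open>l1\<close>, the configuration \<open>v\<close> keeps distance \<open>e\<close> from the boundary and between its points.\<close>

definition roomy :: "nat set \<Rightarrow> real \<Rightarrow> (nat \<Rightarrow> real \<times> real) \<Rightarrow> bool" where
  "roomy I e v \<longleftrightarrow> (\<forall>i\<in>I. \<forall>r. l1 (r - v i) < e \<longrightarrow> r \<in> open_square) \<and>
     (\<forall>i\<in>I. \<forall>j\<in>I. i \<noteq> j \<longrightarrow> e \<le> l1 (v i - v j))"

lemma configI:
  assumes "\<And>i. i \<in> I \<Longrightarrow> v i \<in> open_square" "\<And>i j. i \<in> I \<Longrightarrow> j \<in> I \<Longrightarrow> v i = v j \<Longrightarrow> i = j"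
    "\<And>i. i \<notin> I \<Longrightarrow> v i = 0"
  shows "v \<in> config I"
  using assms by (auto simp: config_def inj_on_def)

lemma roomy_near_config:
  assumes "roomy I e v" and "\<And>i. i \<in> I \<Longrightarrow> l1 (w i - v i) < e / 2" "e > 0" "\<And>i. i \<notin> I \<Longrightarrow> w i = 0"
  shows "w \<in> config I"
proof (rule configI)
  show "w i \<in> open_square" if "i \<in> I" for i
  proof -
    have "l1 (w i - v i) < e" using assms(2)[OF that] \<open>e > 0\<close> by linarith
    then show ?thesis using assms(1) that unfolding roomy_def by blast
  qed
  show "i = j" if "i \<in> I" "j \<in> I" "w i = w j" for i j
  proof (rule ccontr)
    assume "i \<noteq> j"
    then have "e \<le> l1 (v i - v j)" using assms(1) that by (auto simp: roomy_def)
    also have "\<dots> \<le> l1 (v i - w i) + l1 (w i - v j)" by (rule l1_triangle)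
    finally show False
      using assms(2)[OF that(1)] assms(2)[OF that(2)] that(3) l1_minus_commute[of "v i" "w i"] by simp
  qed
qed (fact assms(4))

lemma eventually_le_pos_continuous:
  fixes g :: "'a::topological_space \<Rightarrow> real"
  assumes "compact X" "continuous_on X g" "\<And>x. x \<in> X \<Longrightarrow> g x > 0"
  shows "\<forall>\<^sub>F e in at_right 0. \<forall>x\<in>X. e \<le> g x"
proof (cases "X = {}")
  case False
  then obtain x0 where x0: "x0 \<in> X" "\<And>x. x \<in> X \<Longrightarrow> g x0 \<le> g x"
    using continuous_attains_inf[OF assms(1) _ assms(2)] by blast
  have "\<forall>\<^sub>F e in at_right 0. e < g x0"
    using assms(3)[OF x0(1)] by (auto simp: eventually_at_right_field)
  then show ?thesis by (rule eventually_mono) (use x0(2) in fastforce)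
qed auto

lemma continuous_on_l1 [continuous_intros]:
  "continuous_on X f \<Longrightarrow> continuous_on X (\<lambda>x. l1 (f x))"
  unfolding l1_def by (intro continuous_intros)

text \<open>
  By compactness, the condition for a single label or pair of labels holds on all of \<open>X\<close> for every
  sufficiently small \<open>e > 0\<close>; and there are finitely many of them.
\<close>

lemma compact_roomy:
  fixes K :: "'a::topological_space \<Rightarrow> nat \<Rightarrow> real \<times> real"
  assumes "finite I" "compact X" and K: "continuous_on X K" "K ` X \<subseteq> config I"
  shows "\<exists>e>0. \<forall>x\<in>X. roomy I e (K x)"
proof -
  have cont: "continuous_on X (\<lambda>x. K x i)" for i
    using K(1) by (rule continuous_on_product_then_coordinatewise)
  have 1: "\<forall>\<^sub>F e in at_right 0. \<forall>x\<in>X. \<forall>r. l1 (r - K x i) < e \<longrightarrow> r \<in> open_square" if "i \<in> I" for i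
  proof -
    let ?g = "\<lambda>x. min (min (fst (K x i)) (1 - fst (K x i))) (min (snd (K x i)) (1 - snd (K x i)))"
    have "\<forall>\<^sub>F e in at_right 0. \<forall>x\<in>X. e \<le> ?g x"
    proof (rule eventually_le_pos_continuous[OF \<open>compact X\<close>])
      show "continuous_on X ?g" by (intro continuous_intros cont)
      show "?g x > 0" if "x \<in> X" for x
        using K(2) that \<open>i \<in> I\<close> by (force simp: config_def open_square_def)
    qed
    then show ?thesis
    proof (rule eventually_mono, intro ballI allI impI)
      fix e x r assume "\<forall>x\<in>X. e \<le> ?g x" "x \<in> X" and r: "l1 (r - K x i) < e"
      then have "e \<le> ?g x" by blast
      with r show "r \<in> open_square"
        by (cases r) (auto simp: open_square_def l1_def)
    qed
  qed
  have 2: "\<forall>\<^sub>F e in at_right 0. \<forall>x\<in>X. e \<le> l1 (K x i - K x j)" if "i \<in> I" "j \<in> I" "i \<noteq> j" for i j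
  proof (rule eventually_le_pos_continuous[OF \<open>compact X\<close>])
    show "continuous_on X (\<lambda>x. l1 (K x i - K x j))" by (intro continuous_intros cont)
    show "l1 (K x i - K x j) > 0" if "x \<in> X" for x
    proof -
      have "K x i \<noteq> K x j"
        using K(2) that \<open>i \<in> I\<close> \<open>j \<in> I\<close> \<open>i \<noteq> j\<close> by (auto simp: config_def inj_on_def)
      then show ?thesis using l1_eq_0[of "K x i - K x j"] by (metis eq_iff_diff_eq_0 not_le)
    qed
  qed
  have "\<forall>\<^sub>F e in at_right 0. (\<forall>i\<in>I. \<forall>x\<in>X. \<forall>r. l1 (r - K x i) < e \<longrightarrow> r \<in> open_square) \<and>
     (\<forall>p\<in>{(i, j). i \<in> I \<and> j \<in> I \<and> i \<noteq> j}. \<forall>x\<in>X. e \<le> l1 (K x (fst p) - K x (snd p)))"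
    using 1 2 \<open>finite I\<close> finite_subset[of "{(i, j). i \<in> I \<and> j \<in> I \<and> i \<noteq> j}" "I \<times> I"]
    by (intro eventually_conj eventually_ball_finite) auto
  moreover have "\<forall>\<^sub>F e in at_right 0. (0::real) < e"
    by (rule eventually_at_right_less)
  ultimately have "\<forall>\<^sub>F e in at_right 0. 0 < e \<and> (\<forall>x\<in>X. roomy I e (K x))"
    by eventually_elim (auto simp: roomy_def)
  then show ?thesis using eventually_happens[of _ "at_right (0::real)"] by force
qed

text \<open>
  The step \<open>e / 5\<close> fits the margins \<open>5 * (e / 5)\<close> asked for by \<open>move_strands\<close>.
\<close>

lemma homotopy_subdivision:
  fixes K :: "real \<times> real \<Rightarrow> nat \<Rightarrow> real \<times> real"
  assumes "finite I" and K: "continuous_on ({0..1} \<times> {0..1}) K" "K ` ({0..1} \<times> {0..1}) \<subseteq> config I"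
  shows "\<exists>e>0. \<exists>N::nat. (0::nat) < N \<and> (\<forall>p\<in>{0..1} \<times> {0..1}. roomy I e (K p)) \<and>
    (\<forall>i\<in>I. \<forall>p\<in>{0..1} \<times> {0..1}. \<forall>p'\<in>{0..1} \<times> {0..1}. dist p p' \<le> 1 / real N \<longrightarrow> l1 (K p i - K p' i) \<le> e / 5)"
proof -
  let ?X = "{0..1} \<times> {0..1} :: (real \<times> real) set"
  have "compact ?X" by (intro compact_Times compact_Icc)
  then obtain e where e: "e > 0" "\<And>p. p \<in> ?X \<Longrightarrow> roomy I e (K p)"
    using compact_roomy[OF \<open>finite I\<close> _ K] by blast
  have "\<forall>\<^sub>F N in sequentially. \<forall>p\<in>?X. \<forall>p'\<in>?X. dist p p' \<le> 1 / real N \<longrightarrow> l1 (K p i - K p' i) \<le> e / 5"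
    if "i \<in> I" for i
  proof -
    have "uniformly_continuous_on ?X (\<lambda>p. K p i)"
      using continuous_on_product_then_coordinatewise[OF K(1)] \<open>compact ?X\<close>
      by (rule compact_uniformly_continuous)
    then obtain d where d: "d > 0"
      "\<And>p p'. p \<in> ?X \<Longrightarrow> p' \<in> ?X \<Longrightarrow> dist p p' < d \<Longrightarrow> dist (K p i) (K p' i) < e / 10"
      unfolding uniformly_continuous_on_def using e
      by (metis dist_commute zero_less_divide_iff zero_less_numeral)
    have "(\<lambda>N. 1 / real N) \<longlonglongrightarrow> 0" by (rule lim_1_over_n)
    then have "\<forall>\<^sub>F N in sequentially. 1 / real N < d" using d(1) by (rule order_tendstoD)
    then show ?thesis
    proof (rule eventually_mono, intro ballI impI)
      fix N p p' assume "1 / real N < d" "p \<in> ?X" "p' \<in> ?X" "dist p p' \<le> 1 / real N"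
      then have "dist (K p i) (K p' i) < e / 10" using d(2) by force
      then show "l1 (K p i - K p' i) \<le> e / 5" using l1_le_norm[of "K p i - K p' i"] by (simp add: dist_norm)
    qed
  qed
  then have "\<forall>\<^sub>F N in sequentially. \<forall>i\<in>I. \<forall>p\<in>?X. \<forall>p'\<in>?X. dist p p' \<le> 1 / real N \<longrightarrow> l1 (K p i - K p' i) \<le> e / 5"
    using \<open>finite I\<close> by (intro eventually_ball_finite) auto
  moreover have "\<forall>\<^sub>F N in sequentially. N > (0::nat)" by (rule eventually_gt_at_top)
  ultimately have "\<forall>\<^sub>F N in sequentially. N > 0 \<and> (\<forall>i\<in>I. \<forall>p\<in>?X. \<forall>p'\<in>?X. dist p p' \<le> 1 / real N \<longrightarrow> l1 (K p i - K p' i) \<le> e / 5)"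
    by eventually_elim blast
  then have "\<exists>N. N > 0 \<and> (\<forall>i\<in>I. \<forall>p\<in>?X. \<forall>p'\<in>?X. dist p p' \<le> 1 / real N \<longrightarrow> l1 (K p i - K p' i) \<le> e / 5)"
    using sequentially_bot by (rule eventually_happens'[rotated])
  then show ?thesis using e by blast
qed

text \<open>
  \<open>interp N \<phi>\<close> is the piecewise-linear function with the values of \<open>\<phi>\<close> at the points \<open>j / N\<close>,
  written as a combination of the hat functions at these points, which form a partition of unity.
\<close>

definition hat :: "real \<Rightarrow> real" where
  "hat s = max 0 (1 - \<bar>s\<bar>)"

definition interp :: "nat \<Rightarrow> (real \<Rightarrow> real \<times> real) \<Rightarrow> real \<Rightarrow> real \<times> real" where
  "interp N \<phi> x = (\<Sum>j\<le>N. hat (real N * x - real j) *\<^sub>R \<phi> (real j / real N))"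

lemma hat_nonneg: "hat s \<ge> 0" by (simp add: hat_def)

lemma sum_hat: "0 \<le> s \<Longrightarrow> s \<le> real N \<Longrightarrow> (\<Sum>j\<le>N. hat (s - real j)) = 1"
proof (induction N)
  case 0
  then show ?case by (simp add: hat_def)
next
  case (Suc N)
  show ?case
  proof (cases "s \<le> real N")
    case True
    then have "hat (s - real (Suc N)) = 0" by (simp add: hat_def)
    then show ?thesis using Suc.IH[OF Suc.prems(1) True] by simp
  next
    case False
    then have "(\<Sum>j<N. hat (s - real j)) = 0" by (intro sum.neutral) (auto simp: hat_def)
    then have "(\<Sum>j\<le>N. hat (s - real j)) = hat (s - real N)"
      by (simp add: lessThan_Suc_atMost[symmetric])
    then show ?thesis using False Suc.prems by (simp add: hat_def)
  qed
qed

lemma l1_sum_le: "l1 (\<Sum>j\<in>J. F j) \<le> (\<Sum>j\<in>J. l1 (F j))"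
proof (induction J rule: infinite_finite_induct)
  case (insert j J)
  have "l1 (F j + sum F J) \<le> l1 (F j) + l1 (sum F J)" by (simp add: l1_def)
  with insert show ?case by simp
qed auto

lemma l1_scaleR: "l1 (c *\<^sub>R q) = \<bar>c\<bar> * l1 q"
  by (simp add: l1_def abs_mult algebra_simps)

lemma interp_close:
  assumes "x \<in> {0..1}" "N > 0" "e \<ge> 0"
    and e: "\<And>j. j \<le> N \<Longrightarrow> \<bar>x - real j / real N\<bar> < 1 / real N \<Longrightarrow> l1 (\<phi> (real j / real N) - \<phi> x) \<le> e"
  shows "l1 (interp N \<phi> x - \<phi> x) \<le> e"
proof -
  let ?w = "\<lambda>j. hat (real N * x - real j)"
  have w: "(\<Sum>j\<le>N. ?w j) = 1"
    using assms by (intro sum_hat) (auto simp: mult_left_le)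
  have "interp N \<phi> x - \<phi> x = (\<Sum>j\<le>N. ?w j *\<^sub>R (\<phi> (real j / real N) - \<phi> x))"
    using w by (simp add: interp_def scaleR_diff_right sum_subtractf flip: scaleR_left.sum)
  also have "l1 \<dots> \<le> (\<Sum>j\<le>N. l1 (?w j *\<^sub>R (\<phi> (real j / real N) - \<phi> x)))" by (rule l1_sum_le)
  also have "\<dots> \<le> (\<Sum>j\<le>N. ?w j * e)"
  proof (rule sum_mono)
    fix j assume j: "j \<in> {..N}"
    show "l1 (?w j *\<^sub>R (\<phi> (real j / real N) - \<phi> x)) \<le> ?w j * e"
    proof (cases "\<bar>x - real j / real N\<bar> < 1 / real N")
      case True
      then show ?thesis using e[of j] j by (simp add: l1_scaleR hat_nonneg mult_left_mono)
    next
      case False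
      have "real N * (1 / real N) \<le> real N * \<bar>x - real j / real N\<bar>"
        using False by (intro mult_left_mono) auto
      also have "\<dots> = \<bar>real N * (x - real j / real N)\<bar>" by (simp add: abs_mult)
      also have "\<dots> = \<bar>real N * x - real j\<bar>" using \<open>N > 0\<close> by (simp add: right_diff_distrib)
      finally have "?w j = 0" using \<open>N > 0\<close> by (simp add: hat_def)
      then show ?thesis by simp
    qed
  qed
  also have "\<dots> = e" using w by (simp flip: sum_distrib_right)
  finally show ?thesis .
qed

lemma interp_ends:
  assumes "N > 0" shows "interp N \<phi> 0 = \<phi> 0" "interp N \<phi> 1 = \<phi> 1"
proof -
  have "l1 (interp N \<phi> 0 - \<phi> 0) \<le> 0"
    by (rule interp_close) (use assms in \<open>auto simp: divide_less_cancel\<close>)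
  then show "interp N \<phi> 0 = \<phi> 0" using l1_eq_0[of "interp N \<phi> 0 - \<phi> 0"] by simp
  have "l1 (interp N \<phi> 1 - \<phi> 1) \<le> 0"
  proof (rule interp_close)
    fix j assume "j \<le> N" "\<bar>1 - real j / real N\<bar> < 1 / real N"
    then have "1 - real j / real N < 1 / real N" by linarith
    then have "real N * (1 - real j / real N) < real N * (1 / real N)"
      using assms by (intro mult_strict_left_mono) auto
    then have "real N - real j < 1" using assms by (simp add: right_diff_distrib)
    with \<open>j \<le> N\<close> have "j = N" by linarith
    then show "l1 (\<phi> (real j / real N) - \<phi> 1) \<le> 0" using assms by simp
  qed (use assms in auto)
  then show "interp N \<phi> 1 = \<phi> 1" using l1_eq_0[of "interp N \<phi> 1 - \<phi> 1"] by simp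
qed

lemma pl_on_interp: "pl_on {0..1} (interp N \<phi>)"
proof -
  have id: "pl_on {0..1} (\<lambda>x::real. x)"
    by (rule pl_on_ident[OF polytope_interval_real])
  have "pl_on {0..1} (\<lambda>x. \<Sum>j\<le>N. hat (real N * x - real j) *\<^sub>R \<phi> (real j / real N))"
    unfolding hat_def
    by (intro pl_on_sum[OF _ id] pl_on_scaleR_left pl_on_max pl_on_diff pl_on_abs pl_on_mult pl_on_const[OF id] id) auto
  then show ?thesis by (simp add: interp_def[abs_def])
qed

text \<open>
  Homotopy relative to the endpoints through piecewise-linear paths; the dependence on the time
  \<open>t\<close> is only continuous.
\<close>

definition pl_homotopic :: "nat set \<Rightarrow> (real \<Rightarrow> nat \<Rightarrow> real \<times> real) \<Rightarrow> (real \<Rightarrow> nat \<Rightarrow> real \<times> real) \<Rightarrow> bool" where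
  "pl_homotopic I f g \<longleftrightarrow>
     (\<exists>K :: real \<times> real \<Rightarrow> nat \<Rightarrow> real \<times> real.
          continuous_on ({0..1} \<times> {0..1}) K \<and> K ` ({0..1} \<times> {0..1}) \<subseteq> config I \<and>
          (\<forall>t\<in>{0..1}. K (t, 0) = f 0 \<and> K (t, 1) = f 1 \<and> pl_path I (\<lambda>x. K (t, x))) \<and>
          (\<forall>x\<in>{0..1}. K (0, x) = f x) \<and> (\<forall>x\<in>{0..1}. K (1, x) = g x))"

lemma pl_homotopicE:
  assumes "pl_homotopic I f g"
  obtains K :: "real \<times> real \<Rightarrow> nat \<Rightarrow> real \<times> real" where
    "continuous_on ({0..1} \<times> {0..1}) K" "K ` ({0..1} \<times> {0..1}) \<subseteq> config I"
    "\<And>t. t \<in> {0..1} \<Longrightarrow> K (t, 0) = f 0 \<and> K (t, 1) = f 1 \<and> pl_path I (\<lambda>x. K (t, x))"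
    "\<And>x. x \<in> {0..1} \<Longrightarrow> K (0, x) = f x" "\<And>x. x \<in> {0..1} \<Longrightarrow> K (1, x) = g x"
proof -
  from assms obtain K :: "real \<times> real \<Rightarrow> nat \<Rightarrow> real \<times> real" where
    "continuous_on ({0..1} \<times> {0..1}) K \<and> K ` ({0..1} \<times> {0..1}) \<subseteq> config I \<and>
     (\<forall>t\<in>{0..1}. K (t, 0) = f 0 \<and> K (t, 1) = f 1 \<and> pl_path I (\<lambda>x. K (t, x))) \<and>
     (\<forall>x\<in>{0..1}. K (0, x) = f x) \<and> (\<forall>x\<in>{0..1}. K (1, x) = g x)"
    unfolding pl_homotopic_def by (elim exE)
  then show thesis by (intro that[of K]) simp_all
qed

lemma pl_homotopic_ends: "pl_homotopic I f g \<Longrightarrow> f 0 = g 0 \<and> f 1 = g 1"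
  unfolding pl_homotopic_def by (metis atLeastAtMost_iff order_refl zero_le_one)

lemma pl_homotopic_sym:
  assumes "pl_homotopic I f g" shows "pl_homotopic I g f"
proof -
  obtain K :: "real \<times> real \<Rightarrow> nat \<Rightarrow> real \<times> real"
    where K: "continuous_on ({0..1} \<times> {0..1}) K" "K ` ({0..1} \<times> {0..1}) \<subseteq> config I"
    "\<And>t. t \<in> {0..1} \<Longrightarrow> K (t, 0) = f 0 \<and> K (t, 1) = f 1 \<and> pl_path I (\<lambda>x. K (t, x))"
    "\<And>x. x \<in> {0..1} \<Longrightarrow> K (0, x) = f x" "\<And>x. x \<in> {0..1} \<Longrightarrow> K (1, x) = g x"
    using assms by (rule pl_homotopicE) (rule that; assumption)
  have 1: "continuous_on ({0..1} \<times> {0..1}) (\<lambda>p. K (1 - fst p, snd p))"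
    by (rule continuous_on_compose2[OF K(1)]) (auto intro!: continuous_intros)
  have 2: "K (1 - fst p, snd p) \<in> config I" if "p \<in> {0..1} \<times> {0..1}" for p
    using K(2) that by (auto simp: image_subset_iff)
  show ?thesis unfolding pl_homotopic_def
    by (intro exI[of _ "\<lambda>p. K (1 - fst p, snd p)"])
      (use 1 2 K(3-5) pl_homotopic_ends[OF assms] in auto)
qed

lemma pl_homotopic_trans:
  assumes "pl_homotopic I f g" "pl_homotopic I g k" shows "pl_homotopic I f k"
proof -
  let ?S = "{0..1} \<times> {0..1} :: (real \<times> real) set"
  obtain K where K: "continuous_on ?S K" "K ` ?S \<subseteq> config I"
    "\<And>t. t \<in> {0..1} \<Longrightarrow> K (t, 0) = f 0 \<and> K (t, 1) = f 1 \<and> pl_path I (\<lambda>x. K (t, x))"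
    "\<And>x. x \<in> {0..1} \<Longrightarrow> K (0, x) = f x" "\<And>x. x \<in> {0..1} \<Longrightarrow> K (1, x) = g x"
    using assms(1) by (rule pl_homotopicE) (rule that; assumption)
  obtain L where L: "continuous_on ?S L" "L ` ?S \<subseteq> config I"
    "\<And>t. t \<in> {0..1} \<Longrightarrow> L (t, 0) = g 0 \<and> L (t, 1) = g 1 \<and> pl_path I (\<lambda>x. L (t, x))"
    "\<And>x. x \<in> {0..1} \<Longrightarrow> L (0, x) = g x" "\<And>x. x \<in> {0..1} \<Longrightarrow> L (1, x) = k x"
    using assms(2) by (rule pl_homotopicE) (rule that; assumption)
  define M where "M = (\<lambda>p. if fst p \<le> 1/2 then K (2 * fst p, snd p) else L (2 * fst p - 1, snd p))"
  have M1: "M (t, x) = K (2 * t, x)" if "t \<le> 1/2" for t x using that by (simp add: M_def)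
  have M2: "M (t, x) = L (2 * t - 1, x)" if "t \<ge> 1/2" "x \<in> {0..1}" for t x
  proof (cases "t = 1/2")
    case True
    show ?thesis unfolding True using K(5)[OF that(2)] L(4)[OF that(2)] by (simp add: M_def)
  qed (use that in \<open>simp add: M_def\<close>)
  have cl: "closed (?S \<inter> {p. fst p \<le> 1/2})" "closed (?S \<inter> {p. 1/2 \<le> fst p})"
    by (intro closed_Int closed_Times closed_Collect_le continuous_intros; simp)+
  have "continuous_on ((?S \<inter> {p. fst p \<le> 1/2}) \<union> (?S \<inter> {p. 1/2 \<le> fst p})) M"
  proof (rule continuous_on_closed_Un[OF cl])
    have "continuous_on (?S \<inter> {p. fst p \<le> 1/2}) (\<lambda>p. K (2 * fst p, snd p))"
      by (rule continuous_on_compose2[OF K(1)]) (auto intro!: continuous_intros)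
    then show "continuous_on (?S \<inter> {p. fst p \<le> 1/2}) M"
      by (rule continuous_on_eq) (auto simp: M1)
    have "continuous_on (?S \<inter> {p. 1/2 \<le> fst p}) (\<lambda>p. L (2 * fst p - 1, snd p))"
      by (rule continuous_on_compose2[OF L(1)]) (auto intro!: continuous_intros)
    then show "continuous_on (?S \<inter> {p. 1/2 \<le> fst p}) M"
      by (rule continuous_on_eq) (auto simp: M2)
  qed
  moreover have "(?S \<inter> {p. fst p \<le> 1/2}) \<union> (?S \<inter> {p. 1/2 \<le> fst p}) = ?S" by auto
  ultimately have 1: "continuous_on ?S M" by simp
  have 2: "M p \<in> config I" if "p \<in> ?S" for p
    using that K(2) L(2) by (auto simp: M_def image_subset_iff)
  have 3: "M (t, 0) = f 0 \<and> M (t, 1) = f 1 \<and> pl_path I (\<lambda>x. M (t, x))" if "t \<in> {0..1}" for t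
  proof (cases "t \<le> 1/2")
    case True
    then show ?thesis using K(3)[of "2 * t"] that by (simp add: M1)
  next
    case False
    then have "M (t, x) = L (2 * t - 1, x)" for x by (simp add: M_def)
    then show ?thesis using L(3)[of "2 * t - 1"] that False pl_homotopic_ends[OF assms(1)] by simp
  qed
  have 4: "M (0, x) = f x" "M (1, x) = k x" if "x \<in> {0..1}" for x
    using that K(4) L(5) by (auto simp: M_def)
  show ?thesis unfolding pl_homotopic_def
    by (intro exI[of _ M] conjI) (use 1 2 3 4 in auto)
qed

lemma pl_homotopic_linear:
  assumes f: "path f" "pl_path I f" and g: "path g" "pl_path I g" and ends: "f 0 = g 0" "f 1 = g 1"
    and conf: "\<And>t x. t \<in> {0..1} \<Longrightarrow> x \<in> {0..1} \<Longrightarrow> (\<lambda>i. (1 - t) *\<^sub>R f x i + t *\<^sub>R g x i) \<in> config I"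
  shows "pl_homotopic I f g"
  unfolding pl_homotopic_def
proof (intro exI[of _ "\<lambda>p i. (1 - fst p) *\<^sub>R f (snd p) i + fst p *\<^sub>R g (snd p) i"] conjI ballI)
  have c: "continuous_on ({0..1} \<times> {0..1}) (\<lambda>p. q (snd p) i)" if "path q"
    for q :: "real \<Rightarrow> nat \<Rightarrow> real \<times> real" and i
  proof -
    have "continuous_on {0..1} (\<lambda>x. q x i)"
      using that unfolding path_def by (rule continuous_on_product_then_coordinatewise)
    then show ?thesis by (rule continuous_on_compose2) (auto intro!: continuous_intros)
  qed
  show "continuous_on ({0..1} \<times> {0..1}) (\<lambda>p i. (1 - fst p) *\<^sub>R f (snd p) i + fst p *\<^sub>R g (snd p) i)"
    by (intro continuous_on_coordinatewise_then_product continuous_intros c f g)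
  show "pl_path I (\<lambda>x i. (1 - fst (t, x)) *\<^sub>R f (snd (t, x)) i + fst (t, x) *\<^sub>R g (snd (t, x)) i)" for t
    using f g by (auto simp: pl_path_def intro!: pl_on_add pl_on_scaleR)
qed (use conf ends in \<open>auto simp: algebra_simps fun_eq_iff simp flip: scaleR_add_left\<close>)

text \<open>
  All stages of a homotopy are interpolated at the points \<open>j / N\<close>. For large \<open>N\<close> the result is close
  enough to the homotopy to consist of configurations, and its two ends are joined
  linearly to the given piecewise-linear paths.
\<close>

lemma homotopic_paths_imp_pl_homotopic:
  assumes "finite I" and fg: "homotopic_paths (config I) f g" and pl: "pl_path I f" "pl_path I g"
  shows "pl_homotopic I f g"
proof -
  let ?S = "{0..1} \<times> {0..1} :: (real \<times> real) set"
  from fg obtain K where K: "continuous_on ?S K" "K \<in> ?S \<rightarrow> config I"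
    "\<And>x. x \<in> {0..1} \<Longrightarrow> K (0, x) = f x" "\<And>x. x \<in> {0..1} \<Longrightarrow> K (1, x) = g x"
    "\<And>t. t \<in> {0..1} \<Longrightarrow> K (t, 0) = f 0 \<and> K (t, 1) = f 1"
    unfolding homotopic_paths by (auto simp: pathstart_def pathfinish_def)
  have conf: "K p \<in> config I" if "p \<in> ?S" for p using K(2) that by auto
  obtain e and N :: nat where e: "e > 0" "(0::nat) < N" "\<And>p. p \<in> ?S \<Longrightarrow> roomy I e (K p)"
    "\<And>i p p'. i \<in> I \<Longrightarrow> p \<in> ?S \<Longrightarrow> p' \<in> ?S \<Longrightarrow> dist p p' \<le> 1 / real N \<Longrightarrow> l1 (K p i - K p' i) \<le> e / 5"
    using homotopy_subdivision[OF \<open>finite I\<close> K(1)] conf by blast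
  define G where "G = (\<lambda>p i. if i \<in> I then interp N (\<lambda>x. K (fst p, x) i) (snd p) else 0)"
  have close: "l1 (G (t, x) i - K (t, x) i) \<le> e / 5" if "t \<in> {0..1}" "x \<in> {0..1}" "i \<in> I" for t x i
  proof -
    have "l1 (interp N (\<lambda>x. K (t, x) i) x - K (t, x) i) \<le> e / 5"
    proof (rule interp_close)
      fix j assume j: "j \<le> N" "\<bar>x - real j / real N\<bar> < 1 / real N"
      show "l1 (K (t, real j / real N) i - K (t, x) i) \<le> e / 5"
        using e(4)[of i "(t, real j / real N)" "(t, x)"] that j \<open>N > 0\<close>
        by (auto simp: dist_Pair_Pair dist_real_def abs_minus_commute)
    qed (use that e in auto)
    then show ?thesis using that by (simp add: G_def)
  qed
  have lin: "(\<lambda>i. (1 - s) *\<^sub>R K (t, x) i + s *\<^sub>R G (t, x) i) \<in> config I"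
    if "s \<in> {0..1}" "t \<in> {0..1}" "x \<in> {0..1}" for s t x
  proof (rule roomy_near_config[OF e(3)[of "(t, x)"]])
    fix i assume i: "i \<in> I"
    have "(1 - s) *\<^sub>R K (t, x) i + s *\<^sub>R G (t, x) i - K (t, x) i = s *\<^sub>R (G (t, x) i - K (t, x) i)"
      by (simp add: algebra_simps)
    then have "l1 ((1 - s) *\<^sub>R K (t, x) i + s *\<^sub>R G (t, x) i - K (t, x) i) = s * l1 (G (t, x) i - K (t, x) i)"
      using that by (simp add: l1_scaleR)
    also have "\<dots> \<le> 1 * (e / 5)" using that close[OF that(2,3) i] by (intro mult_mono) auto
    also have "\<dots> < e / 2" using \<open>e > 0\<close> by simp
    finally show "l1 ((1 - s) *\<^sub>R K (t, x) i + s *\<^sub>R G (t, x) i - K (t, x) i) < e / 2" .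
  next
    fix i assume "i \<notin> I"
    then show "(1 - s) *\<^sub>R K (t, x) i + s *\<^sub>R G (t, x) i = 0"
      using conf[of "(t, x)"] that by (auto simp: config_def G_def)
  qed (use that e in auto)
  have Gends: "G (t, 0) = f 0" "G (t, 1) = f 1" if "t \<in> {0..1}" for t
    using K(5)[OF that] conf[of "(t, 0)"] conf[of "(t, 1)"] that
    by (auto simp: G_def interp_ends[OF \<open>N > 0\<close>] config_def fun_eq_iff)
  have Gpl: "pl_path I (\<lambda>x. G (t, x))" for t
    using pl_on_interp by (auto simp: pl_path_def G_def)
  have Gcont: "continuous_on ?S G"
  proof (rule continuous_on_coordinatewise_then_product)
    fix i
    have "continuous_on ?S (\<lambda>p. K (fst p, real j / real N) i)" if "j \<le> N" for j
      using continuous_on_product_then_coordinatewise[OF K(1), of i]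
      by (rule continuous_on_compose2) (use that \<open>N > 0\<close> in \<open>auto intro!: continuous_intros\<close>)
    then have "continuous_on ?S (\<lambda>p. interp N (\<lambda>x. K (fst p, x) i) (snd p))"
      unfolding interp_def hat_def by (intro continuous_intros) auto
    then show "continuous_on ?S (\<lambda>p. G p i)" by (cases "i \<in> I") (auto simp: G_def)
  qed
  have Gpath: "path (\<lambda>x. G (t, x))" if "t \<in> {0..1}" for t
    unfolding path_def by (rule continuous_on_compose2[OF Gcont]) (use that in \<open>auto intro!: continuous_intros\<close>)
  have path: "path f" "path g" using fg homotopic_paths_imp_path by blast+
  have ends: "g 0 = f 0" "g 1 = f 1"
    using K(4)[of 0] K(4)[of 1] K(5)[of 1] by auto
  have 1: "pl_homotopic I f (\<lambda>x. G (0, x))"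
    by (rule pl_homotopic_linear) (use path pl Gpl Gpath Gends lin[of _ 0] K(3) in auto)
  have 2: "pl_homotopic I (\<lambda>x. G (0, x)) (\<lambda>x. G (1, x))"
    unfolding pl_homotopic_def
    by (intro exI[of _ G]) (use Gcont Gends Gpl lin[of 1] in auto)
  have 3: "pl_homotopic I g (\<lambda>x. G (1, x))"
    by (rule pl_homotopic_linear) (use path pl Gpl Gpath Gends lin[of _ 1] K(4) ends in auto)
  show ?thesis
    by (rule pl_homotopic_trans[OF pl_homotopic_trans[OF 1 2] pl_homotopic_sym[OF 3]])
qed

text \<open>
  Isotopy extension for piecewise-linear braids: consecutive stages of a fine subdivision of the
  homotopy are close, so \<open>move_strands\<close> applies to them.
\<close>

lemma homotopic_paths_imp_level_homeo:
  assumes "finite I" "homotopic_paths (config I) f g" "pl_path I f" "pl_path I g"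
  shows "\<exists>h k. level_homeo h k \<and> (\<forall>x\<in>{0..1}. \<forall>i\<in>I. h (x, f x i) = (x, g x i))"
proof -
  let ?S = "{0..1} \<times> {0..1} :: (real \<times> real) set"
  from homotopic_paths_imp_pl_homotopic[OF assms]
  obtain K where K: "continuous_on ?S K" "K ` ?S \<subseteq> config I"
    "\<And>t. t \<in> {0..1} \<Longrightarrow> K (t, 0) = f 0 \<and> K (t, 1) = f 1 \<and> pl_path I (\<lambda>x. K (t, x))"
    "\<And>x. x \<in> {0..1} \<Longrightarrow> K (0, x) = f x" "\<And>x. x \<in> {0..1} \<Longrightarrow> K (1, x) = g x"
    by (rule pl_homotopicE) (rule that; assumption)
  obtain e and N :: nat where e: "e > 0" "(0::nat) < N" "\<And>p. p \<in> ?S \<Longrightarrow> roomy I e (K p)"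
    "\<And>i p p'. i \<in> I \<Longrightarrow> p \<in> ?S \<Longrightarrow> p' \<in> ?S \<Longrightarrow> dist p p' \<le> 1 / real N \<Longrightarrow> l1 (K p i - K p' i) \<le> e / 5"
    using homotopy_subdivision[OF \<open>finite I\<close> K(1,2)] by blast
  have "\<exists>h k. level_homeo h k \<and> (\<forall>x\<in>{0..1}. \<forall>i\<in>I. h (x, f x i) = (x, K (real j / real N, x) i))"
    if "j \<le> N" for j
    using that
  proof (induction j)
    case 0
    show ?case using K(4) level_homeo_ident by (intro exI[of _ "\<lambda>p. p"]) auto
  next
    case (Suc j)
    then obtain h k where hk: "level_homeo h k"
      "\<And>x i. x \<in> {0..1} \<Longrightarrow> i \<in> I \<Longrightarrow> h (x, f x i) = (x, K (real j / real N, x) i)" by auto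
    let ?t = "real j / real N" and ?u = "real (Suc j) / real N"
    have t: "?t \<in> {0..1}" "?u \<in> {0..1}" and tu: "\<bar>?u - ?t\<bar> = 1 / real N"
      using Suc.prems by (auto simp: field_simps abs_if)
    have "\<exists>h k. level_homeo h k \<and> (\<forall>x\<in>{0..1}. \<forall>i\<in>I. h (x, K (?t, x) i) = (x, K (?u, x) i))"
    proof (rule move_strands[of I "e / 5" "\<lambda>x. K (?t, x)" "\<lambda>x. K (?u, x)"])
      fix x i assume xi: "x \<in> {0..1::real}" "i \<in> I"
      show "l1 (K (?u, x) i - K (?t, x) i) \<le> e / 5"
        using e(4)[OF xi(2), of "(?u, x)" "(?t, x)"] t tu xi by (auto simp: dist_Pair_Pair dist_real_def)
    next
      fix i assume i: "i \<in> I"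
      show "pl_on {0..1} (\<lambda>x. K (?t, x) i)" "pl_on {0..1} (\<lambda>x. K (?u, x) i)"
        using K(3)[OF t(1)] K(3)[OF t(2)] i by (auto simp: pl_path_def)
      show "K (?t, 0) i = K (?u, 0) i" "K (?t, 1) i = K (?u, 1) i"
        using K(3)[OF t(1)] K(3)[OF t(2)] by auto
    next
      fix x i r assume "x \<in> {0..1::real}" "i \<in> I" "l1 (r - K (?t, x) i) < 5 * (e / 5)"
      then have "l1 (r - K (?t, x) i) < e" "roomy I e (K (?t, x))" using e(3) t by auto
      then show "r \<in> open_square" using \<open>i \<in> I\<close> unfolding roomy_def by blast
    next
      fix x i j' assume "x \<in> {0..1::real}" "i \<in> I" "j' \<in> I" "i \<noteq> j'"
      then show "5 * (e / 5) \<le> l1 (K (?t, x) i - K (?t, x) j')"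
        using e(3)[of "(?t, x)"] t by (auto simp: roomy_def)
    qed (use \<open>finite I\<close> e in auto)
    then obtain h' k' where hk': "level_homeo h' k'"
      "\<And>x i. x \<in> {0..1} \<Longrightarrow> i \<in> I \<Longrightarrow> h' (x, K (?t, x) i) = (x, K (?u, x) i)" by blast
    show ?case
      by (intro exI conjI) (rule level_homeo_compose[OF hk(1) hk'(1)], use hk(2) hk'(2) in auto)
  qed
  from this[of N] K(5) \<open>N > 0\<close> show ?thesis by auto
qed

section \<open>The Alexander trick\<close>

lemma open_open_square: "open open_square"
  unfolding open_square_def by (intro open_Times open_greaterThanLessThan)

lemma open_square_centre_scale:
  assumes "c = (1/2, 1/2)" "0 \<le> t" "t \<le> 1" "r \<in> open_square"
  shows "c + t *\<^sub>R (r - c) \<in> open_square"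
proof -
  have *: "0 < 1/2 + t * (u - 1/2)" "1/2 + t * (u - 1/2) < 1" if "0 < u" "u < 1" for u :: real
  proof -
    have "\<bar>t * (u - 1/2)\<bar> \<le> 1 * \<bar>u - 1/2\<bar>" unfolding abs_mult using assms by (intro mult_right_mono) auto
    then show "0 < 1/2 + t * (u - 1/2)" "1/2 + t * (u - 1/2) < 1" using that by (auto simp: abs_if split: if_splits)
  qed
  show ?thesis using assms *[of "fst r"] *[of "snd r"] by (cases r) (auto simp: open_square_def)
qed

text \<open>
  A level-preserving homeomorphism relative to the boundary does not change the homotopy class of
  a braid: extended by the identity to all levels \<open>{x} \<times> \<real>\<^sup>2\<close>, it is conjugated by scalings by \<open>t\<close>
  about the centre of the square and tends to the identity as \<open>t\<close> tends to \<open>0\<close>. With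
  \<open>E (x, q)\<close> the displacement at \<open>(x, q)\<close>, the conjugate moves \<open>q\<close> by \<open>t E (x, c + (q - c) / t)\<close>.
  It is injective and fixes all points outside the open square; so it maps the open square to itself.
\<close>

lemma alexander_trick:
  assumes h: "level_homeo h k" and f: "path f" "path_image f \<subseteq> config I"
    and g: "\<And>x i. x \<in> {0..1} \<Longrightarrow> i \<in> I \<Longrightarrow> h (x, f x i) = (x, g x i)"
    and g0: "\<And>x i. x \<in> {0..1} \<Longrightarrow> i \<notin> I \<Longrightarrow> g x i = 0"
  shows "homotopic_paths (config I) f g"
proof -
  let ?S = "{0..1} \<times> {0..1} :: (real \<times> real) set"
  define c :: "real \<times> real" where "c = (1/2, 1/2)"
  define E where "E = (\<lambda>p. if snd p \<in> ?S then snd (h p) - snd p else 0)"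
  have hrel: "rel_homeo h k" using h by (simp add: level_homeo_def)
  have hlev: "h (x, q) = (x, snd (h (x, q)))" if "x \<in> {0..1}" "q \<in> ?S" for x q
    using h that by (simp add: level_homeo_def mem_tangle_ball prod_eq_iff)
  have hS: "snd (h (x, q)) \<in> ?S" if "x \<in> {0..1}" "q \<in> ?S" for x q
    using rel_homeo_mem[OF hrel, of "(x, q)"] that hlev[OF that] by (metis mem_tangle_ball)
  have sub: "open_square \<subseteq> ?S" by (auto simp: open_square_def)
  have E0: "E (x, q) = 0" if "x \<in> {0..1}" "q \<notin> open_square" for x q
    using rel_homeo_frontier[OF hrel, of "(x, q)"] that
    by (auto simp: E_def mem_frontier_tangle_ball mem_tangle_ball)
  have E1: "E (x, q) = 0" if "x = 0 \<or> x = 1" for x q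
    using rel_homeo_frontier[OF hrel, of "(x, q)"] that
    by (auto simp: E_def mem_frontier_tangle_ball mem_tangle_ball)
  have Enorm: "norm (E (x, q)) \<le> 2" if "x \<in> {0..1}" for x q
  proof (cases "q \<in> ?S")
    case True
    have "l1 (snd (h (x, q)) - q) \<le> 2"
      using hS[OF that True] True by (cases q, cases "snd (h (x, q))") (auto simp: l1_def abs_if)
    then show ?thesis using norm_le_l1[of "snd (h (x, q)) - q"] True by (simp add: E_def)
  qed (simp add: E_def)
  have Econt: "continuous_on ({0..1} \<times> UNIV) E"
  proof -
    have "continuous_on (({0..1} \<times> ?S) \<union> ({0..1} \<times> (- open_square))) E"
    proof (rule continuous_on_closed_Un)
      have "continuous_on tangle_ball h" using rel_homeo_pl[OF hrel] by (rule pl_on_imp_continuous_on)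
      then have "continuous_on ({0..1} \<times> ?S) (\<lambda>p. snd (h p) - snd p)"
        by (intro continuous_intros) (simp add: tangle_ball_def)
      then show "continuous_on ({0..1} \<times> ?S) E" by (rule continuous_on_eq) (auto simp: E_def)
      show "continuous_on ({0..1} \<times> (- open_square)) E"
        by (rule continuous_on_eq[of _ "\<lambda>p. 0"]) (use E0 in auto)
      show "closed ({0..1::real} \<times> ?S)" by (intro closed_Times) auto
      show "closed ({0..1::real} \<times> (- open_square))"
        by (intro closed_Times closed_Compl open_open_square) auto
    qed
    moreover have "({0..1} \<times> ?S) \<union> ({0..1} \<times> (- open_square)) = {0..1::real} \<times> UNIV" using sub by auto
    ultimately show ?thesis by simp
  qed
  have hhat_inj: "q = q'" if x: "x \<in> {0..1}" and eq: "q + E (x, q) = q' + E (x, q')" for x q q'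
  proof -
    have 1: "q + E (x, q) \<in> ?S \<longleftrightarrow> q \<in> ?S" for q using hS[OF x] by (auto simp: E_def)
    show ?thesis
    proof (cases "q \<in> ?S")
      case True
      then have q': "q' \<in> ?S" using 1[of q] 1[of q'] eq by auto
      then have "h (x, q) = h (x, q')"
        using eq True hlev[OF x True] hlev[OF x q'] by (simp add: E_def)
      then show ?thesis
        using inj_onD[OF rel_homeo_inj_on[OF hrel], of "(x, q)" "(x, q')"] True q' x
        by (simp add: mem_tangle_ball)
    next
      case False
      then have "q' \<notin> ?S" using 1[of q] 1[of q'] eq by auto
      with False eq show ?thesis by (simp add: E_def)
    qed
  qed
  define \<Phi> where "\<Phi> = (\<lambda>t x q. q + t *\<^sub>R E (x, c + (1 / t) *\<^sub>R (q - c)))"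
  have \<Phi>0 [simp]: "\<Phi> 0 x q = q" for x q by (simp add: \<Phi>_def)
  have \<Phi>_inj: "q = q'" if "t \<in> {0..1}" "x \<in> {0..1}" "\<Phi> t x q = \<Phi> t x q'" for t x q q'
  proof (cases "t = 0")
    case False
    have eq: "\<Phi> t x q = c + t *\<^sub>R (c + (1 / t) *\<^sub>R (q - c) + E (x, c + (1 / t) *\<^sub>R (q - c)) - c)" for q
      using False by (simp add: \<Phi>_def algebra_simps)
    have "c + (1 / t) *\<^sub>R (q - c) = c + (1 / t) *\<^sub>R (q' - c)"
      by (rule hhat_inj[OF that(2)]) (use that(3) False in \<open>unfold eq, simp\<close>)
    then show ?thesis using False by simp
  qed (use that in simp)
  have \<Phi>_out: "\<Phi> t x q = q" if "t \<in> {0..1}" "x \<in> {0..1}" "q \<notin> open_square" for t x q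
  proof (cases "t = 0")
    case False
    have "c + (1 / t) *\<^sub>R (q - c) \<notin> open_square"
      using open_square_centre_scale[OF c_def, of t "c + (1 / t) *\<^sub>R (q - c)"] that False by auto
    then show ?thesis using E0[OF that(2)] by (simp add: \<Phi>_def)
  qed simp
  have \<Phi>_in: "\<Phi> t x q \<in> open_square" if "t \<in> {0..1}" "x \<in> {0..1}" "q \<in> open_square" for t x q
    using \<Phi>_out[OF that(1,2), of "\<Phi> t x q"] \<Phi>_inj[OF that(1,2), of "\<Phi> t x q" q] that(3) by metis
  have fconf: "f x \<in> config I" if "x \<in> {0..1}" for x using f(2) that by (auto simp: path_image_def)
  define K where "K = (\<lambda>p i. if i \<in> I then \<Phi> (fst p) (snd p) (f (snd p) i) else 0)"
  have fc: "continuous_on ?S (\<lambda>p. f (snd p) i)" for i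
  proof -
    have "continuous_on {0..1} (\<lambda>x. f x i)"
      using f(1) unfolding path_def by (rule continuous_on_product_then_coordinatewise)
    then show ?thesis by (rule continuous_on_compose2) (auto intro!: continuous_intros)
  qed
  have cont: "continuous_on ?S (\<lambda>p. \<Phi> (fst p) (snd p) (f (snd p) i))" for i
  proof -
    \<comment> \<open>Division by \<open>t\<close> is not continuous at \<open>t = 0\<close>; as \<open>E\<close> is bounded, bounding the divisor below by
      \<open>1 / (1 + n)\<close> gives continuous maps that converge uniformly.\<close>
    define F where "F = (\<lambda>(n::nat) p. f (snd p) i +
      fst p *\<^sub>R E (snd p, c + (1 / max (fst p) (1 / (1 + real n))) *\<^sub>R (f (snd p) i - c)))"
    have pos: "max t (1 / (1 + real n)) \<noteq> 0" for n and t :: real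
      by (smt (verit) max.cobounded2 of_nat_0_le_iff zero_less_divide_iff)
    have Fc: "continuous_on ?S (F n)" for n unfolding F_def
      by (intro continuous_intros fc continuous_on_compose2[OF Econt]) (use pos in auto)
    have "uniform_limit ?S F (\<lambda>p. \<Phi> (fst p) (snd p) (f (snd p) i)) sequentially"
    proof (rule uniform_limitI)
      fix e :: real assume "e > 0"
      have "(\<lambda>n. 4 * (1 / (1 + real n))) \<longlonglongrightarrow> 4 * 0"
        using LIMSEQ_inverse_real_of_nat by (intro tendsto_intros) (simp add: divide_inverse)
      then have "\<forall>\<^sub>F n in sequentially. 4 * (1 / (1 + real n)) < e"
        using \<open>e > 0\<close> by (simp add: order_tendstoD)
      then show "\<forall>\<^sub>F n in sequentially. \<forall>p\<in>?S. dist (F n p) (\<Phi> (fst p) (snd p) (f (snd p) i)) < e"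
      proof (rule eventually_mono, intro ballI)
        fix n p assume n: "4 * (1 / (1 + real n)) < e" and p: "p \<in> ?S"
        show "dist (F n p) (\<Phi> (fst p) (snd p) (f (snd p) i)) < e"
        proof (cases "fst p < 1 / (1 + real n)")
          case True
          let ?A = "E (snd p, c + (1 / max (fst p) (1 / (1 + real n))) *\<^sub>R (f (snd p) i - c))"
            and ?B = "E (snd p, c + (1 / fst p) *\<^sub>R (f (snd p) i - c))"
          have "dist (F n p) (\<Phi> (fst p) (snd p) (f (snd p) i)) = norm (fst p *\<^sub>R (?A - ?B))"
            by (simp add: F_def \<Phi>_def dist_norm scaleR_diff_right)
          also have "\<dots> \<le> fst p * 4"
          proof -
            have "norm (?A - ?B) \<le> 2 + 2"
              using p by (intro order_trans[OF norm_triangle_ineq4] add_mono Enorm) auto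
            then show ?thesis using p by (auto intro!: mult_left_mono)
          qed
          also have "\<dots> < e" using True n by linarith
          finally show ?thesis .
        next
          case False
          then have "max (fst p) (1 / (1 + real n)) = fst p" by simp
          then show ?thesis using \<open>e > 0\<close> by (simp add: F_def \<Phi>_def)
        qed
      qed
    qed
    then show ?thesis
      by (rule uniform_limit_theorem[rotated]) (use Fc in auto)
  qed
  show ?thesis unfolding homotopic_paths
  proof (intro exI[of _ K] conjI ballI)
    show "continuous_on ?S K"
    proof (rule continuous_on_coordinatewise_then_product)
      show "continuous_on ?S (\<lambda>p. K p i)" for i
        using cont by (cases "i \<in> I") (auto simp: K_def)
    qed
    show "K \<in> ?S \<rightarrow> config I"
    proof
      fix p assume p: "p \<in> ?S"
      then have px: "fst p \<in> {0..1}" "snd p \<in> {0..1}" by auto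
      show "K p \<in> config I"
      proof (rule configI)
        show "K p i \<in> open_square" if "i \<in> I" for i
          using \<Phi>_in[OF px] fconf[OF px(2)] that by (simp add: K_def config_def)
        show "i = j" if "i \<in> I" "j \<in> I" "K p i = K p j" for i j
          using \<Phi>_inj[OF px] fconf[OF px(2)] that by (auto simp: K_def config_def inj_on_def)
      qed (simp add: K_def)
    qed
    have f0: "f x i = 0" if "x \<in> {0..1}" "i \<notin> I" for x i using fconf[OF that(1)] that by (simp add: config_def)
    show "K (0, x) = f x" if "x \<in> {0..1}" for x
      using f0[OF that] by (auto simp: K_def)
    show "K (1, x) = g x" if x: "x \<in> {0..1}" for x
    proof
      fix i
      show "K (1, x) i = g x i"
      proof (cases "i \<in> I")
        case True
        then have "f x i \<in> ?S" using fconf[OF x] sub by (auto simp: config_def)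
        then show ?thesis using g[OF x True] True by (simp add: K_def \<Phi>_def E_def)
      qed (use g0[OF x] in \<open>simp add: K_def\<close>)
    qed
    show "pathstart (K \<circ> Pair t) = pathstart f" "pathfinish (K \<circ> Pair t) = pathfinish f" for t
      using f0 by (auto simp: pathstart_def pathfinish_def K_def \<Phi>_def E1 fun_eq_iff)
  qed
qed

section \<open>Braids as paths of configurations\<close>

text \<open>
  The \<open>(y, z)\<close>-coordinates of the endpoints, as a configuration.
\<close>

definition base :: "nat \<Rightarrow> nat \<Rightarrow> real \<times> real" where
  "base n i = (if i \<in> {1..n} then (real i / (real n + 1), 1 / 2) else 0)"

lemma base_in_square: "i \<in> {1..n} \<Longrightarrow> base n i \<in> open_square"
  by (simp add: base_def open_square_def)

lemma base_inj: "i \<in> {1..n} \<Longrightarrow> j \<in> {1..n} \<Longrightarrow> base n i = base n j \<Longrightarrow> i = j"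
  by (simp add: base_def)

lemma base_inj_on: "inj_on (base n) {1..n}"
  by (rule inj_onI) (rule base_inj)

lemma base_config: "base n \<in> config {1..n}"
proof (rule configI)
  show "i = j" if "i \<in> {1..n}" "j \<in> {1..n}" "base n i = base n j" for i j
    using base_inj that by blast
  show "base n i = 0" if "i \<notin> {1..n}" for i using that by (simp only: base_def if_False)
qed (rule base_in_square)

lemma endpoints_eq: "endpoints n = {0, 1} \<times> base n ` {1..n}"
  by (force simp: endpoints_def base_def)

text \<open>
  Piecewise-linear paths of configurations between arrangements of the base points, and the
  subset of the ball swept out by the strands of such a path.
\<close>

definition braid_path :: "nat \<Rightarrow> (real \<Rightarrow> nat \<Rightarrow> real \<times> real) \<Rightarrow> bool" where
  "braid_path n f \<longleftrightarrow> path f \<and> path_image f \<subseteq> config {1..n} \<and> pl_path {1..n} f \<and>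
     f 0 ` {1..n} = base n ` {1..n} \<and> f 1 ` {1..n} = base n ` {1..n}"

definition strand_graph :: "(real \<Rightarrow> nat \<Rightarrow> real \<times> real) \<Rightarrow> nat \<Rightarrow> point set" where
  "strand_graph f i = (\<lambda>x. (x, f x i)) ` {0..1}"

definition braid_graph :: "nat \<Rightarrow> (real \<Rightarrow> nat \<Rightarrow> real \<times> real) \<Rightarrow> point set" where
  "braid_graph n f = (\<Union>i\<in>{1..n}. strand_graph f i)"

lemma braid_path_config: "braid_path n f \<Longrightarrow> x \<in> {0..1} \<Longrightarrow> f x \<in> config {1..n}"
  by (auto simp: braid_path_def path_image_def)

lemma braid_path_in_square: "braid_path n f \<Longrightarrow> x \<in> {0..1} \<Longrightarrow> i \<in> {1..n} \<Longrightarrow> f x i \<in> open_square"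
  using braid_path_config[of n f x] by (simp add: config_def)

lemma braid_path_neq:
  "braid_path n f \<Longrightarrow> x \<in> {0..1} \<Longrightarrow> i \<in> {1..n} \<Longrightarrow> j \<in> {1..n} \<Longrightarrow> f x i = f x j \<Longrightarrow> i = j"
  using braid_path_config[of n f x] unfolding config_def inj_on_def by blast

lemma braid_path_out: "braid_path n f \<Longrightarrow> x \<in> {0..1} \<Longrightarrow> i \<notin> {1..n} \<Longrightarrow> f x i = 0"
  using braid_path_config[of n f x] by (simp add: config_def)

lemma braid_path_pl: "braid_path n f \<Longrightarrow> i \<in> {1..n} \<Longrightarrow> pl_on {0..1} (\<lambda>x. f x i)"
  by (simp add: braid_path_def pl_path_def)

lemma braid_pathI:
  assumes "pl_path {1..n} f" "\<And>x. x \<in> {0..1} \<Longrightarrow> f x \<in> config {1..n}"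
    "f 0 ` {1..n} = base n ` {1..n}" "f 1 ` {1..n} = base n ` {1..n}"
  shows "braid_path n f"
proof -
  have "continuous_on {0..1} (\<lambda>x. f x i)" for i
  proof (cases "i \<in> {1..n}")
    case True
    then show ?thesis using assms(1) by (auto simp: pl_path_def intro: pl_on_imp_continuous_on)
  next
    case False
    then show ?thesis
      by (intro continuous_on_eq[OF continuous_on_const[of _ 0]]) (use assms(2) in \<open>auto simp: config_def\<close>)
  qed
  then have "path f" unfolding path_def by (rule continuous_on_coordinatewise_then_product)
  then show ?thesis using assms by (auto simp: braid_path_def path_image_def)
qed

lemma braid_path_const: "braid_path n (\<lambda>x. base n)"
proof (rule braid_pathI)
  show "pl_path {1..n} (\<lambda>x. base n)"
    by (auto simp: pl_path_def intro: pl_on_const_polytope polytope_interval_real)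
qed (use base_config in auto)

lemma connected_subset_disjoint_closed:
  assumes "finite J" "\<And>j. j \<in> J \<Longrightarrow> closed (F j)" "i \<in> J"
    and disj: "\<And>j. j \<in> J \<Longrightarrow> j \<noteq> i \<Longrightarrow> F i \<inter> F j = {}"
    and C: "connected C" "C \<subseteq> (\<Union>j\<in>J. F j)" "C \<inter> F i \<noteq> {}"
  shows "C \<subseteq> F i"
proof -
  let ?B = "\<Union>j\<in>J - {i}. F j"
  have "closed ?B" using assms by (intro closed_UN) auto
  moreover have "C \<subseteq> F i \<union> ?B" "F i \<inter> ?B \<inter> C = {}" using C disj \<open>i \<in> J\<close> by auto
  ultimately have "F i \<inter> C = {} \<or> ?B \<inter> C = {}"
    using \<open>connected C\<close> assms(2)[OF \<open>i \<in> J\<close>] unfolding connected_closed by blast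
  then show ?thesis using C \<open>C \<subseteq> F i \<union> ?B\<close> by blast
qed

lemma continuous_strand_graph: "braid_path n f \<Longrightarrow> i \<in> {1..n} \<Longrightarrow> continuous_on {0..1} (\<lambda>x. (x, f x i))"
  by (intro continuous_intros pl_on_imp_continuous_on braid_path_pl)

lemma closed_strand_graph: "braid_path n f \<Longrightarrow> i \<in> {1..n} \<Longrightarrow> closed (strand_graph f i)"
  unfolding strand_graph_def
  by (intro compact_imp_closed compact_continuous_image continuous_strand_graph) auto

lemma disjoint_strand_graph:
  assumes "braid_path n f" "i \<in> {1..n}" "j \<in> {1..n}" "j \<noteq> i"
  shows "strand_graph f i \<inter> strand_graph f j = {}"
proof -
  have "f x i \<noteq> f x j" if "x \<in> {0..1}" for x
    using braid_path_neq[OF assms(1) that assms(2,3)] assms(4) by blast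
  then show ?thesis unfolding strand_graph_def by blast
qed

text \<open>
  The strands are the components of a braid: they are connected, closed and disjoint. Consequently
  a path \<open>f\<close> with \<open>f 0 = base n\<close> is determined by the braid as a point set.
\<close>

lemma connected_in_strand_graph:
  assumes "braid_path n f" "i \<in> {1..n}" "connected C" "C \<subseteq> braid_graph n f" "C \<inter> strand_graph f i \<noteq> {}"
  shows "C \<subseteq> strand_graph f i"
proof (rule connected_subset_disjoint_closed[where J = "{1..n}"])
  show "closed (strand_graph f j)" if "j \<in> {1..n}" for j
    by (rule closed_strand_graph[OF assms(1) that])
  show "strand_graph f i \<inter> strand_graph f j = {}" if "j \<in> {1..n}" "j \<noteq> i" for j
    by (rule disjoint_strand_graph[OF assms(1,2) that])
qed (use assms in \<open>simp_all add: braid_graph_def\<close>)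

lemma braid_path_unique:
  assumes f: "braid_path n f" and g: "braid_path n g" and "braid_graph n g \<subseteq> braid_graph n f" "f 0 = g 0"
    and x: "x \<in> {0..1}"
  shows "f x = g x"
proof
  fix i
  show "f x i = g x i"
  proof (cases "i \<in> {1..n}")
    case True
    have "strand_graph g i \<subseteq> strand_graph f i"
    proof (rule connected_in_strand_graph[OF f True])
      show "connected (strand_graph g i)" unfolding strand_graph_def
        by (intro connected_continuous_image continuous_strand_graph[OF g True]) simp
      have "strand_graph g i \<subseteq> braid_graph n g" using True by (auto simp: braid_graph_def)
      then show "strand_graph g i \<subseteq> braid_graph n f" using assms(3) by blast
      have "(0, g 0 i) \<in> strand_graph g i" "(0, g 0 i) \<in> strand_graph f i"
        using \<open>f 0 = g 0\<close> unfolding strand_graph_def by (force intro!: image_eqI[of _ _ 0])+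
      then show "strand_graph g i \<inter> strand_graph f i \<noteq> {}" by blast
    qed
    moreover have "(x, g x i) \<in> strand_graph g i" using x by (auto simp: strand_graph_def)
    ultimately show ?thesis by (auto simp: strand_graph_def)
  next
    case False
    then show ?thesis using braid_path_out[OF f x False] braid_path_out[OF g x False] by simp
  qed
qed

lemma config_permute:
  assumes "\<sigma> permutes I" "v \<in> config I" shows "v \<circ> \<sigma> \<in> config I"
proof (rule configI)
  have v: "\<And>i. i \<in> I \<Longrightarrow> v i \<in> open_square" "inj_on v I" "\<And>i. i \<notin> I \<Longrightarrow> v i = 0"
    using assms by (auto simp: config_def)
  show "(v \<circ> \<sigma>) i \<in> open_square" if "i \<in> I" for i using v that permutes_in_image[OF assms(1)] by simp
  show "i = j" if "i \<in> I" "j \<in> I" "(v \<circ> \<sigma>) i = (v \<circ> \<sigma>) j" for i j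
  proof -
    have "\<sigma> i = \<sigma> j"
      using inj_onD[OF v(2), of "\<sigma> i" "\<sigma> j"] that permutes_in_image[OF assms(1)] by simp
    then show ?thesis using permutes_inj[OF assms(1)] by (simp add: inj_eq)
  qed
  show "(v \<circ> \<sigma>) i = 0" if "i \<notin> I" for i using v that permutes_not_in[OF assms(1) that] by simp
qed

lemma continuous_permute: "continuous_on X (\<lambda>v::nat \<Rightarrow> real \<times> real. v \<circ> \<sigma>)"
  unfolding comp_def
  by (intro continuous_on_coordinatewise_then_product
      continuous_on_product_then_coordinatewise[OF continuous_on_id])

lemma braid_path_permute:
  assumes s: "\<sigma> permutes {1..n}" and f: "braid_path n f"
  shows "braid_path n (\<lambda>x. f x \<circ> \<sigma>)"
proof (rule braid_pathI)
  show "pl_path {1..n} (\<lambda>x. f x \<circ> \<sigma>)"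
    using braid_path_pl[OF f] permutes_in_image[OF s] by (auto simp: pl_path_def)
  show "f x \<circ> \<sigma> \<in> config {1..n}" if "x \<in> {0..1}" for x
    using config_permute[OF s] braid_path_config[OF f that] by blast
  show "(f 0 \<circ> \<sigma>) ` {1..n} = base n ` {1..n}" "(f 1 \<circ> \<sigma>) ` {1..n} = base n ` {1..n}"
    using f permutes_image[OF s] by (simp_all only: braid_path_def image_comp[symmetric])
qed

lemma braid_graph_permute:
  assumes "\<sigma> permutes {1..n}" shows "braid_graph n (\<lambda>x. f x \<circ> \<sigma>) = braid_graph n f"
proof -
  have "strand_graph (\<lambda>x. f x \<circ> \<sigma>) i = strand_graph f (\<sigma> i)" for i by (simp add: strand_graph_def)
  then have "braid_graph n (\<lambda>x. f x \<circ> \<sigma>) = (\<Union>i\<in>\<sigma> ` {1..n}. strand_graph f i)"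
    by (simp add: braid_graph_def)
  then show ?thesis unfolding permutes_image[OF assms] by (simp add: braid_graph_def)
qed

text \<open>Every arrangement of the base points is a relabelling of \<open>base n\<close>.\<close>

lemma arrangement_permutation:
  assumes v: "v \<in> config {1..n}" "v ` {1..n} \<subseteq> base n ` {1..n}"
  shows "\<exists>\<sigma>. \<sigma> permutes {1..n} \<and> v \<circ> \<sigma> = base n"
proof -
  have inj: "inj_on v {1..n}" and out: "\<And>i. i \<notin> {1..n} \<Longrightarrow> v i = 0" using v by (auto simp: config_def)
  have "v ` {1..n} = base n ` {1..n}"
  proof (rule card_subset_eq)
    show "card (v ` {1..n}) = card (base n ` {1..n})"
      using card_image[OF inj] card_image[OF base_inj_on] by simp
  qed (use v in auto)
  define \<sigma> where "\<sigma> = (\<lambda>i. if i \<in> {1..n} then inv_into {1..n} v (base n i) else i)"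
  have s: "\<sigma> i \<in> {1..n}" "v (\<sigma> i) = base n i" if "i \<in> {1..n}" for i
    using that inv_into_into[of "base n i" v "{1..n}"] f_inv_into_f[of "base n i" v "{1..n}"]
      \<open>v ` {1..n} = base n ` {1..n}\<close> by (auto simp: \<sigma>_def)
  have "inj_on \<sigma> {1..n}"
  proof (rule inj_onI)
    fix i j assume "i \<in> {1..n}" "j \<in> {1..n}" "\<sigma> i = \<sigma> j"
    then show "i = j" using s(2)[of i] s(2)[of j] base_inj[of i n j] by simp
  qed
  moreover have "\<sigma> ` {1..n} \<subseteq> {1..n}" using s(1) by blast
  ultimately have "bij_betw \<sigma> {1..n} {1..n}"
    using endo_inj_surj[of "{1..n}" \<sigma>] unfolding bij_betw_def by blast
  then have "\<sigma> permutes {1..n}" by (rule bij_imp_permutes) (auto simp: \<sigma>_def)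
  moreover have "v \<circ> \<sigma> = base n"
    using s out by (auto simp: fun_eq_iff \<sigma>_def base_def)
  ultimately show ?thesis by blast
qed

lemma braid_path_endE:
  assumes "braid_path n f"
  obtains \<sigma> where "\<sigma> permutes {1..n}" "f 1 = base n \<circ> \<sigma>"
proof -
  obtain \<tau> where t: "\<tau> permutes {1..n}" "f 1 \<circ> \<tau> = base n"
    using arrangement_permutation[of "f 1" n] braid_path_config[OF assms, of 1] assms
    by (auto simp: braid_path_def)
  then have "f 1 = base n \<circ> Hilbert_Choice.inv \<tau>"
    unfolding t(2)[symmetric] comp_assoc permutes_inv_o(1)[OF t(1)] by simp
  then show thesis using that permutes_inv[OF t(1)] by blast
qed

lemma strand_graph_image: "path_image (\<lambda>x. (x, f x i)) = strand_graph f i"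
  by (simp add: path_image_def strand_graph_def)

lemma braid_path_strands:
  assumes f: "braid_path n f"
  shows "braid_strands n (\<lambda>i x. (x, f x i))" "strand_union n (\<lambda>i x. (x, f x i)) = braid_graph n f"
proof -
  let ?g = "\<lambda>i x. (x, f x i)"
  show un: "strand_union n ?g = braid_graph n f"
    by (simp add: strand_union_def braid_graph_def strand_graph_image)
  have f01: "f 0 ` {1..n} = base n ` {1..n}" "f 1 ` {1..n} = base n ` {1..n}"
    using f by (auto simp: braid_path_def)
  have ends: "(\<Union>i\<in>{1..n}. {pathstart (?g i), pathfinish (?g i)}) = endpoints n"
  proof -
    have "(\<Union>i\<in>{1..n}. {pathstart (?g i), pathfinish (?g i)}) = {0} \<times> f 0 ` {1..n} \<union> {1} \<times> f 1 ` {1..n}"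
      by (auto simp: pathstart_def pathfinish_def)
    then show ?thesis using f01 by (auto simp: endpoints_eq)
  qed
  have ball: "braid_graph n f \<subseteq> tangle_ball"
    unfolding braid_graph_def strand_graph_def
    by (intro UN_least image_subsetI tangle_ballI braid_path_in_square[OF f])
  have e_sub: "endpoints n \<subseteq> braid_graph n f"
    unfolding ends[symmetric] braid_graph_def strand_graph_def
    by (intro UN_mono) (auto simp: pathstart_def pathfinish_def)
  have fr: "braid_graph n f \<inter> frontier tangle_ball = endpoints n"
  proof
    show "braid_graph n f \<inter> frontier tangle_ball \<subseteq> endpoints n"
    proof
      fix p assume p: "p \<in> braid_graph n f \<inter> frontier tangle_ball"
      then obtain i x where ix: "i \<in> {1..n}" "x \<in> {0..1}" "p = (x, f x i)"
        by (auto simp: braid_graph_def strand_graph_def)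
      then have "x = 0 \<or> x = 1"
        using p braid_path_in_square[OF f ix(2,1)] by (simp add: mem_frontier_tangle_ball)
      then have "f x i \<in> base n ` {1..n}" using f01 ix(1) by (metis imageI)
      then show "p \<in> endpoints n" using \<open>x = 0 \<or> x = 1\<close> ix(3) by (auto simp: endpoints_eq)
    qed
    have "endpoints n \<subseteq> frontier tangle_ball"
    proof
      fix p assume p: "p \<in> endpoints n"
      then obtain x q where "p = (x, q)" "x = 0 \<or> x = 1" by (auto simp: endpoints_eq)
      moreover have "p \<in> tangle_ball" using p e_sub ball by blast
      ultimately show "p \<in> frontier tangle_ball" by (auto simp: mem_frontier_tangle_ball)
    qed
    with e_sub show "endpoints n \<subseteq> braid_graph n f \<inter> frontier tangle_ball" by blast
  qed
  have arc: "arc (?g i)" if "i \<in> {1..n}" for i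
    using continuous_strand_graph[OF f that] by (auto simp: arc_def path_def inj_on_def)
  have pl: "pl_on {0..1} (?g i)" if "i \<in> {1..n}" for i
    by (intro pl_on_Pair braid_path_pl[OF f that] pl_on_ident polytope_interval_real)
  have "disjoint_family_on (\<lambda>i. path_image (?g i)) {1..n}"
    using disjoint_strand_graph[OF f] by (auto simp: disjoint_family_on_def strand_graph_image)
  then have "tangle_strands n ?g"
    using arc pl ends ball fr by (simp add: tangle_strands_def un)
  moreover have "pathstart (?g i) \<in> left_face \<and> pathfinish (?g i) \<in> right_face" if "i \<in> {1..n}" for i
    using braid_path_in_square[OF f _ that, of 0] braid_path_in_square[OF f _ that, of 1]
    by (auto simp: pathstart_def pathfinish_def left_face_def right_face_def open_square_def)
  moreover have "strict_mono_on {0..1} (\<lambda>s. fst (?g i s))" for i by (simp add: strict_mono_on_def)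
  ultimately show "braid_strands n ?g" by (simp add: braid_strands_def string_link_strands_def)
qed

lemma braid_graph_in_braids: "braid_path n f \<Longrightarrow> braid_graph n f \<in> braids n"
  using braid_path_strands[of n f] unfolding braids_def by force

lemma connected_finite_constant:
  fixes f :: "real \<Rightarrow> 'a::metric_space"
  assumes "continuous_on {0..1} f" "finite A" "\<And>t. t \<in> {0..1} \<Longrightarrow> f t \<in> A" "t \<in> {0..1}"
  shows "f t = f 0"
proof -
  have "connected (f ` {0..1})" using assms by (intro connected_continuous_image) auto
  moreover have "finite (f ` {0..1})" using assms(2,3) by (rule_tac finite_subset) auto
  ultimately obtain a where "f ` {0..1} = {a}"
    using connected_finite_iff_sing[of "f ` {0..1}"] by auto
  then show ?thesis using \<open>t \<in> {0..1}\<close> by (metis atLeastAtMost_iff imageI order_refl singletonD zero_le_one)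
qed

text \<open>
  Normal form of an isotopy of braids: each strand is oriented from left to right, parametrized by
  the coordinate \<open>x\<close>, and labelled by its starting point. The orientations and the endpoints take
  finitely many values, so they do not depend on \<open>t\<close>.
\<close>

lemma isotopy_normal_form:
  fixes H :: "nat \<Rightarrow> real \<Rightarrow> real \<Rightarrow> point"
  assumes cont: "\<And>i. i \<in> {1..n} \<Longrightarrow> continuous_on ({0..1} \<times> {0..1}) (\<lambda>(t, s). H i t s)"
    and br: "\<And>t. t \<in> {0..1} \<Longrightarrow> braid_strands n (\<lambda>i. H i t)"
  shows "\<exists>K :: real \<times> real \<Rightarrow> nat \<Rightarrow> real \<times> real. continuous_on ({0..1} \<times> {0..1}) K \<and>
    (\<forall>t\<in>{0..1}. braid_path n (\<lambda>x. K (t, x)) \<and> K (t, 0) = base n \<and> K (t, 1) = K (0, 1) \<and>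
       braid_graph n (\<lambda>x. K (t, x)) = strand_union n (\<lambda>i. H i t))"
proof -
  let ?I = "{0..1} :: real set" and ?S = "{0..1} \<times> {0..1} :: (real \<times> real) set"
  have sl: "string_link_strands n (\<lambda>i. H i t)" and ts: "tangle_strands n (\<lambda>i. H i t)" if "t \<in> ?I" for t
    using br[OF that] by (auto simp: braid_strands_def string_link_strands_def)
  have cont': "continuous_on ?S (\<lambda>p. H i (fst p) (snd p))" if "i \<in> {1..n}" for i
    using cont[OF that] by (simp add: case_prod_unfold)
  have fst01: "fst (H i t 0) = 0 \<and> fst (H i t 1) = 1 \<or> fst (H i t 0) = 1 \<and> fst (H i t 1) = 0"
    if "i \<in> {1..n}" "t \<in> ?I" for i t
  proof -
    have "pathstart (H i t) \<in> left_face \<and> pathfinish (H i t) \<in> right_face \<or>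
        pathstart (H i t) \<in> right_face \<and> pathfinish (H i t) \<in> left_face"
      using sl[OF that(2)] that(1) unfolding string_link_strands_def by blast
    then show ?thesis
      by (auto simp: left_face_def right_face_def pathstart_def pathfinish_def mem_Times_iff)
  qed
  have orient: "fst (H i t 0) = fst (H i 0 0)" if "i \<in> {1..n}" "t \<in> ?I" for i t
  proof (rule connected_finite_constant[of "\<lambda>t. fst (H i t 0)" "{0, 1}"])
    have c: "continuous_on ?I (\<lambda>t. (t, 0::real))" by (intro continuous_intros)
    have "continuous_on ?I (\<lambda>t. H i (fst (t, 0::real)) (snd (t, 0::real)))"
      by (rule continuous_on_compose2[OF cont'[OF that(1)] c]) auto
    then show "continuous_on ?I (\<lambda>t. fst (H i t 0))" by (intro continuous_on_fst) simp
    show "fst (H i s 0) \<in> {0, 1}" if "s \<in> ?I" for s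
      using fst01[OF \<open>i \<in> {1..n}\<close> that] by auto
  qed (use that in simp_all)
  define G where "G = (\<lambda>i t s. if fst (H i 0 0) = 0 then H i t s else H i t (1 - s))"
  have Gcont: "continuous_on ?S (\<lambda>p. G i (fst p) (snd p))" if "i \<in> {1..n}" for i
  proof (cases "fst (H i 0 0) = 0")
    case True
    then show ?thesis using cont'[OF that] by (simp add: G_def)
  next
    case False
    have "continuous_on ?S (\<lambda>p. H i (fst (fst p, 1 - snd p)) (snd (fst p, 1 - snd p)))"
      by (rule continuous_on_compose2[OF cont'[OF that], of ?S "\<lambda>p. (fst p, 1 - snd p)"])
        (auto intro!: continuous_intros)
    then show ?thesis using False by (simp add: G_def)
  qed
  have G01: "fst (G i t 0) = 0" "fst (G i t 1) = 1" if "i \<in> {1..n}" "t \<in> ?I" for i t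
    using fst01[OF that] orient[OF that] fst01[of i 0] that by (auto simp: G_def)
  have Gmono: "strict_mono_on ?I (\<lambda>s. fst (G i t s))" if i: "i \<in> {1..n}" "t \<in> ?I" for i t
  proof -
    have "strict_mono_on ?I (\<lambda>s. fst (H i t s)) \<or> strict_antimono_on ?I (\<lambda>s. fst (H i t s))"
      using br[OF i(2)] i(1) by (auto simp: braid_strands_def)
    then show ?thesis
    proof
      assume m: "strict_mono_on ?I (\<lambda>s. fst (H i t s))"
      then have "fst (H i t 0) < fst (H i t 1)" by (rule strict_mono_onD) auto
      then have "fst (H i 0 0) = 0" using fst01[OF i] orient[OF i] by auto
      then show ?thesis using m by (simp add: G_def)
    next
      assume m: "strict_antimono_on ?I (\<lambda>s. fst (H i t s))"
      then have m': "fst (H i t s) < fst (H i t r)" if "r \<in> ?I" "s \<in> ?I" "r < s" for r s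
        using that by (auto simp: monotone_on_def)
      have "fst (H i t 1) < fst (H i t 0)" by (rule m') auto
      then have "fst (H i 0 0) \<noteq> 0" using fst01[OF i] orient[OF i] by auto
      then show ?thesis using m' by (auto simp: G_def strict_mono_on_def)
    qed
  qed
  have Gpl: "pl_on ?I (G i t)" if i: "i \<in> {1..n}" "t \<in> ?I" for i t
  proof -
    have H: "pl_on ?I (H i t)" using ts[OF i(2)] i(1) by (auto simp: tangle_strands_def)
    with pl_on_reverse[OF H] show ?thesis by (cases "fst (H i 0 0) = 0") (simp_all add: G_def[abs_def])
  qed
  have Gimage: "G i t ` ?I = path_image (H i t)" for i t
  proof -
    have "(\<lambda>s. H i t (1 - s)) ` ?I = H i t ` ((-) 1 ` ?I)" by (simp only: image_image)
    then have "(\<lambda>s. H i t (1 - s)) ` ?I = H i t ` ?I" by simp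
    then show ?thesis by (simp add: G_def path_image_def)
  qed
  have Ginj: "inj_on (\<lambda>s. fst (G i t s)) ?I" if "i \<in> {1..n}" "t \<in> ?I" for i t
    using Gmono[OF that] by (rule strict_mono_on_imp_inj_on)
  have Gsurj: "(\<lambda>s. fst (G i t s)) ` ?I = ?I" if i: "i \<in> {1..n}" "t \<in> ?I" for i t
  proof
    have "path_image (H i t) \<subseteq> strand_union n (\<lambda>i. H i t)"
      unfolding strand_union_def using i(1) by blast
    also have "\<dots> \<subseteq> tangle_ball" using ts[OF i(2)] unfolding tangle_strands_def by blast
    finally have sub: "path_image (H i t) \<subseteq> tangle_ball" .
    show "(\<lambda>s. fst (G i t s)) ` ?I \<subseteq> ?I"
    proof (rule image_subsetI)
      fix s assume "s \<in> ?I"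
      then have "G i t s \<in> tangle_ball" using Gimage[of i t] sub by blast
      then show "fst (G i t s) \<in> ?I" by (simp add: tangle_ball_def mem_Times_iff)
    qed
    show "?I \<subseteq> (\<lambda>s. fst (G i t s)) ` ?I"
    proof
      fix x :: real assume "x \<in> ?I"
      moreover have "continuous_on ?I (\<lambda>s. fst (G i t s))"
        using Gpl[OF i] by (intro continuous_intros pl_on_imp_continuous_on)
      ultimately obtain s where "0 \<le> s" "s \<le> 1" "fst (G i t s) = x"
        using IVT'[of "\<lambda>s. fst (G i t s)" 0 x 1] G01[OF i] by auto
      then show "x \<in> (\<lambda>s. fst (G i t s)) ` ?I" by (intro image_eqI[of _ _ s]) auto
    qed
  qed
  \<comment> \<open>The parameter \<open>s\<close> as a function of the level \<open>x\<close>. It is continuous in \<open>(t, x)\<close> because it is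
    obtained by inverting a continuous bijection of the compact square.\<close>
  define \<Sigma> where "\<Sigma> = (\<lambda>i t. inv_into ?I (\<lambda>s. fst (G i t s)))"
  have \<Sigma>: "\<Sigma> i t x \<in> ?I" "fst (G i t (\<Sigma> i t x)) = x" if "i \<in> {1..n}" "t \<in> ?I" "x \<in> ?I" for i t x
    using inv_into_into[of x "\<lambda>s. fst (G i t s)" ?I] f_inv_into_f[of x "\<lambda>s. fst (G i t s)" ?I]
      Gsurj[OF that(1,2)] that(3) by (auto simp: \<Sigma>_def)
  have \<Sigma>_inv: "\<Sigma> i t (fst (G i t s)) = s" if "i \<in> {1..n}" "t \<in> ?I" "s \<in> ?I" for i t s
    using inv_into_f_f[OF Ginj[OF that(1,2)] that(3)] by (simp add: \<Sigma>_def)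
  define R where "R = (\<lambda>i p. snd (G i (fst p) (\<Sigma> i (fst p) (snd p))))"
  have Rcont: "continuous_on ?S (R i)" if i: "i \<in> {1..n}" for i
  proof -
    let ?T = "\<lambda>p. (fst p, fst (G i (fst p) (snd p)))"
    have im: "?T ` ?S = ?S"
    proof
      show "?T ` ?S \<subseteq> ?S"
      proof (rule image_subsetI)
        fix p assume "p \<in> ?S"
        then have p: "fst p \<in> ?I" "snd p \<in> ?I" by auto
        then have "fst (G i (fst p) (snd p)) \<in> (\<lambda>s. fst (G i (fst p) s)) ` ?I" by (intro imageI)
        then show "?T p \<in> ?S" using Gsurj[OF i p(1)] p(1) by simp
      qed
      show "?S \<subseteq> ?T ` ?S"
      proof
        fix p assume p: "p \<in> ?S"
        then have "p = ?T (fst p, \<Sigma> i (fst p) (snd p))" "(fst p, \<Sigma> i (fst p) (snd p)) \<in> ?S"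
          using \<Sigma>[OF i, of "fst p" "snd p"] by (auto simp: prod_eq_iff)
        then show "p \<in> ?T ` ?S" by blast
      qed
    qed
    have "continuous_on (?T ` ?S) (\<lambda>p. (fst p, \<Sigma> i (fst p) (snd p)))"
    proof (rule continuous_on_inv)
      show "continuous_on ?S ?T" by (intro continuous_intros Gcont i)
      show "compact ?S" by (intro compact_Times compact_Icc)
    qed (use \<Sigma>_inv[OF i] in \<open>auto simp: prod_eq_iff\<close>)
    then have c: "continuous_on ?S (\<lambda>p. (fst p, \<Sigma> i (fst p) (snd p)))" unfolding im .
    have "continuous_on ?S (\<lambda>p. G i (fst (fst p, \<Sigma> i (fst p) (snd p))) (snd (fst p, \<Sigma> i (fst p) (snd p))))"
      by (rule continuous_on_compose2[OF Gcont[OF i] c]) (use \<Sigma>[OF i] in auto)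
    then show ?thesis unfolding R_def by (intro continuous_on_snd) simp
  qed
  have Rgraph: "(\<lambda>x. (x, R i (t, x))) ` ?I = path_image (H i t)" if "i \<in> {1..n}" "t \<in> ?I" for i t
  proof -
    have 1: "(x, R i (t, x)) = G i t (\<Sigma> i t x)" if "x \<in> ?I" for x
      using \<Sigma>[OF \<open>i \<in> {1..n}\<close> \<open>t \<in> ?I\<close> that] by (simp add: R_def prod_eq_iff)
    have "(\<lambda>x. (x, R i (t, x))) ` ?I = G i t ` (\<Sigma> i t ` ?I)"
      unfolding image_image by (rule image_cong[OF refl 1])
    also have "\<Sigma> i t ` ?I = ?I"
    proof
      show "\<Sigma> i t ` ?I \<subseteq> ?I" using \<Sigma>[OF that] by auto
      show "?I \<subseteq> \<Sigma> i t ` ?I"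
      proof
        fix s assume "s \<in> ?I"
        then show "s \<in> \<Sigma> i t ` ?I"
          using \<Sigma>_inv[OF that, of s] Gsurj[OF that] by (intro image_eqI[of _ _ "fst (G i t s)"]) auto
      qed
    qed
    finally show ?thesis using Gimage by simp
  qed
  have Rpl: "pl_on ?I (\<lambda>x. R i (t, x))" if "i \<in> {1..n}" "t \<in> ?I" for i t
  proof -
    have "pl_on ((\<lambda>s. fst (G i t s)) ` ?I) (\<Sigma> i t)"
      by (intro pl_on_inverse pl_on_fst Gpl that) (use \<Sigma>_inv[OF that] in auto)
    then have "pl_on ?I (\<Sigma> i t)" using Gsurj[OF that] by simp
    from pl_on_compose[OF this Gpl[OF that]] \<Sigma>[OF that]
    have "pl_on ?I (\<lambda>x. G i t (\<Sigma> i t x))" by simp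
    then have "pl_on ?I (\<lambda>x. snd (G i t (\<Sigma> i t x)))" by (rule pl_on_snd)
    then show ?thesis by (simp add: R_def)
  qed
  have Rmem: "(x, R i (t, x)) \<in> strand_union n (\<lambda>i. H i t)" if "i \<in> {1..n}" "t \<in> ?I" "x \<in> ?I" for i t x
  proof -
    have "(x, R i (t, x)) \<in> path_image (H i t)" unfolding Rgraph[OF that(1,2), symmetric] using that(3) by (rule imageI)
    then show ?thesis unfolding strand_union_def using that(1) by blast
  qed
  have frE: "(x, q) \<in> endpoints n"
    if "t \<in> ?I" "(x, q) \<in> strand_union n (\<lambda>i. H i t)" "x = 0 \<or> x = 1 \<or> q \<notin> open_square" for t x q
  proof -
    have "strand_union n (\<lambda>i. H i t) \<subseteq> tangle_ball"
      "strand_union n (\<lambda>i. H i t) \<inter> frontier tangle_ball = endpoints n"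
      using ts[OF that(1)] unfolding tangle_strands_def by blast+
    then show ?thesis using that mem_frontier_tangle_ball[of x q] by blast
  qed
  have Rend: "R i (t, x) \<in> base n ` {1..n}" if "i \<in> {1..n}" "t \<in> ?I" "x = 0 \<or> x = 1" for i t x
  proof -
    have "(x, R i (t, x)) \<in> strand_union n (\<lambda>i. H i t)" using Rmem[OF that(1,2)] that(3) by auto
    then have "(x, R i (t, x)) \<in> endpoints n" using frE[OF that(2)] that(3) by blast
    then show ?thesis by (auto simp: endpoints_eq)
  qed
  have Rsq: "R i (t, x) \<in> open_square" if "i \<in> {1..n}" "t \<in> ?I" "x \<in> ?I" for i t x
  proof (rule ccontr)
    assume "R i (t, x) \<notin> open_square"
    then have "(x, R i (t, x)) \<in> endpoints n" using frE[OF that(2)] Rmem[OF that] by blast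
    then show False using \<open>R i (t, x) \<notin> open_square\<close> base_in_square by (auto simp: endpoints_eq)
  qed
  have Rneq: "i = j" if "i \<in> {1..n}" "j \<in> {1..n}" "t \<in> ?I" "x \<in> ?I" "R i (t, x) = R j (t, x)" for i j t x
  proof (rule ccontr)
    assume "i \<noteq> j"
    then have "path_image (H i t) \<inter> path_image (H j t) = {}"
      using ts[OF that(3)] that(1,2) unfolding tangle_strands_def disjoint_family_on_def by blast
    moreover have "(x, R i (t, x)) \<in> path_image (H i t)" "(x, R i (t, x)) \<in> path_image (H j t)"
      unfolding Rgraph[OF that(1,3), symmetric] Rgraph[OF that(2,3), symmetric]
      using imageI[OF that(4), of "\<lambda>x. (x, R i (t, x))"] imageI[OF that(4), of "\<lambda>x. (x, R j (t, x))"]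
        that(5) by simp_all
    ultimately show False by blast
  qed
  have Rconst: "R i (t, x) = R i (0, x)" if "i \<in> {1..n}" "t \<in> ?I" "x = 0 \<or> x = 1" for i t x
  proof (rule connected_finite_constant[of "\<lambda>t. R i (t, x)" "base n ` {1..n}"])
    have c: "continuous_on ?I (\<lambda>t. (t, x))" by (intro continuous_intros)
    show "continuous_on ?I (\<lambda>t. R i (t, x))"
      by (rule continuous_on_compose2[OF Rcont[OF that(1)] c]) (use that in auto)
    show "R i (s, x) \<in> base n ` {1..n}" if "s \<in> ?I" for s
      using Rend \<open>i \<in> {1..n}\<close> that \<open>x = 0 \<or> x = 1\<close> by blast
  qed (use that in simp_all)
  define v where "v = (\<lambda>p i. if i \<in> {1..n} then R i p else 0)"
  have v: "v p i = R i p" if "i \<in> {1..n}" for p i using that by (simp only: v_def if_True)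
  have v0: "v p i = 0" if "i \<notin> {1..n}" for p i using that by (simp only: v_def if_False)
  have vconf: "v p \<in> config {1..n}" if "p \<in> ?S" for p
  proof (rule configI)
    have p: "fst p \<in> ?I" "snd p \<in> ?I" using that by auto
    show "v p i \<in> open_square" if "i \<in> {1..n}" for i using Rsq[OF that p] v[OF that] by simp
    show "i = j" if "i \<in> {1..n}" "j \<in> {1..n}" "v p i = v p j" for i j
      using Rneq[OF that(1,2) p] v[OF that(1)] v[OF that(2)] that(3) by simp
  qed (rule v0)
  have vim: "v (t, x) ` {1..n} \<subseteq> base n ` {1..n}" if "t \<in> ?I" "x = 0 \<or> x = 1" for t x
  proof (rule image_subsetI)
    fix i assume i: "i \<in> {1..n}"
    show "v (t, x) i \<in> base n ` {1..n}" using Rend[OF i that] v[OF i] by simp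
  qed
  have arr: "\<exists>\<sigma>. \<sigma> permutes {1..n} \<and> v (t, x) \<circ> \<sigma> = base n" if "t \<in> ?I" "x = 0 \<or> x = 1" for t x
    by (rule arrangement_permutation[OF vconf vim[OF that]]) (use that in auto)
  obtain \<sigma> where s: "\<sigma> permutes {1..n}" "v (0, 0) \<circ> \<sigma> = base n"
    using arr[of 0 0] by auto
  define K where "K = (\<lambda>p. v p \<circ> \<sigma>)"
  show ?thesis
  proof (intro exI[of _ K] conjI ballI)
    show "continuous_on ?S K"
    proof (rule continuous_on_coordinatewise_then_product)
      show "continuous_on ?S (\<lambda>p. K p i)" for i
      proof (cases "\<sigma> i \<in> {1..n}")
        case True
        then have "(\<lambda>p. K p i) = R (\<sigma> i)" using v by (simp add: K_def fun_eq_iff)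
        then show ?thesis using Rcont[OF True] by (simp only:)
      next
        case False
        then have "(\<lambda>p. K p i) = (\<lambda>p. 0)" using v0 by (simp add: K_def fun_eq_iff)
        then show ?thesis by (simp only: continuous_on_const)
      qed
    qed
    fix t assume t: "t \<in> ?I"
    have vends: "v (t, x) ` {1..n} = base n ` {1..n}" if x: "x = 0 \<or> x = 1" for x
    proof -
      obtain \<tau> where "\<tau> permutes {1..n}" "v (t, x) \<circ> \<tau> = base n" using arr[OF t x] by blast
      then have "base n ` {1..n} = v (t, x) ` (\<tau> ` {1..n})" by (simp only: image_comp)
      then show ?thesis using permutes_image[OF \<open>\<tau> permutes {1..n}\<close>] by (simp only:)
    qed
    have "braid_path n (\<lambda>x. v (t, x))"
    proof (rule braid_pathI)
      show "pl_path {1..n} (\<lambda>x. v (t, x))" unfolding pl_path_def using Rpl[OF _ t] v by simp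
      show "v (t, x) \<in> config {1..n}" if "x \<in> ?I" for x using vconf t that by simp
      show "v (t, 0) ` {1..n} = base n ` {1..n}" "v (t, 1) ` {1..n} = base n ` {1..n}"
        using vends[of 0] vends[of 1] by simp_all
    qed
    then show "braid_path n (\<lambda>x. K (t, x))" unfolding K_def by (rule braid_path_permute[OF s(1)])
    have "v (t, x) = v (0, x)" if "x = 0 \<or> x = 1" for x
    proof
      fix i
      show "v (t, x) i = v (0, x) i"
        using Rconst[OF _ t that, of i] v[of i] v0[of i] by (cases "i \<in> {1..n}") simp_all
    qed
    then show "K (t, 0) = base n" "K (t, 1) = K (0, 1)" using s(2) by (auto simp: K_def)
    have "braid_graph n (\<lambda>x. K (t, x)) = braid_graph n (\<lambda>x. v (t, x))"
      unfolding K_def by (rule braid_graph_permute[OF s(1)])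
    also have "\<dots> = (\<Union>i\<in>{1..n}. path_image (H i t))"
      unfolding braid_graph_def strand_graph_def using Rgraph[OF _ t] v by simp
    finally show "braid_graph n (\<lambda>x. K (t, x)) = strand_union n (\<lambda>i. H i t)"
      by (simp add: strand_union_def)
  qed
qed

section \<open>The braid group\<close>

text \<open>
  Isotopy of braids is homotopy in the configuration space. So the laws of the
  braid group reduce to those of concatenation of paths up to homotopy.
\<close>

lemma homotopic_imp_isotopy:
  assumes f: "braid_path n f" and g: "braid_path n g" and fg: "homotopic_paths (config {1..n}) f g"
  shows "(braid_graph n f, braid_graph n g) \<in> braid_isotopy n"
proof -
  let ?S = "{0..1} \<times> {0..1} :: (real \<times> real) set"
  have "pl_homotopic {1..n} f g"
    using f g by (intro homotopic_paths_imp_pl_homotopic fg) (auto simp: braid_path_def)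
  then obtain K where K: "continuous_on ?S K" "K ` ?S \<subseteq> config {1..n}"
    "\<And>t. t \<in> {0..1} \<Longrightarrow> K (t, 0) = f 0 \<and> K (t, 1) = f 1 \<and> pl_path {1..n} (\<lambda>x. K (t, x))"
    "\<And>x. x \<in> {0..1} \<Longrightarrow> K (0, x) = f x" "\<And>x. x \<in> {0..1} \<Longrightarrow> K (1, x) = g x"
    by (rule pl_homotopicE) (rule that; assumption)
  have bp: "braid_path n (\<lambda>x. K (t, x))" if "t \<in> {0..1}" for t
  proof (rule braid_pathI)
    show "K (t, x) \<in> config {1..n}" if "x \<in> {0..1}" for x using K(2) \<open>t \<in> {0..1}\<close> that by blast
  qed (use K(3)[OF that] f in \<open>simp_all add: braid_path_def\<close>)
  define H where "H = (\<lambda>i t s. (s, K (t, s) i))"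
  have Hcont: "continuous_on ?S (\<lambda>(t, s). H i t s)" for i
  proof -
    have "continuous_on ?S (\<lambda>p. (snd p, K p i))"
      by (intro continuous_intros continuous_on_product_then_coordinatewise[OF K(1)])
    then show ?thesis by (simp add: H_def case_prod_unfold)
  qed
  have br: "braid_strands n (\<lambda>i. H i t)" if "t \<in> {0..1}" for t
    unfolding H_def by (rule braid_path_strands(1)[OF bp[OF that]])
  have un: "strand_union n (\<lambda>i. H i t) = braid_graph n (\<lambda>x. K (t, x))" if "t \<in> {0..1}" for t
    unfolding H_def by (rule braid_path_strands(2)[OF bp[OF that]])
  have cong: "braid_graph n p = braid_graph n q" if "\<And>x. x \<in> {0..1} \<Longrightarrow> p x = q x" for p q
    using that by (simp add: braid_graph_def strand_graph_def)
  have "braid_graph n f = strand_union n (\<lambda>i. H i 0)" "braid_graph n g = strand_union n (\<lambda>i. H i 1)"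
    using un[of 0] un[of 1] cong[of f "\<lambda>x. K (0, x)"] cong[of g "\<lambda>x. K (1, x)"] K(4,5) by simp_all
  then show ?thesis unfolding braid_isotopy_def using Hcont br by blast
qed

lemma isotopy_imp_homotopic:
  assumes "(T, T') \<in> braid_isotopy n"
  obtains f g where "braid_path n f" "braid_path n g" "f 0 = base n" "g 0 = base n"
    "T = braid_graph n f" "T' = braid_graph n g" "homotopic_paths (config {1..n}) f g"
proof -
  let ?S = "{0..1} \<times> {0..1} :: (real \<times> real) set"
  from assms obtain H :: "nat \<Rightarrow> real \<Rightarrow> real \<Rightarrow> point" where H:
    "\<And>i. i \<in> {1..n} \<Longrightarrow> continuous_on ?S (\<lambda>(t, s). H i t s)"
    "\<And>t. t \<in> {0..1} \<Longrightarrow> braid_strands n (\<lambda>i. H i t)"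
    "T = strand_union n (\<lambda>i. H i 0)" "T' = strand_union n (\<lambda>i. H i 1)"
    unfolding braid_isotopy_def by blast
  obtain K :: "real \<times> real \<Rightarrow> nat \<Rightarrow> real \<times> real" where K: "continuous_on ?S K"
    "\<And>t. t \<in> {0..1} \<Longrightarrow> braid_path n (\<lambda>x. K (t, x)) \<and> K (t, 0) = base n \<and> K (t, 1) = K (0, 1) \<and>
       braid_graph n (\<lambda>x. K (t, x)) = strand_union n (\<lambda>i. H i t)"
    using isotopy_normal_form[OF H(1,2)] by blast
  have "homotopic_paths (config {1..n}) (\<lambda>x. K (0, x)) (\<lambda>x. K (1, x))"
    unfolding homotopic_paths
  proof (intro exI[of _ K] conjI ballI)
    show "K \<in> ?S \<rightarrow> config {1..n}"
    proof
      fix p assume "p \<in> ?S"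
      then have "fst p \<in> {0..1}" "snd p \<in> {0..1}" by auto
      then have "K (fst p, snd p) \<in> config {1..n}"
        using K(2) by (intro braid_path_config[of n "\<lambda>x. K (fst p, x)"]) blast+
      then show "K p \<in> config {1..n}" by simp
    qed
    show "pathstart (K \<circ> Pair t) = pathstart (\<lambda>x. K (0, x))"
      "pathfinish (K \<circ> Pair t) = pathfinish (\<lambda>x. K (0, x))" if "t \<in> {0..1}" for t
      using K(2)[OF that] K(2)[of 0] by (simp_all add: pathstart_def pathfinish_def)
  qed (use K(1) in simp_all)
  then show thesis
    using that[of "\<lambda>x. K (0, x)" "\<lambda>x. K (1, x)"] K(2)[of 0] K(2)[of 1] H(3,4) by simp
qed

lemma braids_normal_form:
  assumes "T \<in> braids n"
  obtains f where "braid_path n f" "f 0 = base n" "T = braid_graph n f"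
proof -
  obtain \<gamma> where g: "braid_strands n \<gamma>" "T = strand_union n \<gamma>" using assms by (auto simp: braids_def)
  have pl: "pl_on {0..1} (\<gamma> i)" if "i \<in> {1..n}" for i
    using g(1) that by (auto simp: braid_strands_def string_link_strands_def tangle_strands_def)
  \<comment> \<open>The normal form of the constant isotopy.\<close>
  have "(T, T) \<in> braid_isotopy n"
    unfolding braid_isotopy_def
  proof (clarify, intro exI[of _ "\<lambda>i t. \<gamma> i"] conjI ballI)
    fix i assume "i \<in> {1..n}"
    then have "continuous_on {0..1} (\<gamma> i)" by (rule pl_on_imp_continuous_on[OF pl])
    then have "continuous_on ({0..1} \<times> {0..1}) (\<lambda>p::real \<times> real. \<gamma> i (snd p))"
      by (rule continuous_on_compose2) (auto intro!: continuous_intros)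
    then show "continuous_on ({0..1} \<times> {0..1}) (\<lambda>(t::real, s). \<gamma> i s)"
      by (simp add: case_prod_unfold)
  qed (use g in simp_all)
  then show thesis using isotopy_imp_homotopic that by metis
qed

lemma homotopic_eq_paths:
  assumes "homotopic_paths S f g" "\<And>x. x \<in> {0..1} \<Longrightarrow> f x = f' x" "\<And>x. x \<in> {0..1} \<Longrightarrow> g x = g' x"
  shows "homotopic_paths S f' g'"
proof -
  have "homotopic_paths S f f'" "homotopic_paths S g g'"
    using assms homotopic_paths_imp_path[OF assms(1)] homotopic_paths_imp_subset[OF assms(1)]
    by (auto intro!: homotopic_paths_eq)
  then show ?thesis using assms(1) homotopic_paths_sym homotopic_paths_trans by blast
qed

lemma isotopy_iff_homotopic:
  assumes f: "braid_path n f" "f 0 = base n" and g: "braid_path n g" "g 0 = base n"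
  shows "(braid_graph n f, braid_graph n g) \<in> braid_isotopy n \<longleftrightarrow> homotopic_paths (config {1..n}) f g"
proof
  assume "(braid_graph n f, braid_graph n g) \<in> braid_isotopy n"
  then obtain f' g' where fg': "braid_path n f'" "braid_path n g'" "f' 0 = base n" "g' 0 = base n"
    "braid_graph n f = braid_graph n f'" "braid_graph n g = braid_graph n g'"
    "homotopic_paths (config {1..n}) f' g'"
    by (rule isotopy_imp_homotopic)
  show "homotopic_paths (config {1..n}) f g"
  proof (rule homotopic_eq_paths[OF fg'(7)])
    show "f' x = f x" if "x \<in> {0..1}" for x
      using braid_path_unique[OF fg'(1) f(1) _ _ that] fg' f by simp
    show "g' x = g x" if "x \<in> {0..1}" for x
      using braid_path_unique[OF fg'(2) g(1) _ _ that] fg' g by simp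
  qed
qed (rule homotopic_imp_isotopy[OF f(1) g(1)])

lemma equiv_braid_isotopy: "equiv (braids n) (braid_isotopy n)"
proof (rule equivI)
  show "braid_isotopy n \<subseteq> braids n \<times> braids n"
  proof clarify
    fix T T' assume "(T, T') \<in> braid_isotopy n"
    then show "T \<in> braids n \<and> T' \<in> braids n"
      by (rule isotopy_imp_homotopic) (simp add: braid_graph_in_braids)
  qed
  show "refl_on (braids n) (braid_isotopy n)"
  proof (rule refl_onI)
    fix T assume "T \<in> braids n"
    then obtain f where f: "braid_path n f" "T = braid_graph n f" by (rule braids_normal_form)
    then have "homotopic_paths (config {1..n}) f f" by (simp add: braid_path_def)
    then show "(T, T) \<in> braid_isotopy n" using homotopic_imp_isotopy f by blast
  qed
  show "sym (braid_isotopy n)"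
  proof (rule symI)
    fix T T' assume "(T, T') \<in> braid_isotopy n"
    then obtain f g where fg: "braid_path n f" "braid_path n g"
      "T = braid_graph n f" "T' = braid_graph n g" "homotopic_paths (config {1..n}) f g"
      by (rule isotopy_imp_homotopic)
    then show "(T', T) \<in> braid_isotopy n"
      using homotopic_imp_isotopy[OF fg(2,1) homotopic_paths_sym[OF fg(5)]] by simp
  qed
  show "trans (braid_isotopy n)"
  proof (rule transI)
    fix T T' T'' assume 1: "(T, T') \<in> braid_isotopy n" and 2: "(T', T'') \<in> braid_isotopy n"
    from 1 obtain f g where fg: "braid_path n f" "braid_path n g" "f 0 = base n" "g 0 = base n"
      "T = braid_graph n f" "T' = braid_graph n g" "homotopic_paths (config {1..n}) f g"
      by (rule isotopy_imp_homotopic)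
    from 2 obtain g' h where gh: "braid_path n g'" "braid_path n h" "g' 0 = base n" "h 0 = base n"
      "T' = braid_graph n g'" "T'' = braid_graph n h" "homotopic_paths (config {1..n}) g' h"
      by (rule isotopy_imp_homotopic)
    have "homotopic_paths (config {1..n}) g h"
      using isotopy_iff_homotopic[OF fg(2,4) gh(2,4)] 2 fg(6) gh(6) by simp
    then show "(T, T'') \<in> braid_isotopy n"
      using homotopic_imp_isotopy[OF fg(1) gh(2)] homotopic_paths_trans[OF fg(7)] fg(5) gh(6) by simp
  qed
qed

lemma pl_on_join:
  fixes f g :: "real \<Rightarrow> 'a::euclidean_space"
  assumes f: "pl_on {0..1} f" and g: "pl_on {0..1} g" and fg: "f 1 = g 0"
  shows "pl_on {0..1} (f +++ g)"
proof -
  have "pl_on {0..1/2} (\<lambda>x::real. 2 *\<^sub>R x)" "pl_on {1/2..1} (\<lambda>x::real. 2 *\<^sub>R x + - 1)"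
    by (intro pl_on_linear_polytope pl_on_affine_polytope polytope_interval_real linear_scaleR)+
  from pl_on_compose[OF this(1) f] pl_on_compose[OF this(2) g]
  have 1: "pl_on {0..1/2} (\<lambda>x. f (2 * x))" and 2: "pl_on {1/2..1} (\<lambda>x. g (2 * x - 1))" by auto
  have "pl_on ({0..1/2} \<union> {1/2..1}) (f +++ g)"
  proof (rule pl_on_Un)
    show "pl_on {0..1/2} (f +++ g)" using 1 by (rule pl_on_cong) (simp add: joinpaths_def)
    show "pl_on {1/2..1} (f +++ g)"
      using 2
    proof (rule pl_on_cong)
      fix x :: real assume "x \<in> {1/2..1}"
      then consider "x = 1/2" | "1/2 < x" by force
      then show "g (2 * x - 1) = (f +++ g) x"
      proof cases
        case 1
        show ?thesis unfolding 1 using fg by (simp add: joinpaths_def)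
      qed (simp add: joinpaths_def)
    qed
  qed
  moreover have "{0..1/2} \<union> {1/2..1} = {0..1::real}" by auto
  ultimately show ?thesis by simp
qed

lemma join_image: "(f +++ g) ` {0..1} = f ` {0..1} \<union> g ` {0..1}" if "f 1 = g 0"
  using path_image_join[of f g] that by (simp add: path_image_def pathstart_def pathfinish_def)

lemma stack_Un_image:
  "stack (\<Union>i\<in>J. A i) (\<Union>i\<in>J. B i) = (\<Union>i\<in>J. stack (A i) (B i))"
  unfolding stack_def by blast

lemma braid_path_join:
  assumes f: "braid_path n f" and g: "braid_path n g" and fg: "f 1 = g 0"
  shows "braid_path n (f +++ g)" "braid_graph n (f +++ g) = stack (braid_graph n f) (braid_graph n g)"
proof -
  have ji: "(f +++ g) x i = ((\<lambda>x. f x i) +++ (\<lambda>x. g x i)) x" for x i by (simp add: joinpaths_def)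
  show "braid_path n (f +++ g)"
  proof (rule braid_pathI)
    show "pl_path {1..n} (f +++ g)"
      unfolding pl_path_def ji using pl_on_join[OF braid_path_pl[OF f] braid_path_pl[OF g]] fg by simp
    show "(f +++ g) x \<in> config {1..n}" if "x \<in> {0..1}" for x
      using braid_path_config[OF f, of "2 * x"] braid_path_config[OF g, of "2 * x - 1"] that
      by (auto simp: joinpaths_def)
    show "(f +++ g) 0 ` {1..n} = base n ` {1..n}" "(f +++ g) 1 ` {1..n} = base n ` {1..n}"
      using f g by (auto simp: braid_path_def joinpaths_def)
  qed
  have "strand_graph (f +++ g) i = stack (strand_graph f i) (strand_graph g i)" for i
  proof -
    let ?F = "\<lambda>x. (x / 2, f x i)" and ?G = "\<lambda>x. ((x + 1) / 2, g x i)"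
    have eq: "(\<lambda>x. (x, (f +++ g) x i)) = ?F +++ ?G"
      by (auto simp: joinpaths_def fun_eq_iff)
    have "strand_graph (f +++ g) i = ?F ` {0..1} \<union> ?G ` {0..1}"
      unfolding strand_graph_def eq by (rule join_image) (simp add: fg)
    also have "\<dots> = stack (strand_graph f i) (strand_graph g i)"
      unfolding stack_def strand_graph_def image_image by (simp add: case_prod_unfold)
    finally show ?thesis .
  qed
  then show "braid_graph n (f +++ g) = stack (braid_graph n f) (braid_graph n g)"
    by (simp add: braid_graph_def stack_Un_image)
qed

text \<open>
  The strands of the second factor are relabelled by the permutation \<open>\<sigma>\<close> at the end of the first, so
  that the product becomes a concatenation of paths.
\<close>

lemma stack_braid_graph:
  assumes f: "braid_path n f" and g: "braid_path n g" "g 0 = base n"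
    and s: "\<sigma> permutes {1..n}" "f 1 = base n \<circ> \<sigma>"
  shows "braid_path n (f +++ (\<lambda>x. g x \<circ> \<sigma>))"
    "stack (braid_graph n f) (braid_graph n g) = braid_graph n (f +++ (\<lambda>x. g x \<circ> \<sigma>))"
proof -
  have "f 1 = g 0 \<circ> \<sigma>" using g s by simp
  then show "braid_path n (f +++ (\<lambda>x. g x \<circ> \<sigma>))"
    "stack (braid_graph n f) (braid_graph n g) = braid_graph n (f +++ (\<lambda>x. g x \<circ> \<sigma>))"
    using braid_path_join[OF f braid_path_permute[OF s(1) g(1)]] braid_graph_permute[OF s(1)] by simp_all
qed

lemma homotopic_permute:
  assumes "\<sigma> permutes I" "homotopic_paths (config I) f g"
  shows "homotopic_paths (config I) (\<lambda>x. f x \<circ> \<sigma>) (\<lambda>x. g x \<circ> \<sigma>)"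
proof -
  have "homotopic_paths (config I) ((\<lambda>v. v \<circ> \<sigma>) \<circ> f) ((\<lambda>v. v \<circ> \<sigma>) \<circ> g)"
    by (rule homotopic_paths_continuous_image[OF assms(2) continuous_permute])
      (use config_permute[OF assms(1)] in blast)
  then show ?thesis by (simp add: comp_def)
qed

lemma join_0 [simp]: "(f +++ g) 0 = f 0" and join_1 [simp]: "(f +++ g) 1 = g 1"
  by (simp_all add: joinpaths_def)

lemma stack_isotopy:
  assumes 1: "(S, S') \<in> braid_isotopy n" and 2: "(T, T') \<in> braid_isotopy n"
  shows "(stack S T, stack S' T') \<in> braid_isotopy n"
proof -
  from 1 obtain f f' where f: "braid_path n f" "braid_path n f'" "f 0 = base n" "f' 0 = base n"
    "S = braid_graph n f" "S' = braid_graph n f'" "homotopic_paths (config {1..n}) f f'"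
    by (rule isotopy_imp_homotopic)
  from 2 obtain g g' where g: "braid_path n g" "braid_path n g'" "g 0 = base n" "g' 0 = base n"
    "T = braid_graph n g" "T' = braid_graph n g'" "homotopic_paths (config {1..n}) g g'"
    by (rule isotopy_imp_homotopic)
  obtain \<sigma> where s: "\<sigma> permutes {1..n}" "f 1 = base n \<circ> \<sigma>" by (rule braid_path_endE[OF f(1)])
  have "f' 1 = f 1" using homotopic_paths_imp_pathfinish[OF f(7)] by (simp add: pathfinish_def)
  then have s': "f' 1 = base n \<circ> \<sigma>" using s by simp
  have "homotopic_paths (config {1..n}) (f +++ (\<lambda>x. g x \<circ> \<sigma>)) (f' +++ (\<lambda>x. g' x \<circ> \<sigma>))"
    by (rule homotopic_paths_join[OF f(7) homotopic_permute[OF s(1) g(7)]])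
      (simp add: pathstart_def pathfinish_def s g)
  then show ?thesis
    unfolding f(5,6) g(5,6) stack_braid_graph(2)[OF f(1) g(1,3) s] stack_braid_graph(2)[OF f(2) g(2,4) s(1) s']
    by (intro homotopic_imp_isotopy stack_braid_graph(1)[OF f(1) g(1,3) s] stack_braid_graph(1)[OF f(2) g(2,4) s(1) s'])
qed

lemma stack_braids: "S \<in> braids n \<Longrightarrow> T \<in> braids n \<Longrightarrow> stack S T \<in> braids n"
  using stack_isotopy[of S S n T T] equiv_braid_isotopy[of n]
  by (auto simp: equiv_def refl_on_def)

lemma stack_assoc_isotopy:
  assumes "S \<in> braids n" "T \<in> braids n" "U \<in> braids n"
  shows "(stack (stack S T) U, stack S (stack T U)) \<in> braid_isotopy n"
proof -
  obtain f where f: "braid_path n f" "f 0 = base n" "S = braid_graph n f" using assms(1) by (rule braids_normal_form)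
  obtain g where g: "braid_path n g" "g 0 = base n" "T = braid_graph n g" using assms(2) by (rule braids_normal_form)
  obtain h where h: "braid_path n h" "h 0 = base n" "U = braid_graph n h" using assms(3) by (rule braids_normal_form)
  obtain \<sigma> where s: "\<sigma> permutes {1..n}" "f 1 = base n \<circ> \<sigma>" by (rule braid_path_endE[OF f(1)])
  obtain \<tau> where t: "\<tau> permutes {1..n}" "g 1 = base n \<circ> \<tau>" by (rule braid_path_endE[OF g(1)])
  let ?gs = "\<lambda>x. g x \<circ> \<sigma>" and ?ht = "\<lambda>x. h x \<circ> \<tau>" and ?hts = "\<lambda>x. h x \<circ> (\<tau> \<circ> \<sigma>)"
  have fgs: "braid_path n (f +++ ?gs)" "stack S T = braid_graph n (f +++ ?gs)"
    unfolding f(3) g(3) by (rule stack_braid_graph[OF f(1) g(1,2) s])+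
  have ts: "(\<tau> \<circ> \<sigma>) permutes {1..n}" "(f +++ ?gs) 1 = base n \<circ> (\<tau> \<circ> \<sigma>)"
    using permutes_compose[OF s(1) t(1)] t(2) by (simp_all add: comp_assoc)
  have L: "braid_path n ((f +++ ?gs) +++ ?hts)" "stack (stack S T) U = braid_graph n ((f +++ ?gs) +++ ?hts)"
    unfolding fgs(2) h(3) by (rule stack_braid_graph[OF fgs(1) h(1,2) ts])+
  have ght: "braid_path n (g +++ ?ht)" "stack T U = braid_graph n (g +++ ?ht)"
    unfolding g(3) h(3) by (rule stack_braid_graph[OF g(1) h(1,2) t])+
  have eq: "(\<lambda>x. (g +++ ?ht) x \<circ> \<sigma>) = ?gs +++ ?hts"
    by (auto simp: joinpaths_def fun_eq_iff)
  have R: "braid_path n (f +++ (?gs +++ ?hts))" "stack S (stack T U) = braid_graph n (f +++ (?gs +++ ?hts))"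
    unfolding ght(2) f(3) eq[symmetric] by (rule stack_braid_graph[OF f(1) ght(1) _ s]; simp add: g(2))+
  have p: "path p \<and> path_image p \<subseteq> config {1..n}" if "braid_path n p" for p
    using that by (simp add: braid_path_def)
  have "homotopic_paths (config {1..n}) (f +++ (?gs +++ ?hts)) ((f +++ ?gs) +++ ?hts)"
  proof (rule homotopic_paths_assoc)
    show "pathfinish f = pathstart ?gs" by (simp only: pathstart_def pathfinish_def s(2) g(2))
    show "pathfinish ?gs = pathstart ?hts"
      by (simp only: pathstart_def pathfinish_def t(2) h(2) comp_assoc)
  qed (use p[OF f(1)] p[OF braid_path_permute[OF s(1) g(1)]] p[OF braid_path_permute[OF ts(1) h(1)]] in simp_all)
  then show ?thesis
    unfolding L(2) R(2) by (intro homotopic_imp_isotopy[OF L(1) R(1)]) (rule homotopic_paths_sym)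
qed

lemma identity_braid_graph: "identity_braid n = braid_graph n (\<lambda>x. base n)"
proof -
  have "{0..1} \<times> {(real i / (real n + 1), 1 / 2)} = strand_graph (\<lambda>x. base n) i" if "i \<in> {1..n}" for i
    using that by (auto simp: strand_graph_def base_def)
  then show ?thesis by (simp add: identity_braid_def braid_graph_def)
qed

lemma identity_in_braids: "identity_braid n \<in> braids n"
  by (simp add: identity_braid_graph braid_graph_in_braids braid_path_const)

lemma homotopic_join_const:
  assumes "path p" "path_image p \<subseteq> S"
  shows "homotopic_paths S (p +++ (\<lambda>x. p 1)) p" "homotopic_paths S ((\<lambda>x. p 0) +++ p) p"
proof -
  have "homotopic_paths S p (p +++ (\<lambda>x. p 1))"
  proof (rule homotopic_paths_reparametrize[OF assms, where f = "\<lambda>x. min (2 * x) 1"])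
    show "continuous_on {0..1} (\<lambda>x::real. min (2 * x) 1)" by (intro continuous_intros)
    show "(p +++ (\<lambda>x. p 1)) t = p (min (2 * t) 1)" for t by (simp add: joinpaths_def min_def)
  qed auto
  then show "homotopic_paths S (p +++ (\<lambda>x. p 1)) p" by (rule homotopic_paths_sym)
  have "homotopic_paths S p ((\<lambda>x. p 0) +++ p)"
  proof (rule homotopic_paths_reparametrize[OF assms, where f = "\<lambda>x. max (2 * x - 1) 0"])
    show "continuous_on {0..1} (\<lambda>x::real. max (2 * x - 1) 0)" by (intro continuous_intros)
    show "((\<lambda>x. p 0) +++ p) t = p (max (2 * t - 1) 0)" for t by (auto simp: joinpaths_def max_def)
  qed auto
  then show "homotopic_paths S ((\<lambda>x. p 0) +++ p) p" by (rule homotopic_paths_sym)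
qed

lemma homotopic_join_reverse:
  assumes "path p" "path_image p \<subseteq> S"
  shows "homotopic_paths S (p +++ reversepath p) (\<lambda>x. p 0)"
proof -
  have c: "continuous_on {0..1} p" using assms(1) by (simp add: path_def)
  let ?u = "\<lambda>z::real \<times> real. (1 - fst z) * min (2 * snd z) (2 - 2 * snd z)"
  have u: "?u z \<in> {0..1}" if "z \<in> {0..1} \<times> {0..1}" for z
  proof -
    have "0 \<le> min (2 * snd z) (2 - 2 * snd z)" "min (2 * snd z) (2 - 2 * snd z) \<le> 1" using that by auto
    then show ?thesis using that mult_mono[of "1 - fst z" 1 "min (2 * snd z) (2 - 2 * snd z)" 1] by auto
  qed
  have eq: "(p +++ reversepath p) x = p (min (2 * x) (2 - 2 * x))" for x
    by (auto simp: joinpaths_def reversepath_def min_def algebra_simps)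
  show ?thesis unfolding homotopic_paths
  proof (intro exI[of _ "\<lambda>z. p (?u z)"] conjI ballI)
    show "continuous_on ({0..1} \<times> {0..1}) (\<lambda>z. p (?u z))"
      by (rule continuous_on_compose2[OF c]) (use u in \<open>auto intro!: continuous_intros\<close>)
    show "(\<lambda>z. p (?u z)) \<in> {0..1} \<times> {0..1} \<rightarrow> S"
      using u assms(2) by (auto simp: path_image_def)
    show "pathstart ((\<lambda>z. p (?u z)) \<circ> Pair t) = pathstart (p +++ reversepath p)"
      "pathfinish ((\<lambda>z. p (?u z)) \<circ> Pair t) = pathfinish (p +++ reversepath p)" for t
      by (simp_all add: pathstart_def pathfinish_def reversepath_def)
  qed (simp_all add: eq)
qed

lemma stack_identity_isotopy:
  assumes "T \<in> braids n"
  shows "(stack T (identity_braid n), T) \<in> braid_isotopy n" "(stack (identity_braid n) T, T) \<in> braid_isotopy n"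
proof -
  obtain f where f: "braid_path n f" "f 0 = base n" "T = braid_graph n f" using assms by (rule braids_normal_form)
  obtain \<sigma> where s: "\<sigma> permutes {1..n}" "f 1 = base n \<circ> \<sigma>" by (rule braid_path_endE[OF f(1)])
  have p: "path f" "path_image f \<subseteq> config {1..n}" using f by (auto simp: braid_path_def)
  have 1: "stack T (identity_braid n) = braid_graph n (f +++ (\<lambda>x. f 1))" "braid_path n (f +++ (\<lambda>x. f 1))"
    using stack_braid_graph[OF f(1) braid_path_const _ s] f s by (simp_all add: identity_braid_graph)
  show "(stack T (identity_braid n), T) \<in> braid_isotopy n"
    using homotopic_imp_isotopy[OF 1(2) f(1) homotopic_join_const(1)[OF p]] 1(1) f(3) by simp
  have 2: "stack (identity_braid n) T = braid_graph n ((\<lambda>x. f 0) +++ f)" "braid_path n ((\<lambda>x. f 0) +++ f)"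
    using braid_path_join[OF braid_path_const f(1)] f by (simp_all add: identity_braid_graph)
  show "(stack (identity_braid n) T, T) \<in> braid_isotopy n"
    using homotopic_imp_isotopy[OF 2(2) f(1) homotopic_join_const(2)[OF p]] 2(1) f(3) by simp
qed

lemma braid_inverse_isotopy:
  assumes "T \<in> braids n"
  shows "\<exists>U\<in>braids n. (stack U T, identity_braid n) \<in> braid_isotopy n"
proof -
  obtain f where f: "braid_path n f" "f 0 = base n" "T = braid_graph n f" using assms by (rule braids_normal_form)
  obtain \<sigma> where s: "\<sigma> permutes {1..n}" "f 1 \<circ> \<sigma> = base n"
    using arrangement_permutation[OF braid_path_config[OF f(1), of 1]] f(1) by (auto simp: braid_path_def)
  let ?fs = "\<lambda>x. f x \<circ> \<sigma>"
  let ?g = "reversepath ?fs"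
  have fs: "braid_path n ?fs" by (rule braid_path_permute[OF s(1) f(1)])
  have g: "braid_path n ?g"
  proof (rule braid_pathI)
    show "pl_path {1..n} ?g"
      using pl_on_reverse[OF braid_path_pl[OF fs]] by (simp add: pl_path_def reversepath_def)
    show "?g x \<in> config {1..n}" if "x \<in> {0..1}" for x
      using braid_path_config[OF fs, of "1 - x"] that by (simp add: reversepath_def)
    show "?g 0 ` {1..n} = base n ` {1..n}" "?g 1 ` {1..n} = base n ` {1..n}"
      using fs by (simp_all add: braid_path_def reversepath_def)
  qed
  have g01: "?g 0 = base n" "?g 1 = f 0 \<circ> \<sigma>" using s by (simp_all add: reversepath_def)
  have st: "stack (braid_graph n ?g) T = braid_graph n (?g +++ ?fs)" "braid_path n (?g +++ ?fs)"
    using stack_braid_graph[OF g f(1,2) s(1)] g01 f by simp_all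
  have "homotopic_paths (config {1..n}) (?g +++ reversepath ?g) (\<lambda>x. ?g 0)"
    by (rule homotopic_join_reverse) (use g in \<open>auto simp: braid_path_def\<close>)
  then have "homotopic_paths (config {1..n}) (?g +++ ?fs) (\<lambda>x. base n)" by (simp add: g01)
  then have "(stack (braid_graph n ?g) T, identity_braid n) \<in> braid_isotopy n"
    unfolding st(1) identity_braid_graph by (rule homotopic_imp_isotopy[OF st(2) braid_path_const])
  then show ?thesis using braid_graph_in_braids[OF g] by blast
qed

text \<open>
  If a product is compatible with an equivalence relation and satisfies the monoid laws up to it,
  then the classes form a monoid with the product of representatives.
\<close>

lemma quotient_monoid_mult:
  assumes r: "equiv S r" and cong: "\<And>a a' b b'. (a, a') \<in> r \<Longrightarrow> (b, b') \<in> r \<Longrightarrow> (m a b, m a' b') \<in> r"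
    and "a \<in> S" "b \<in> S"
  shows "monoid.mult (quotient_monoid S r m e) (r `` {a}) (r `` {b}) = r `` {m a b}"
proof -
  have "r `` {m a' b'} = r `` {m a b}" if "(a, a') \<in> r" "(b, b') \<in> r" for a' b'
    using equiv_class_eq[OF r cong[OF that]] by simp
  then have "(\<Union>a'\<in>r `` {a}. \<Union>b'\<in>r `` {b}. r `` {m a' b'}) = (\<Union>a'\<in>r `` {a}. \<Union>b'\<in>r `` {b}. r `` {m a b})"
    by (intro SUP_cong refl) simp
  moreover have "a \<in> r `` {a}" "b \<in> r `` {b}"
    using equiv_class_self[OF r] assms(3,4) by blast+
  ultimately show ?thesis unfolding quotient_monoid_def by (simp add: UN_constant) blast
qed

lemma quotient_monoid_monoid:
  assumes r: "equiv S r" and cong: "\<And>a a' b b'. (a, a') \<in> r \<Longrightarrow> (b, b') \<in> r \<Longrightarrow> (m a b, m a' b') \<in> r"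
    and "e \<in> S" and m: "\<And>a b. a \<in> S \<Longrightarrow> b \<in> S \<Longrightarrow> m a b \<in> S"
    and assoc: "\<And>a b c. a \<in> S \<Longrightarrow> b \<in> S \<Longrightarrow> c \<in> S \<Longrightarrow> (m (m a b) c, m a (m b c)) \<in> r"
    and unit: "\<And>a. a \<in> S \<Longrightarrow> (m e a, a) \<in> r" "\<And>a. a \<in> S \<Longrightarrow> (m a e, a) \<in> r"
  shows "Group.monoid (quotient_monoid S r m e)"
proof -
  let ?M = "quotient_monoid S r m e"
  have carrier: "carrier ?M = S // r" and one: "\<one>\<^bsub>?M\<^esub> = r `` {e}"
    by (simp_all add: quotient_monoid_def)
  note mult = quotient_monoid_mult[OF r cong]
  show ?thesis
  proof (rule monoidI)
    show "x \<otimes>\<^bsub>?M\<^esub> y \<in> carrier ?M" if "x \<in> carrier ?M" "y \<in> carrier ?M" for x y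
      using that unfolding carrier by (elim quotientE) (simp add: mult m quotientI)
    show "\<one>\<^bsub>?M\<^esub> \<in> carrier ?M" unfolding carrier one using \<open>e \<in> S\<close> by (rule quotientI)
    show "x \<otimes>\<^bsub>?M\<^esub> y \<otimes>\<^bsub>?M\<^esub> z = x \<otimes>\<^bsub>?M\<^esub> (y \<otimes>\<^bsub>?M\<^esub> z)"
      if "x \<in> carrier ?M" "y \<in> carrier ?M" "z \<in> carrier ?M" for x y z
      using that unfolding carrier by (elim quotientE) (simp add: mult m equiv_class_eq[OF r assoc])
    show "\<one>\<^bsub>?M\<^esub> \<otimes>\<^bsub>?M\<^esub> x = x" if "x \<in> carrier ?M" for x
      using that unfolding carrier one by (elim quotientE) (simp add: mult \<open>e \<in> S\<close> equiv_class_eq[OF r unit(1)])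
    show "x \<otimes>\<^bsub>?M\<^esub> \<one>\<^bsub>?M\<^esub> = x" if "x \<in> carrier ?M" for x
      using that unfolding carrier one by (elim quotientE) (simp add: mult \<open>e \<in> S\<close> equiv_class_eq[OF r unit(2)])
  qed
qed

lemma group_braid_group: "Group.group (braid_group n)"
proof -
  let ?G = "braid_group n"
  note r = equiv_braid_isotopy[of n]
  have mon: "Group.monoid ?G" unfolding braid_group_def
    by (rule quotient_monoid_monoid[OF r stack_isotopy identity_in_braids stack_braids stack_assoc_isotopy
        stack_identity_isotopy(2) stack_identity_isotopy(1)])
  have carrier: "carrier ?G = braids n // braid_isotopy n" and one: "\<one>\<^bsub>?G\<^esub> = braid_isotopy n `` {identity_braid n}"
    by (simp_all add: braid_group_def quotient_monoid_def)
  have inv: "\<exists>y\<in>carrier ?G. y \<otimes>\<^bsub>?G\<^esub> x = \<one>\<^bsub>?G\<^esub>" if x: "x \<in> carrier ?G" for x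
  proof -
    obtain T where T: "T \<in> braids n" "x = braid_isotopy n `` {T}" using x unfolding carrier quotient_def by blast
    obtain U where U: "U \<in> braids n" "(stack U T, identity_braid n) \<in> braid_isotopy n"
      using braid_inverse_isotopy[OF T(1)] by blast
    have "braid_isotopy n `` {U} \<otimes>\<^bsub>?G\<^esub> x = \<one>\<^bsub>?G\<^esub>"
      unfolding T(2) one using quotient_monoid_mult[OF r stack_isotopy U(1) T(1)] equiv_class_eq[OF r U(2)]
      by (simp add: braid_group_def)
    then show ?thesis unfolding carrier using quotientI[OF U(1)] by blast
  qed
  show ?thesis
    using mon inv by (intro groupI) (auto simp: monoid.m_closed monoid.one_closed monoid.m_assoc monoid.l_one)
qed

section \<open>String links\<close>

lemma string_link_equivalence_iff:
  "(T, T') \<in> string_link_equivalence n \<longleftrightarrow>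
     T \<in> string_links n \<and> T' \<in> string_links n \<and> (\<exists>h k. rel_homeo h k \<and> h ` T = T')"
  by (auto simp: string_link_equivalence_def rel_homeo_def)

text \<open>
  Strands oriented from left to right and labelled by their starting points; strand \<open>i\<close> ends
  at the base point with number \<open>\<sigma> i\<close>.
\<close>

definition oriented_strands :: "nat \<Rightarrow> (nat \<Rightarrow> nat) \<Rightarrow> (nat \<Rightarrow> real \<Rightarrow> point) \<Rightarrow> bool" where
  "oriented_strands n \<sigma> \<gamma> \<longleftrightarrow>
     \<sigma> permutes {1..n} \<and> disjoint_family_on (\<lambda>i. path_image (\<gamma> i)) {1..n} \<and>
     (\<forall>i\<in>{1..n}. arc (\<gamma> i) \<and> pl_on {0..1} (\<gamma> i) \<and> \<gamma> i 0 = (0, base n i) \<and>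
        \<gamma> i 1 = (1, base n (\<sigma> i)) \<and> (\<forall>s. 0 < s \<and> s < 1 \<longrightarrow> \<gamma> i s \<in> interior tangle_ball))"

lemma oriented_strandsD:
  assumes "oriented_strands n \<sigma> \<gamma>"
  shows "\<sigma> permutes {1..n}"
    "\<And>i j. i \<in> {1..n} \<Longrightarrow> j \<in> {1..n} \<Longrightarrow> i \<noteq> j \<Longrightarrow> path_image (\<gamma> i) \<inter> path_image (\<gamma> j) = {}"
    "\<And>i. i \<in> {1..n} \<Longrightarrow> arc (\<gamma> i)" "\<And>i. i \<in> {1..n} \<Longrightarrow> pl_on {0..1} (\<gamma> i)"
    "\<And>i. i \<in> {1..n} \<Longrightarrow> \<gamma> i 0 = (0, base n i)" "\<And>i. i \<in> {1..n} \<Longrightarrow> \<gamma> i 1 = (1, base n (\<sigma> i))"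
    "\<And>i s. i \<in> {1..n} \<Longrightarrow> 0 < s \<Longrightarrow> s < 1 \<Longrightarrow> \<gamma> i s \<in> interior tangle_ball"
    "\<And>i. i \<in> {1..n} \<Longrightarrow> \<sigma> i \<in> {1..n}"
  using assms permutes_in_image[of \<sigma> "{1..n}"] unfolding oriented_strands_def disjoint_family_on_def
  by (metis | blast)+

lemma mem_interior_tangle_ball: "p \<in> interior tangle_ball \<longleftrightarrow> 0 < fst p \<and> fst p < 1 \<and> snd p \<in> open_square"
  by (cases p) (simp add: interior_tangle_ball)

lemma oriented_strands_cases:
  assumes "oriented_strands n \<sigma> \<gamma>" "i \<in> {1..n}" "p \<in> path_image (\<gamma> i)"
  shows "p = (0, base n i) \<or> p = (1, base n (\<sigma> i)) \<or> p \<in> interior tangle_ball"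
proof -
  obtain s where s: "s \<in> {0..1}" "p = \<gamma> i s" using assms(3) by (auto simp: path_image_def)
  then consider "s = 0" | "s = 1" | "0 < s" "s < 1" by force
  then show ?thesis using oriented_strandsD[OF assms(1)] assms(2) s(2) by cases auto
qed

lemma oriented_strands_square:
  assumes "oriented_strands n \<sigma> \<gamma>" "i \<in> {1..n}" "p \<in> path_image (\<gamma> i)"
  shows "snd p \<in> open_square" "fst p \<in> {0..1}"
proof -
  have "base n i \<in> open_square" "base n (\<sigma> i) \<in> open_square"
    using base_in_square[OF assms(2)] base_in_square[OF oriented_strandsD(8)[OF assms(1,2)]] .
  then show "snd p \<in> open_square" "fst p \<in> {0..1}"
    using oriented_strands_cases[OF assms] by (auto simp: mem_interior_tangle_ball)
qed

lemma oriented_strands_left: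
  assumes "oriented_strands n \<sigma> \<gamma>" "i \<in> {1..n}" "p \<in> path_image (\<gamma> i)" "fst p = 0"
  shows "p = (0, base n i)"
  using oriented_strands_cases[OF assms(1-3)] assms(4) by (auto simp: mem_interior_tangle_ball)

lemma oriented_strands_right:
  assumes "oriented_strands n \<sigma> \<gamma>" "i \<in> {1..n}" "p \<in> path_image (\<gamma> i)" "fst p = 1"
  shows "p = (1, base n (\<sigma> i))"
  using oriented_strands_cases[OF assms(1-3)] assms(4) by (auto simp: mem_interior_tangle_ball)

lemma strand_unionE:
  assumes "p \<in> strand_union n \<gamma>" obtains i where "i \<in> {1..n}" "p \<in> path_image (\<gamma> i)"
  using assms unfolding strand_union_def by blast

lemma string_linkI:
  assumes g: "oriented_strands n \<sigma> \<gamma>" shows "strand_union n \<gamma> \<in> string_links n"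
proof -
  note D = oriented_strandsD[OF g]
  have ends: "(\<Union>i\<in>{1..n}. {pathstart (\<gamma> i), pathfinish (\<gamma> i)}) = endpoints n"
  proof -
    have "(\<Union>i\<in>{1..n}. {pathstart (\<gamma> i), pathfinish (\<gamma> i)}) =
        {0} \<times> base n ` {1..n} \<union> {1} \<times> base n ` (\<sigma> ` {1..n})"
      using D(5,6) by (auto simp: pathstart_def pathfinish_def)
    then show ?thesis using permutes_image[OF D(1)] by (auto simp: endpoints_eq)
  qed
  have ball: "strand_union n \<gamma> \<subseteq> tangle_ball"
  proof
    fix p assume "p \<in> strand_union n \<gamma>"
    then obtain i where "i \<in> {1..n}" "p \<in> path_image (\<gamma> i)" by (rule strand_unionE)
    then show "p \<in> tangle_ball"
      using oriented_strands_square[OF g] tangle_ballI[of "fst p" "snd p"] by simp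
  qed
  have e: "endpoints n \<subseteq> strand_union n \<gamma>"
    unfolding ends[symmetric] strand_union_def by (intro UN_mono) auto
  have "strand_union n \<gamma> \<inter> frontier tangle_ball = endpoints n"
  proof
    show "strand_union n \<gamma> \<inter> frontier tangle_ball \<subseteq> endpoints n"
    proof
      fix p assume p: "p \<in> strand_union n \<gamma> \<inter> frontier tangle_ball"
      then obtain i where i: "i \<in> {1..n}" "p \<in> path_image (\<gamma> i)" by (auto elim: strand_unionE)
      have "p \<notin> interior tangle_ball" using p by (simp add: frontier_def)
      then have "p = (0, base n i) \<or> p = (1, base n (\<sigma> i))"
        using oriented_strands_cases[OF g i] by blast
      then show "p \<in> endpoints n" using i(1) D(8)[OF i(1)] unfolding endpoints_eq by blast
    qed
    have "endpoints n \<subseteq> frontier tangle_ball"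
    proof
      fix p assume p: "p \<in> endpoints n"
      then obtain x q where "p = (x, q)" "x = 0 \<or> x = 1" by (auto simp: endpoints_eq)
      moreover have "p \<in> tangle_ball" using p e ball by blast
      ultimately show "p \<in> frontier tangle_ball" by (auto simp: mem_frontier_tangle_ball)
    qed
    with e show "endpoints n \<subseteq> strand_union n \<gamma> \<inter> frontier tangle_ball" by blast
  qed
  then have "tangle_strands n \<gamma>"
    using D(3,4) ends ball g unfolding tangle_strands_def oriented_strands_def by blast
  moreover have "pathstart (\<gamma> i) \<in> left_face \<and> pathfinish (\<gamma> i) \<in> right_face" if "i \<in> {1..n}" for i
    using D(5,6)[OF that] base_in_square[OF that] base_in_square[OF D(8)[OF that]]
    by (auto simp: pathstart_def pathfinish_def left_face_def right_face_def open_square_def)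
  ultimately show ?thesis unfolding string_links_def string_link_strands_def by blast
qed

text \<open>
  Every string link has strands in this form: those running from right to left are reversed, and
  all are relabelled by their starting points.
\<close>

lemma string_linkE:
  assumes "T \<in> string_links n"
  obtains \<sigma> \<gamma> where "oriented_strands n \<sigma> \<gamma>" "T = strand_union n \<gamma>"
proof -
  obtain \<gamma>0 where sl: "string_link_strands n \<gamma>0" and T: "T = strand_union n \<gamma>0"
    using assms by (auto simp: string_links_def)
  then have ts: "tangle_strands n \<gamma>0" by (simp add: string_link_strands_def)
  have arc0: "arc (\<gamma>0 i)" and pl0: "pl_on {0..1} (\<gamma>0 i)" if "i \<in> {1..n}" for i
    using ts that unfolding tangle_strands_def by blast+
  have dis0: "path_image (\<gamma>0 i) \<inter> path_image (\<gamma>0 j) = {}" if "i \<in> {1..n}" "j \<in> {1..n}" "i \<noteq> j" for i j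
    using ts that unfolding tangle_strands_def disjoint_family_on_def by blast
  have ends0: "(\<Union>i\<in>{1..n}. {pathstart (\<gamma>0 i), pathfinish (\<gamma>0 i)}) = endpoints n"
    and ball0: "strand_union n \<gamma>0 \<subseteq> tangle_ball"
    and fr0: "strand_union n \<gamma>0 \<inter> frontier tangle_ball = endpoints n"
    using ts unfolding tangle_strands_def by blast+
  define \<gamma>1 where "\<gamma>1 = (\<lambda>i. if fst (\<gamma>0 i 0) = 0 then \<gamma>0 i else reversepath (\<gamma>0 i))"
  have im1: "path_image (\<gamma>1 i) = path_image (\<gamma>0 i)" for i by (simp add: \<gamma>1_def)
  have arc1: "arc (\<gamma>1 i)" if "i \<in> {1..n}" for i using arc0[OF that] by (simp add: \<gamma>1_def arc_reversepath)
  have pl1: "pl_on {0..1} (\<gamma>1 i)" if "i \<in> {1..n}" for i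
  proof -
    have "pl_on {0..1} (reversepath (\<gamma>0 i))"
      using pl_on_reverse[OF pl0[OF that]] by (simp add: reversepath_def)
    then show ?thesis using pl0[OF that] by (simp add: \<gamma>1_def)
  qed
  have fst1: "fst (\<gamma>1 i 0) = 0" "fst (\<gamma>1 i 1) = 1" if "i \<in> {1..n}" for i
  proof -
    have "pathstart (\<gamma>0 i) \<in> left_face \<and> pathfinish (\<gamma>0 i) \<in> right_face \<or>
        pathstart (\<gamma>0 i) \<in> right_face \<and> pathfinish (\<gamma>0 i) \<in> left_face"
      using sl that unfolding string_link_strands_def by blast
    then show "fst (\<gamma>1 i 0) = 0" "fst (\<gamma>1 i 1) = 1"
      by (auto simp: \<gamma>1_def left_face_def right_face_def pathstart_def pathfinish_def mem_Times_iff reversepath_def)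
  qed
  have end1: "\<gamma>1 i 0 \<in> endpoints n" "\<gamma>1 i 1 \<in> endpoints n" if "i \<in> {1..n}" for i
  proof -
    have "{pathstart (\<gamma>0 i), pathfinish (\<gamma>0 i)} \<subseteq> endpoints n" using ends0 that by blast
    then show "\<gamma>1 i 0 \<in> endpoints n" "\<gamma>1 i 1 \<in> endpoints n"
      by (auto simp: \<gamma>1_def pathstart_def pathfinish_def reversepath_def)
  qed
  have int1: "\<gamma>1 i s \<in> interior tangle_ball" if i: "i \<in> {1..n}" and s: "0 < s" "s < 1" for i s
  proof (rule ccontr)
    assume n: "\<gamma>1 i s \<notin> interior tangle_ball"
    have im: "\<gamma>1 i r \<in> path_image (\<gamma>0 i)" if "r \<in> {0..1}" for r
      using imageI[OF that, of "\<gamma>1 i"] im1[of i] by (simp add: path_image_def)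
    have "\<gamma>1 i s \<in> strand_union n \<gamma>0"
      unfolding strand_union_def using im[of s] s i by auto
    then have "\<gamma>1 i s \<in> endpoints n"
      using n ball0 fr0 closure_tangle_ball by (auto simp: frontier_def)
    then obtain j where j: "j \<in> {1..n}" "\<gamma>1 i s \<in> {pathstart (\<gamma>0 j), pathfinish (\<gamma>0 j)}"
      using ends0 by blast
    then have "\<gamma>1 i s \<in> path_image (\<gamma>0 j)" by auto
    then have "j = i" using dis0[OF i j(1)] im[of s] s by auto
    then have "\<gamma>1 i s = \<gamma>1 i 0 \<or> \<gamma>1 i s = \<gamma>1 i 1"
      using j(2) by (auto simp: \<gamma>1_def pathstart_def pathfinish_def reversepath_def)
    then have "s = 0 \<or> s = 1"
      using inj_onD[of "\<gamma>1 i" "{0..1}" s 0] inj_onD[of "\<gamma>1 i" "{0..1}" s 1] arc1[OF i] s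
      by (auto simp: arc_def)
    then show False using s by simp
  qed
  have arr: "\<exists>\<tau>. \<tau> permutes {1..n} \<and> w \<circ> \<tau> = base n"
    if s: "s = 0 \<or> s = (1::real)" and w: "\<And>i. i \<in> {1..n} \<Longrightarrow> w i = snd (\<gamma>1 i s)" "\<And>i. i \<notin> {1..n} \<Longrightarrow> w i = 0" for w s
  proof (rule arrangement_permutation)
    have b: "w i \<in> base n ` {1..n}" if "i \<in> {1..n}" for i
      using end1[OF that] w(1)[OF that] s unfolding endpoints_eq by (auto simp: mem_Times_iff)
    then show "w ` {1..n} \<subseteq> base n ` {1..n}" by blast
    show "w \<in> config {1..n}"
    proof (rule configI)
      show "w i \<in> open_square" if "i \<in> {1..n}" for i using b[OF that] by (metis imageE base_in_square)
      show "i = j" if "i \<in> {1..n}" "j \<in> {1..n}" "w i = w j" for i j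
      proof (rule ccontr)
        assume "i \<noteq> j"
        have "\<gamma>1 i s = \<gamma>1 j s"
          using fst1[OF that(1)] fst1[OF that(2)] w(1)[OF that(1)] w(1)[OF that(2)] that(3) s
          by (auto simp: prod_eq_iff)
        moreover have "\<gamma>1 i s \<in> path_image (\<gamma>0 i)" "\<gamma>1 j s \<in> path_image (\<gamma>0 j)"
          using imageI[of s "{0..1}" "\<gamma>1 i"] imageI[of s "{0..1}" "\<gamma>1 j"] im1[of i] im1[of j] s
          by (auto simp: path_image_def)
        ultimately show False using dis0[OF that(1,2) \<open>i \<noteq> j\<close>] by auto
      qed
    qed (rule w(2))
  qed
  define w where "w = (\<lambda>s i. if i \<in> {1..n} then snd (\<gamma>1 i s) else 0)"
  have w: "w s i = snd (\<gamma>1 i s)" if "i \<in> {1..n}" for i s using that by (simp only: w_def if_True)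
  have w0: "w s i = 0" if "i \<notin> {1..n}" for i s using that by (simp only: w_def if_False)
  obtain \<tau> where t: "\<tau> permutes {1..n}" "w 0 \<circ> \<tau> = base n" using arr[of 0 "w 0"] w w0 by blast
  obtain \<rho> where r: "\<rho> permutes {1..n}" "w 1 \<circ> \<rho> = base n" using arr[of 1 "w 1"] w w0 by blast
  define \<sigma> where "\<sigma> = Hilbert_Choice.inv \<rho> \<circ> \<tau>"
  have s: "\<sigma> permutes {1..n}"
    unfolding \<sigma>_def using permutes_compose[OF t(1) permutes_inv[OF r(1)]] .
  have tin: "\<tau> i \<in> {1..n}" if "i \<in> {1..n}" for i using permutes_in_image[OF t(1)] that by blast
  have w1: "w 1 (\<tau> i) = base n (\<sigma> i)" for i
    unfolding r(2)[symmetric] \<sigma>_def using permutes_inverses(1)[OF r(1)] by simp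
  define \<gamma> where "\<gamma> = (\<lambda>i. \<gamma>1 (\<tau> i))"
  have "oriented_strands n \<sigma> \<gamma>"
    unfolding oriented_strands_def
  proof (intro conjI ballI allI impI)
    show "disjoint_family_on (\<lambda>i. path_image (\<gamma> i)) {1..n}"
      unfolding disjoint_family_on_def
    proof (intro ballI impI)
      fix i j assume ij: "i \<in> {1..n}" "j \<in> {1..n}" "i \<noteq> j"
      then have "\<tau> i \<noteq> \<tau> j" using permutes_inj[OF t(1)] by (simp add: inj_eq)
      then show "path_image (\<gamma> i) \<inter> path_image (\<gamma> j) = {}"
        using dis0[OF tin[OF ij(1)] tin[OF ij(2)]] by (simp add: \<gamma>_def im1)
    qed
    fix i assume i: "i \<in> {1..n}"
    show "arc (\<gamma> i)" "pl_on {0..1} (\<gamma> i)" using arc1[OF tin[OF i]] pl1[OF tin[OF i]] by (simp_all add: \<gamma>_def)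
    show "\<gamma> i 0 = (0, base n i)"
      using fst1(1)[OF tin[OF i]] w[OF tin[OF i], of 0] fun_cong[OF t(2), of i] by (simp add: \<gamma>_def prod_eq_iff)
    show "\<gamma> i 1 = (1, base n (\<sigma> i))"
      using fst1(2)[OF tin[OF i]] w[OF tin[OF i], of 1] w1[of i] by (simp add: \<gamma>_def prod_eq_iff)
    show "\<gamma> i s \<in> interior tangle_ball" if "0 < s \<and> s < 1" for s
      using int1[OF tin[OF i]] that by (simp add: \<gamma>_def)
  qed (rule s)
  moreover have "T = strand_union n \<gamma>"
  proof -
    have "strand_union n \<gamma> = (\<Union>i\<in>\<tau> ` {1..n}. path_image (\<gamma>0 i))"
      by (simp add: strand_union_def \<gamma>_def im1)
    then show ?thesis unfolding permutes_image[OF t(1)] T strand_union_def by simp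
  qed
  ultimately show thesis using that by blast
qed

lemma string_link_subset: assumes "T \<in> string_links n" "p \<in> T" shows "p \<in> tangle_ball" "snd p \<in> open_square"
proof -
  obtain \<sigma> \<gamma> where g: "oriented_strands n \<sigma> \<gamma>" "T = strand_union n \<gamma>" using assms(1) by (rule string_linkE)
  then obtain i where "i \<in> {1..n}" "p \<in> path_image (\<gamma> i)" using assms(2) by (auto elim: strand_unionE)
  then show "p \<in> tangle_ball" "snd p \<in> open_square"
    using oriented_strands_square[OF g(1)] tangle_ballI[of "fst p" "snd p"] by simp_all
qed

lemma compact_string_link: assumes "T \<in> string_links n" shows "compact T"
proof -
  obtain \<sigma> \<gamma> where g: "oriented_strands n \<sigma> \<gamma>" "T = strand_union n \<gamma>" using assms by (rule string_linkE)
  then show ?thesis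
    unfolding strand_union_def using oriented_strandsD(3)[OF g(1)] by (auto intro!: compact_UN compact_arc_image)
qed

lemma rel_homeo_interior:
  assumes h: "rel_homeo h k" and p: "p \<in> interior tangle_ball" shows "h p \<in> interior tangle_ball"
proof (rule ccontr)
  have pB: "p \<in> tangle_ball" using p interior_subset by blast
  assume "h p \<notin> interior tangle_ball"
  then have fr: "h p \<in> frontier tangle_ball"
    using rel_homeo_mem[OF h pB] closure_tangle_ball by (auto simp: frontier_def)
  then have "h (h p) = h p" by (rule rel_homeo_frontier[OF h])
  then have "h p = p" using inj_onD[OF rel_homeo_inj_on[OF h]] rel_homeo_mem[OF h pB] pB by blast
  then show False using fr p by (simp add: frontier_def)
qed

lemma rel_homeo_string_link:
  assumes h: "rel_homeo h k" and T: "T \<in> string_links n" shows "h ` T \<in> string_links n"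
proof -
  obtain \<sigma> \<gamma> where g: "oriented_strands n \<sigma> \<gamma>" "T = strand_union n \<gamma>" using T by (rule string_linkE)
  note D = oriented_strandsD[OF g(1)]
  have sub: "path_image (\<gamma> i) \<subseteq> tangle_ball" if "i \<in> {1..n}" for i
    using string_link_subset[OF T] that g(2) unfolding strand_union_def by blast
  have inj: "inj_on h tangle_ball" by (rule rel_homeo_inj_on[OF h])
  have cont: "continuous_on tangle_ball h" by (rule pl_on_imp_continuous_on[OF rel_homeo_pl[OF h]])
  have fr: "(0, base n i) \<in> frontier tangle_ball" "(1, base n i) \<in> frontier tangle_ball" if "i \<in> {1..n}" for i
    using base_in_square[OF that] by (auto simp: mem_frontier_tangle_ball intro: tangle_ballI)
  have "oriented_strands n \<sigma> (\<lambda>i. h \<circ> \<gamma> i)"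
    unfolding oriented_strands_def
  proof (intro conjI ballI allI impI)
    show "disjoint_family_on (\<lambda>i. path_image (h \<circ> \<gamma> i)) {1..n}"
      unfolding disjoint_family_on_def path_image_compose
    proof (intro ballI impI)
      fix i j assume ij: "i \<in> {1..n}" "j \<in> {1..n}" "i \<noteq> j"
      have "h ` path_image (\<gamma> i) \<inter> h ` path_image (\<gamma> j) = h ` (path_image (\<gamma> i) \<inter> path_image (\<gamma> j))"
        using inj_on_image_Int[OF inj sub[OF ij(1)] sub[OF ij(2)]] by simp
      then show "h ` path_image (\<gamma> i) \<inter> h ` path_image (\<gamma> j) = {}" using D(2)[OF ij] by simp
    qed
    fix i assume i: "i \<in> {1..n}"
    show "arc (h \<circ> \<gamma> i)"
      unfolding arc_def
    proof
      show "path (h \<circ> \<gamma> i)" using D(3)[OF i] continuous_on_subset[OF cont sub[OF i]]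
        by (intro path_continuous_image) (simp_all add: arc_imp_path)
      show "inj_on (h \<circ> \<gamma> i) {0..1}"
        using D(3)[OF i] inj_on_subset[OF inj sub[OF i]] by (intro comp_inj_on) (simp_all add: arc_def path_image_def)
    qed
    show "pl_on {0..1} (h \<circ> \<gamma> i)"
      unfolding comp_def using sub[OF i] by (intro pl_on_compose[OF D(4)[OF i] rel_homeo_pl[OF h]]) (auto simp: path_image_def)
    show "(h \<circ> \<gamma> i) 0 = (0, base n i)" using D(5)[OF i] rel_homeo_frontier[OF h fr(1)[OF i]] by simp
    show "(h \<circ> \<gamma> i) 1 = (1, base n (\<sigma> i))" using D(6)[OF i] rel_homeo_frontier[OF h fr(2)[OF D(8)[OF i]]] by simp
    show "(h \<circ> \<gamma> i) s \<in> interior tangle_ball" if "0 < s \<and> s < 1" for s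
      using rel_homeo_interior[OF h D(7)[OF i]] that by simp
  qed (rule D(1))
  moreover have "h ` T = strand_union n (\<lambda>i. h \<circ> \<gamma> i)"
    unfolding g(2) strand_union_def path_image_compose by blast
  ultimately show ?thesis using string_linkI by simp
qed

lemma rel_homeo_equivalence:
  "rel_homeo h k \<Longrightarrow> T \<in> string_links n \<Longrightarrow> (T, h ` T) \<in> string_link_equivalence n"
  using rel_homeo_string_link string_link_equivalence_iff by blast

lemma equiv_string_link_equivalence: "equiv (string_links n) (string_link_equivalence n)"
proof (rule equivI)
  show "string_link_equivalence n \<subseteq> string_links n \<times> string_links n"
    by (auto simp: string_link_equivalence_iff)
  show "refl_on (string_links n) (string_link_equivalence n)"
    using rel_homeo_equivalence[OF rel_homeo_ident] by (auto intro: refl_onI)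
  show "sym (string_link_equivalence n)"
  proof (rule symI)
    fix T T' assume "(T, T') \<in> string_link_equivalence n"
    then obtain h k where T: "T \<in> string_links n" "T' \<in> string_links n" and hk: "rel_homeo h k" "h ` T = T'"
      unfolding string_link_equivalence_iff by blast
    have "k (h p) = p" if "p \<in> T" for p using rel_homeo_inv[OF hk(1)] string_link_subset(1)[OF T(1) that] .
    then have "k ` T' = T" unfolding hk(2)[symmetric] image_image by simp
    then show "(T', T) \<in> string_link_equivalence n"
      using T rel_homeo_sym[OF hk(1)] unfolding string_link_equivalence_iff by blast
  qed
  show "trans (string_link_equivalence n)"
  proof (rule transI)
    fix T T' T'' assume "(T, T') \<in> string_link_equivalence n" "(T', T'') \<in> string_link_equivalence n"
    then obtain h k h' k' where "T \<in> string_links n" "T'' \<in> string_links n"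
      "rel_homeo h k" "h ` T = T'" "rel_homeo h' k'" "h' ` T' = T''"
      unfolding string_link_equivalence_iff by blast
    moreover from this have "(\<lambda>p. h' (h p)) ` T = T''" by (simp flip: image_image)
    ultimately show "(T, T'') \<in> string_link_equivalence n"
      using rel_homeo_compose unfolding string_link_equivalence_iff by blast
  qed
qed

lemma braids_subset_string_links: "braids n \<subseteq> string_links n"
  unfolding braids_def string_links_def braid_strands_def by blast

section \<open>The string link monoid\<close>

lemma stack_halves:
  "stack A B = (\<lambda>p. (fst p / 2, snd p)) ` A \<union> (\<lambda>p. ((fst p + 1) / 2, snd p)) ` B"
  by (simp add: stack_def case_prod_unfold)

lemma pl_on_halve: "pl_on S f \<Longrightarrow> pl_on S (\<lambda>x. (fst (f x) / 2 :: real, snd (f x)))"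
  using pl_on_Pair[OF pl_on_mult[OF pl_on_fst, of S f "1/2"] pl_on_snd, of f] by simp

lemma pl_on_halve': "pl_on S f \<Longrightarrow> pl_on S (\<lambda>x. ((fst (f x) + 1) / 2 :: real, snd (f x)))"
  using pl_on_Pair[OF pl_on_mult[OF pl_on_add[OF pl_on_fst pl_on_const], of S f f "1/2" 1] pl_on_snd, of f] by simp

text \<open>
  Strand \<open>i\<close> of the product follows strand \<open>i\<close> of the first factor and strand \<open>\<sigma> i\<close> of the second. The
  two halves of a product meet only in the points \<open>(1/2, base n j)\<close>.
\<close>

lemma stack_string_links:
  assumes A: "A \<in> string_links n" and B: "B \<in> string_links n"
  shows "stack A B \<in> string_links n"
proof -
  obtain \<sigma> \<gamma> where g: "oriented_strands n \<sigma> \<gamma>" "A = strand_union n \<gamma>" using A by (rule string_linkE)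
  obtain \<tau> \<delta> where d: "oriented_strands n \<tau> \<delta>" "B = strand_union n \<delta>" using B by (rule string_linkE)
  note G = oriented_strandsD[OF g(1)] and D = oriented_strandsD[OF d(1)]
  let ?L = "\<lambda>p::point. (fst p / 2, snd p)" and ?R = "\<lambda>p::point. ((fst p + 1) / 2, snd p)"
  let ?l = "\<lambda>i s. ?L (\<gamma> i s)" and ?r = "\<lambda>i s. ?R (\<delta> (\<sigma> i) s)"
  have imL: "path_image (?l i) = ?L ` path_image (\<gamma> i)" for i unfolding path_image_def image_image ..
  have imR: "path_image (?r i) = ?R ` path_image (\<delta> (\<sigma> i))" for i unfolding path_image_def image_image ..
  have mid: "?l i 1 = ?r i 0" if "i \<in> {1..n}" for i using G(6)[OF that] D(5)[OF G(8)[OF that]] by simp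
  have cross: "p = (1/2, base n (\<sigma> i)) \<and> p = (1/2, base n (\<sigma> j))"
    if i: "i \<in> {1..n}" and j: "j \<in> {1..n}" and p: "p \<in> path_image (?l i)" "p \<in> path_image (?r j)" for i j p
  proof -
    obtain a where a: "a \<in> path_image (\<gamma> i)" "p = ?L a" using p(1) unfolding imL by blast
    obtain b where b: "b \<in> path_image (\<delta> (\<sigma> j))" "p = ?R b" using p(2) unfolding imR by blast
    have "fst a \<le> 1" "0 \<le> fst b"
      using oriented_strands_square(2)[OF g(1) i a(1)]
        oriented_strands_square(2)[OF d(1) G(8)[OF j] b(1)] by auto
    moreover have "fst a / 2 = (fst b + 1) / 2" using a(2) b(2) by simp
    ultimately have "fst a = 1" "fst b = 0" by auto
    then have "a = (1, base n (\<sigma> i))" "b = (0, base n (\<sigma> j))"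
      using oriented_strands_right[OF g(1) i a(1)] oriented_strands_left[OF d(1) G(8)[OF j] b(1)] by auto
    then show ?thesis using a(2) b(2) by simp
  qed
  have im: "path_image (?l i +++ ?r i) = path_image (?l i) \<union> path_image (?r i)" if "i \<in> {1..n}" for i
    using mid[OF that] by (intro path_image_join) (simp add: pathstart_def pathfinish_def)
  have "oriented_strands n (\<tau> \<circ> \<sigma>) (\<lambda>i. ?l i +++ ?r i)"
    unfolding oriented_strands_def
  proof (intro conjI ballI allI impI)
    show "(\<tau> \<circ> \<sigma>) permutes {1..n}" by (rule permutes_compose[OF G(1) D(1)])
    show "disjoint_family_on (\<lambda>i. path_image (?l i +++ ?r i)) {1..n}"
      unfolding disjoint_family_on_def
    proof (intro ballI impI)
      fix i j assume ij: "i \<in> {1..n}" "j \<in> {1..n}" "i \<noteq> j"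
      then have s: "\<sigma> i \<noteq> \<sigma> j" using permutes_inj[OF G(1)] by (simp add: inj_eq)
      have b: "base n (\<sigma> i) \<noteq> base n (\<sigma> j)" using base_inj[OF G(8)[OF ij(1)] G(8)[OF ij(2)]] s by blast
      have inj: "inj ?L" "inj ?R" by (auto simp: inj_def prod_eq_iff)
      have "path_image (?l i) \<inter> path_image (?l j) = {}" "path_image (?r i) \<inter> path_image (?r j) = {}"
        unfolding imL imR image_Int[OF inj(1), symmetric] image_Int[OF inj(2), symmetric]
        using G(2)[OF ij] D(2)[OF G(8)[OF ij(1)] G(8)[OF ij(2)] s] by simp_all
      moreover have "path_image (?l i) \<inter> path_image (?r j) = {}" "path_image (?l j) \<inter> path_image (?r i) = {}"
      proof -
        have "p \<notin> path_image (?l i) \<or> p \<notin> path_image (?r j)" for p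
          using cross[OF ij(1,2), of p] b by auto
        then show "path_image (?l i) \<inter> path_image (?r j) = {}" by blast
        have "p \<notin> path_image (?l j) \<or> p \<notin> path_image (?r i)" for p
          using cross[OF ij(2,1), of p] b by auto
        then show "path_image (?l j) \<inter> path_image (?r i) = {}" by blast
      qed
      ultimately show "path_image (?l i +++ ?r i) \<inter> path_image (?l j +++ ?r j) = {}"
        unfolding im[OF ij(1)] im[OF ij(2)] by blast
    qed
    fix i assume i: "i \<in> {1..n}"
    have pl: "pl_on {0..1} (?l i)" "pl_on {0..1} (?r i)"
      by (rule pl_on_halve[OF G(4)[OF i]], rule pl_on_halve'[OF D(4)[OF G(8)[OF i]]])
    show "arc (?l i +++ ?r i)"
    proof (rule arc_join)
      have inj: "inj_on (\<gamma> i) {0..1}" "inj_on (\<delta> (\<sigma> i)) {0..1}"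
        using G(3)[OF i] D(3)[OF G(8)[OF i]] by (simp_all add: arc_def)
      have "inj_on (?l i) {0..1}"
      proof (rule inj_onI)
        fix a b :: real assume ab: "a \<in> {0..1}" "b \<in> {0..1}" "?l i a = ?l i b"
        then have "\<gamma> i a = \<gamma> i b" by (simp add: prod_eq_iff)
        then show "a = b" using inj_onD[OF inj(1)] ab by blast
      qed
      then show "arc (?l i)" using pl_on_imp_continuous_on[OF pl(1)] unfolding arc_def path_def by (rule conjI[rotated])
      have "inj_on (?r i) {0..1}"
      proof (rule inj_onI)
        fix a b :: real assume ab: "a \<in> {0..1}" "b \<in> {0..1}" "?r i a = ?r i b"
        then have "\<delta> (\<sigma> i) a = \<delta> (\<sigma> i) b" by (simp add: prod_eq_iff)
        then show "a = b" using inj_onD[OF inj(2)] ab by blast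
      qed
      then show "arc (?r i)" using pl_on_imp_continuous_on[OF pl(2)] unfolding arc_def path_def by (rule conjI[rotated])
      show "pathfinish (?l i) = pathstart (?r i)" using mid[OF i] by (simp add: pathstart_def pathfinish_def)
      show "path_image (?l i) \<inter> path_image (?r i) \<subseteq> {pathstart (?r i)}"
      proof
        fix p assume "p \<in> path_image (?l i) \<inter> path_image (?r i)"
        then have "p = (1/2, base n (\<sigma> i))" using cross[OF i i] by blast
        then show "p \<in> {pathstart (?r i)}" using D(5)[OF G(8)[OF i]] by (simp add: pathstart_def)
      qed
    qed
    show "pl_on {0..1} (?l i +++ ?r i)" by (rule pl_on_join[OF pl mid[OF i]])
    show "(?l i +++ ?r i) 0 = (0, base n i)" using G(5)[OF i] by simp
    show "(?l i +++ ?r i) 1 = (1, base n ((\<tau> \<circ> \<sigma>) i))" using D(6)[OF G(8)[OF i]] by simp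
    show "(?l i +++ ?r i) s \<in> interior tangle_ball" if s: "0 < s \<and> s < 1" for s
    proof -
      consider "s < 1/2" | "s = 1/2" | "1/2 < s" by linarith
      then show ?thesis
      proof cases
        case 1
        then have "\<gamma> i (2 * s) \<in> interior tangle_ball" using s by (intro G(7)[OF i]) auto
        then show ?thesis using 1 by (simp add: joinpaths_def mem_interior_tangle_ball)
      next
        case 2
        have "(?l i +++ ?r i) s = (1/2, base n (\<sigma> i))" unfolding 2 using G(6)[OF i] by (simp add: joinpaths_def)
        then show ?thesis using base_in_square[OF G(8)[OF i]] by (simp add: mem_interior_tangle_ball)
      next
        case 3
        then have "\<delta> (\<sigma> i) (2 * s - 1) \<in> interior tangle_ball" using s by (intro D(7)[OF G(8)[OF i]]) auto
        then show ?thesis using 3 by (simp add: joinpaths_def mem_interior_tangle_ball)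
      qed
    qed
  qed
  moreover have "stack A B = strand_union n (\<lambda>i. ?l i +++ ?r i)"
  proof -
    have "strand_union n (\<lambda>i. ?l i +++ ?r i) = (\<Union>i\<in>{1..n}. ?L ` path_image (\<gamma> i) \<union> ?R ` path_image (\<delta> (\<sigma> i)))"
      unfolding strand_union_def using im imL imR by simp
    also have "\<dots> = ?L ` (\<Union>i\<in>{1..n}. path_image (\<gamma> i)) \<union> ?R ` (\<Union>i\<in>\<sigma> ` {1..n}. path_image (\<delta> i))"
      by blast
    finally show ?thesis
      unfolding permutes_image[OF G(1)] g(2) d(2) stack_halves strand_union_def by simp
  qed
  ultimately show ?thesis using string_linkI by simp
qed

text \<open>
  Homeomorphisms of the two halves of the ball fit together, as both are the identity on the common face
  \<open>x = 1/2\<close>.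
\<close>

lemma rel_homeo_stack:
  assumes h: "rel_homeo h h'" and k: "rel_homeo k k'"
  shows "\<exists>H H'. rel_homeo H H' \<and> (\<forall>A B. A \<subseteq> tangle_ball \<longrightarrow> B \<subseteq> tangle_ball \<longrightarrow>
    H ` stack A B = stack (h ` A) (k ` B))"
proof -
  let ?L = "\<lambda>p::point. (fst p / 2, snd p)" and ?R = "\<lambda>p::point. ((fst p + 1) / 2, snd p)"
  let ?L' = "\<lambda>p::point. (2 * fst p, snd p)" and ?R' = "\<lambda>p::point. (2 * fst p - 1, snd p)"
  let ?BL = "{0..1/2} \<times> {0..1} \<times> {0..1} :: point set" and ?BR = "{1/2..1} \<times> {0..1} \<times> {0..1} :: point set"
  define H where "H = (\<lambda>p. if fst p \<le> 1/2 then ?L (h (?L' p)) else ?R (k (?R' p)))"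
  have BL: "?L' p \<in> tangle_ball" if "p \<in> ?BL" for p using that by (auto simp: tangle_ball_def mem_Times_iff)
  have BR: "?R' p \<in> tangle_ball" if "p \<in> ?BR" for p using that by (auto simp: tangle_ball_def mem_Times_iff)
  have fr01: "p \<in> frontier tangle_ball" if "p \<in> tangle_ball" "fst p = 0 \<or> fst p = 1" for p
    using that mem_frontier_tangle_ball[of "fst p" "snd p"] by auto
  have HL: "H p = ?L (h (?L' p))" if "p \<in> ?BL" for p using that by (auto simp: H_def)
  have HR: "H p = ?R (k (?R' p))" if p: "p \<in> ?BR" for p
  proof (cases "fst p \<le> 1/2")
    case True
    then have f: "fst p = 1/2" using p by (auto simp: mem_Times_iff)
    then have "p \<in> ?BL" using p by (auto simp: mem_Times_iff)
    then have "h (?L' p) = ?L' p" "k (?R' p) = ?R' p"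
      using f rel_homeo_frontier[OF h fr01[OF BL]] rel_homeo_frontier[OF k fr01[OF BR[OF p]]] by simp_all
    then show ?thesis unfolding HL[OF \<open>p \<in> ?BL\<close>] using f by (simp only:) simp
  qed (simp add: H_def)
  have split: "tangle_ball = ?BL \<union> ?BR" by (auto simp: tangle_ball_def)
  have polL: "polytope ?BL" and polR: "polytope ?BR" by (intro polytope_Times polytope_interval_real)+
  have id: "pl_on ?BL (\<lambda>p. p)" "pl_on ?BR (\<lambda>p. p)"
    by (intro pl_on_ident polL polR)+
  have plL: "pl_on ?BL ?L'" using pl_on_Pair[OF pl_on_mult[OF pl_on_fst] pl_on_snd, OF id(1) id(1)] .
  have plR: "pl_on ?BR ?R'"
    using pl_on_Pair[OF pl_on_diff[OF pl_on_mult[OF pl_on_fst] pl_on_const] pl_on_snd, OF id(2) id(2) id(2)] .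
  have hin: "h (?L' p) \<in> tangle_ball" if "p \<in> ?BL" for p by (rule rel_homeo_mem[OF h BL[OF that]])
  have kin: "k (?R' p) \<in> tangle_ball" if "p \<in> ?BR" for p by (rule rel_homeo_mem[OF k BR[OF that]])
  have injL: "p = p'" if "p \<in> ?BL" "p' \<in> ?BL" "H p = H p'" for p p'
  proof -
    have "h (?L' p) = h (?L' p')" using that(3) unfolding HL[OF that(1)] HL[OF that(2)] by (simp add: prod_eq_iff)
    then have "?L' p = ?L' p'" using inj_onD[OF rel_homeo_inj_on[OF h] _ BL[OF that(1)] BL[OF that(2)]] by blast
    then show ?thesis by (simp add: prod_eq_iff)
  qed
  have injR: "p = p'" if "p \<in> ?BR" "p' \<in> ?BR" "H p = H p'" for p p'
  proof -
    have "k (?R' p) = k (?R' p')" using that(3) unfolding HR[OF that(1)] HR[OF that(2)] by (simp add: prod_eq_iff)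
    then have "?R' p = ?R' p'" using inj_onD[OF rel_homeo_inj_on[OF k] _ BR[OF that(1)] BR[OF that(2)]] by blast
    then show ?thesis by (simp add: prod_eq_iff)
  qed
  have injLR: "p' \<in> ?BL" if p: "p \<in> ?BL" "p' \<in> ?BR" "H p = H p'" for p p'
  proof -
    let ?a = "h (?L' p)" and ?b = "k (?R' p')"
    have ab: "?a \<in> tangle_ball" "?b \<in> tangle_ball" using hin[OF p(1)] kin[OF p(2)] .
    have "fst ?a / 2 = (fst ?b + 1) / 2" using p(3) unfolding HL[OF p(1)] HR[OF p(2)] by (simp add: prod_eq_iff)
    then have b0: "fst ?b = 0" using ab by (auto simp: tangle_ball_def mem_Times_iff)
    have "k ?b = ?b" using rel_homeo_frontier[OF k fr01[OF ab(2)]] b0 by blast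
    then have "?b = ?R' p'" using inj_onD[OF rel_homeo_inj_on[OF k] _ ab(2) BR[OF p(2)]] by blast
    then have "fst p' = 1/2" using b0 by simp
    then show ?thesis using p(2) by (auto simp: mem_Times_iff)
  qed
  have "rel_homeo H (inv_into tangle_ball H)"
  proof (rule rel_homeoI)
    have "pl_on ?BL (\<lambda>p. ?L (h (?L' p)))"
      by (rule pl_on_halve[OF pl_on_compose[OF plL rel_homeo_pl[OF h] BL]])
    then have 1: "pl_on ?BL H" by (rule pl_on_cong) (simp only: HL)
    have "pl_on ?BR (\<lambda>p. ?R (k (?R' p)))"
      by (rule pl_on_halve'[OF pl_on_compose[OF plR rel_homeo_pl[OF k] BR]])
    then have 2: "pl_on ?BR H" by (rule pl_on_cong) (simp only: HR)
    show "pl_on tangle_ball H" unfolding split by (rule pl_on_Un[OF 1 2])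
    show "H ` tangle_ball \<subseteq> tangle_ball"
    proof (rule image_subsetI)
      fix p assume "p \<in> tangle_ball"
      then consider "p \<in> ?BL" | "p \<in> ?BR" unfolding split by blast
      then show "H p \<in> tangle_ball"
      proof cases
        case 1
        then show ?thesis using hin[OF 1] unfolding HL[OF 1] by (auto simp: tangle_ball_def mem_Times_iff)
      next
        case 2
        then show ?thesis using kin[OF 2] unfolding HR[OF 2] by (auto simp: tangle_ball_def mem_Times_iff)
      qed
    qed
    show "inj_on H tangle_ball"
    proof (rule inj_onI)
      fix p p' assume "p \<in> tangle_ball" "p' \<in> tangle_ball" "H p = H p'"
      then show "p = p'" using injL[of p p'] injR[of p p'] injLR[of p p'] injLR[of p' p] unfolding split
        by (metis UnE)
    qed
    fix p assume p: "p \<in> frontier tangle_ball"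
    have pf: "fst p = 0 \<or> fst p = 1 \<or> snd p \<notin> open_square"
      using p mem_frontier_tangle_ball[of "fst p" "snd p"] by simp
    have "p \<in> tangle_ball" using p frontier_tangle_ball_subset by blast
    then consider "p \<in> ?BL" | "p \<in> ?BR" unfolding split by blast
    then show "H p = p"
    proof cases
      case 1
      then have "?L' p \<in> frontier tangle_ball"
        using pf BL[OF 1] mem_frontier_tangle_ball[of "2 * fst p" "snd p"] by (auto simp: mem_Times_iff)
      from rel_homeo_frontier[OF h this] show ?thesis unfolding HL[OF 1] by simp
    next
      case 2
      then have "?R' p \<in> frontier tangle_ball"
        using pf BR[OF 2] mem_frontier_tangle_ball[of "2 * fst p - 1" "snd p"] by (auto simp: mem_Times_iff)
      from rel_homeo_frontier[OF k this] show ?thesis unfolding HR[OF 2] by simp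
    qed
  qed
  moreover have "H ` stack A B = stack (h ` A) (k ` B)" if "A \<subseteq> tangle_ball" "B \<subseteq> tangle_ball" for A B
  proof -
    have "H (?L p) = ?L (h p)" if "p \<in> tangle_ball" for p
    proof -
      have "?L p \<in> ?BL" using that by (auto simp: tangle_ball_def mem_Times_iff)
      moreover have "?L' (?L p) = p" by (simp add: prod_eq_iff)
      ultimately show ?thesis using HL[of "?L p"] by (simp only:)
    qed
    then have 1: "H ` ?L ` A = ?L ` h ` A" unfolding image_image using \<open>A \<subseteq> tangle_ball\<close> by (intro image_cong) auto
    have "H (?R p) = ?R (k p)" if "p \<in> tangle_ball" for p
    proof -
      have "?R p \<in> ?BR" using that by (auto simp: tangle_ball_def mem_Times_iff)
      moreover have "?R' (?R p) = p" by (simp add: prod_eq_iff field_simps)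
      ultimately show ?thesis using HR[of "?R p"] by (simp only:)
    qed
    then have 2: "H ` ?R ` B = ?R ` k ` B" unfolding image_image using \<open>B \<subseteq> tangle_ball\<close> by (intro image_cong) auto
    show ?thesis unfolding stack_halves image_Un 1 2 ..
  qed
  ultimately show ?thesis by blast
qed

lemma stack_equivalence:
  assumes "(A, A') \<in> string_link_equivalence n" "(B, B') \<in> string_link_equivalence n"
  shows "(stack A B, stack A' B') \<in> string_link_equivalence n"
proof -
  obtain h h' where h: "A \<in> string_links n" "rel_homeo h h'" "h ` A = A'"
    using assms(1) unfolding string_link_equivalence_iff by blast
  obtain k k' where k: "B \<in> string_links n" "rel_homeo k k'" "k ` B = B'"
    using assms(2) unfolding string_link_equivalence_iff by blast
  obtain H H' where H: "rel_homeo H H'"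
    "\<And>A B. A \<subseteq> tangle_ball \<Longrightarrow> B \<subseteq> tangle_ball \<Longrightarrow> H ` stack A B = stack (h ` A) (k ` B)"
    using rel_homeo_stack[OF h(2) k(2)] by blast
  have "A \<subseteq> tangle_ball" "B \<subseteq> tangle_ball"
    using string_link_subset(1)[OF h(1)] string_link_subset(1)[OF k(1)] by auto
  then have "H ` stack A B = stack A' B'" using H(2) h(3) k(3) by simp
  then show ?thesis using rel_homeo_equivalence[OF H(1) stack_string_links[OF h(1) k(1)]] by simp
qed

text \<open>Distance of a point of the square from its sides.\<close>

definition depth :: "real \<times> real \<Rightarrow> real" where
  "depth q = min (min (fst q) (1 - fst q)) (min (snd q) (1 - snd q))"

lemma depth_pos: "0 < depth q \<longleftrightarrow> q \<in> open_square"
  by (cases q) (auto simp: depth_def open_square_def)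

lemma depth_nonneg: "0 \<le> depth q \<longleftrightarrow> q \<in> {0..1} \<times> {0..1}"
  by (cases q) (auto simp: depth_def)

lemma string_link_depth:
  assumes "T \<in> string_links n"
  shows "\<exists>d>0. \<forall>p\<in>T. d \<le> depth (snd p)"
proof -
  have "\<forall>\<^sub>F d in at_right 0. \<forall>p\<in>T. d \<le> depth (snd p)"
  proof (rule eventually_le_pos_continuous[OF compact_string_link[OF assms]])
    show "continuous_on T (\<lambda>p. depth (snd p))" unfolding depth_def by (intro continuous_intros)
    show "0 < depth (snd p)" if "p \<in> T" for p using string_link_subset(2)[OF assms that] depth_pos by blast
  qed
  then have "\<forall>\<^sub>F d in at_right 0. 0 < d \<and> (\<forall>p\<in>T. d \<le> depth (snd p))"
    using eventually_at_right_less[of "0::real"] by eventually_elim blast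
  then show ?thesis using eventually_happens'[OF trivial_limit_at_right_real] by blast
qed

text \<open>
  A monotone reparametrization \<open>\<phi> \<ge> id\<close> of the coordinate \<open>x\<close> is realised away from the side
  faces, and is damped to the identity towards them.
\<close>

lemma reparametrize_level:
  assumes pl: "pl_on {0..1} \<phi>" and mono: "strict_mono_on {0..1} \<phi>" and ends: "\<phi> 0 = 0" "\<phi> 1 = 1"
    and ge: "\<And>x. x \<in> {0..1} \<Longrightarrow> x \<le> \<phi> x" and "d > 0"
  shows "\<exists>h k. rel_homeo h k \<and> (\<forall>x\<in>{0..1}. \<forall>q. d \<le> depth q \<longrightarrow> h (x, q) = (\<phi> x, q))"
proof -
  define h where "h = (\<lambda>p::point. (min (\<phi> (fst p)) (fst p + (1 / d) * depth (snd p)), snd p))"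
  have le1: "\<phi> x \<le> 1" if "x \<in> {0..1}" for x
  proof (cases "x = 1")
    case False
    then have "\<phi> x < \<phi> 1" using that by (intro strict_mono_onD[OF mono]) auto
    then show ?thesis using ends by simp
  qed (simp add: ends)
  have id: "pl_on tangle_ball (\<lambda>p. p)" by (rule pl_on_ident[OF polytope_tangle_ball])
  have "rel_homeo h (inv_into tangle_ball h)"
  proof (rule rel_homeoI)
    have "pl_on tangle_ball (\<lambda>p. \<phi> (fst p))"
      by (rule pl_on_compose[OF pl_on_fst[OF id] pl]) (simp add: tangle_ball_def mem_Times_iff)
    then show "pl_on tangle_ball h"
      unfolding h_def depth_def
      by (intro pl_on_Pair pl_on_min pl_on_add pl_on_mult pl_on_fst pl_on_snd pl_on_diff pl_on_const[OF id] id)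
    show "h ` tangle_ball \<subseteq> tangle_ball"
    proof (rule image_subsetI)
      fix p assume p: "p \<in> tangle_ball"
      then have x: "fst p \<in> {0..1}" and q: "0 \<le> depth (snd p)"
        by (auto simp: tangle_ball_def mem_Times_iff depth_nonneg)
      have "0 \<le> (1 / d) * depth (snd p)" using q \<open>d > 0\<close> by simp
      then have "min (\<phi> (fst p)) (fst p + (1 / d) * depth (snd p)) \<in> {0..1}"
        using ge[OF x] le1[OF x] x by (auto simp: min_def)
      then show "h p \<in> tangle_ball" using p by (simp add: h_def tangle_ball_def mem_Times_iff)
    qed
    show "inj_on h tangle_ball"
    proof (rule inj_onI)
      fix p p' assume pp: "p \<in> tangle_ball" "p' \<in> tangle_ball" "h p = h p'"
      then have x: "fst p \<in> {0..1}" "fst p' \<in> {0..1}" by (auto simp: tangle_ball_def mem_Times_iff)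
      have s: "snd p = snd p'" using pp(3) by (simp add: h_def)
      have e: "min (\<phi> (fst p)) (fst p + (1 / d) * depth (snd p)) = min (\<phi> (fst p')) (fst p' + (1 / d) * depth (snd p))"
        using pp(3) s by (simp add: h_def)
      have "fst p = fst p'"
        using strict_mono_onD[OF mono x(1) x(2)] strict_mono_onD[OF mono x(2) x(1)] e
        by (cases "fst p" "fst p'" rule: linorder_cases) (auto simp: min_def split: if_splits)
      then show "p = p'" using s by (rule prod_eqI)
    qed
    fix p assume p: "p \<in> frontier tangle_ball"
    then have pB: "fst p \<in> {0..1}" "0 \<le> depth (snd p)"
      using frontier_tangle_ball_subset by (auto simp: tangle_ball_def mem_Times_iff depth_nonneg)
    have "0 \<le> (1 / d) * depth (snd p)" using pB \<open>d > 0\<close> by simp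
    have "fst p = 0 \<or> fst p = 1 \<or> snd p \<notin> open_square"
      using p mem_frontier_tangle_ball[of "fst p" "snd p"] by simp
    then consider "fst p = 0" | "fst p = 1" | "depth (snd p) = 0" using depth_pos[of "snd p"] pB(2) by force
    then show "h p = p"
      by cases (use ends ge[OF pB(1)] \<open>0 \<le> (1 / d) * depth (snd p)\<close> in \<open>auto simp: h_def prod_eq_iff\<close>)
  qed
  moreover have "h (x, q) = (\<phi> x, q)" if "x \<in> {0..1}" "d \<le> depth q" for x q
  proof -
    have "1 \<le> (1 / d) * depth q" using that(2) \<open>d > 0\<close> by (simp add: field_simps)
    then show ?thesis using le1[OF that(1)] that(1) by (simp add: h_def)
  qed
  ultimately show ?thesis by blast
qed

lemma stack_assoc_equivalence:
  assumes "A \<in> string_links n" "B \<in> string_links n" "C \<in> string_links n"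
  shows "(stack (stack A B) C, stack A (stack B C)) \<in> string_link_equivalence n"
proof -
  let ?T = "stack (stack A B) C"
  have T: "?T \<in> string_links n" by (intro stack_string_links assms)
  obtain d where d: "d > 0" "\<And>p. p \<in> ?T \<Longrightarrow> d \<le> depth (snd p)" using string_link_depth[OF T] by blast
  \<comment> \<open>\<open>\<phi>\<close> is affine on \<open>[0, 1/4]\<close>, \<open>[1/4, 1/2]\<close> and \<open>[1/2, 1]\<close>, and maps these intervals onto
    \<open>[0, 1/2]\<close>, \<open>[1/2, 3/4]\<close> and \<open>[3/4, 1]\<close>.\<close>
  define \<phi> :: "real \<Rightarrow> real" where "\<phi> = (\<lambda>x. min (2 * x) (min (x + 1/4) ((1/2) * (x + 1))))"
  have id: "pl_on {0..1} (\<lambda>x::real. x)" by (rule pl_on_ident[OF polytope_interval_real])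
  have "\<exists>h k. rel_homeo h k \<and> (\<forall>x\<in>{0..1}. \<forall>q. d \<le> depth q \<longrightarrow> h (x, q) = (\<phi> x, q))"
  proof (rule reparametrize_level[OF _ _ _ _ _ d(1)])
    show "pl_on {0..1} \<phi>" unfolding \<phi>_def by (intro pl_on_min pl_on_add pl_on_mult pl_on_const[OF id] id)
    show "strict_mono_on {0..1} \<phi>" by (auto simp: strict_mono_on_def \<phi>_def min_def)
  qed (auto simp: \<phi>_def)
  then obtain h k where hk: "rel_homeo h k"
    "\<And>x q. x \<in> {0..1} \<Longrightarrow> d \<le> depth q \<Longrightarrow> h (x, q) = (\<phi> x, q)" by blast
  let ?L = "\<lambda>p::point. (fst p / 2, snd p)" and ?R = "\<lambda>p::point. ((fst p + 1) / 2, snd p)"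
  have x01: "fst p \<in> {0..1}" if "p \<in> A \<union> B \<union> C" for p
  proof -
    have "p \<in> tangle_ball"
      using that string_link_subset(1)[OF assms(1)] string_link_subset(1)[OF assms(2)] string_link_subset(1)[OF assms(3)]
      by blast
    then show ?thesis by (simp add: tangle_ball_def mem_Times_iff)
  qed
  have eq: "?T = ?L ` ?L ` A \<union> ?L ` ?R ` B \<union> ?R ` C" "stack A (stack B C) = ?L ` A \<union> ?R ` ?L ` B \<union> ?R ` ?R ` C"
    by (simp_all only: stack_halves image_Un Un_assoc)
  have A: "h (?L (?L p)) = ?L p" if p: "p \<in> A" for p
  proof -
    have "?L (?L p) \<in> ?T" unfolding eq using p by blast
    from d(2)[OF this] have "d \<le> depth (snd p)" by simp
    moreover have x: "fst p \<in> {0..1}" using x01 p by blast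
    ultimately have "h (fst p / 2 / 2, snd p) = (\<phi> (fst p / 2 / 2), snd p)" by (intro hk(2)) auto
    moreover have "\<phi> (fst p / 2 / 2) = fst p / 2"
      using x by (simp add: \<phi>_def min_def field_simps)
    ultimately show ?thesis by simp
  qed
  have B: "h (?L (?R p)) = ?R (?L p)" if p: "p \<in> B" for p
  proof -
    have "?L (?R p) \<in> ?T" unfolding eq using p by blast
    from d(2)[OF this] have "d \<le> depth (snd p)" by simp
    moreover have x: "fst p \<in> {0..1}" using x01 p by blast
    ultimately have "h ((fst p + 1) / 2 / 2, snd p) = (\<phi> ((fst p + 1) / 2 / 2), snd p)" by (intro hk(2)) auto
    moreover have "\<phi> ((fst p + 1) / 2 / 2) = (fst p / 2 + 1) / 2"
      using x by (simp add: \<phi>_def min_def field_simps)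
    ultimately show ?thesis by simp
  qed
  have C: "h (?R p) = ?R (?R p)" if p: "p \<in> C" for p
  proof -
    have "?R p \<in> ?T" unfolding eq using p by blast
    from d(2)[OF this] have "d \<le> depth (snd p)" by simp
    moreover have x: "fst p \<in> {0..1}" using x01 p by blast
    ultimately have "h ((fst p + 1) / 2, snd p) = (\<phi> ((fst p + 1) / 2), snd p)" by (intro hk(2)) auto
    moreover have "\<phi> ((fst p + 1) / 2) = ((fst p + 1) / 2 + 1) / 2"
      using x by (simp add: \<phi>_def min_def field_simps)
    ultimately show ?thesis by simp
  qed
  have "h ` ?T = stack A (stack B C)"
    unfolding eq image_Un image_image using A B C by (simp cong: image_cong)
  then show ?thesis using rel_homeo_equivalence[OF hk(1) T] by simp
qed

section \<open>The unit of the string link monoid\<close>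

text \<open>
  One of the finitely many affine pieces has \<open>1\<close> as an accumulation point; by convexity it
  contains an interval \<open>[s0, 1]\<close>.
\<close>

lemma pl_on_affine_end:
  fixes f :: "real \<Rightarrow> 'a::euclidean_space"
  assumes "pl_on {0..1} f"
  shows "\<exists>s0 v. 0 \<le> s0 \<and> s0 < 1 \<and> (\<forall>s\<in>{s0..1}. f s = f 1 + (s - 1) *\<^sub>R v)"
proof -
  from assms obtain \<C> where C: "finite \<C>" "\<And>C. C \<in> \<C> \<Longrightarrow> polytope C" "\<Union>\<C> = {0..1::real}"
    "\<And>C. C \<in> \<C> \<Longrightarrow> \<exists>A b. linear A \<and> (\<forall>x\<in>C. f x = A x + b)"
    by (rule pl_onE) (rule that; assumption)
  have "closure {0..<1::real} = {0..1}" by simp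
  moreover have "closure {0..<1::real} \<subseteq> (\<Union>C\<in>\<C>. closure (C \<inter> {0..<1}))"
  proof (rule closure_minimal)
    show "closed (\<Union>C\<in>\<C>. closure (C \<inter> {0..<1::real}))" using C(1) by (intro closed_UN) auto
    show "{0..<1} \<subseteq> (\<Union>C\<in>\<C>. closure (C \<inter> {0..<1::real}))"
    proof
      fix x :: real assume x: "x \<in> {0..<1}"
      then have "x \<in> \<Union>\<C>" unfolding C(3) by simp
      then obtain C1 where C1: "C1 \<in> \<C>" "x \<in> C1 \<inter> {0..<1}" using x by blast
      show "x \<in> (\<Union>C\<in>\<C>. closure (C \<inter> {0..<1}))"
        using C1(1) by (rule UN_I) (rule subsetD[OF closure_subset C1(2)])
    qed
  qed
  ultimately have "{0..1} \<subseteq> (\<Union>C\<in>\<C>. closure (C \<inter> {0..<1::real}))" by simp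
  then have "1 \<in> (\<Union>C\<in>\<C>. closure (C \<inter> {0..<1::real}))" by (rule subsetD) simp
  then obtain C0 where C0: "C0 \<in> \<C>" "1 \<in> closure (C0 \<inter> {0..<1::real})" by blast
  then have "C0 \<inter> {0..<1} \<noteq> {}" by auto
  then obtain s0 where s0: "s0 \<in> C0" "0 \<le> s0" "s0 < 1" by auto
  have "closure (C0 \<inter> {0..<1}) \<subseteq> closure C0" by (intro closure_mono) auto
  then have "1 \<in> C0" using C0 polytope_imp_closed[OF C(2)[OF C0(1)]] by auto
  then have sub: "{s0..1} \<subseteq> C0"
    using closed_segment_subset[OF s0(1) _ polytope_imp_convex[OF C(2)[OF C0(1)]], of 1] s0
    by (simp add: closed_segment_eq_real_ivl)
  obtain A b where A: "linear A" "\<And>x. x \<in> C0 \<Longrightarrow> f x = A x + b" using C(4)[OF C0(1)] by blast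
  have "f s = f 1 + (s - 1) *\<^sub>R A 1" if "s \<in> {s0..1}" for s
  proof -
    have "A s = s *\<^sub>R A 1" using linear_scale[OF A(1), of s 1] by simp
    moreover have "s \<in> C0" "1 \<in> C0" using sub that s0 by auto
    ultimately show ?thesis by (simp add: A(2) scaleR_diff_left)
  qed
  then show ?thesis using s0 by blast
qed

text \<open>Near its endpoint on the right face a strand is a straight segment, transverse to the levels.\<close>

lemma strand_right_end:
  assumes pl: "pl_on {0..1} \<gamma>" and e: "\<gamma> 1 = (1, b)"
    and lt: "\<And>s. 0 \<le> s \<Longrightarrow> s < 1 \<Longrightarrow> fst (\<gamma> s) < (1::real)"
  shows "\<exists>m::real \<times> real. \<exists>\<eta>>0. \<forall>x. 1 - \<eta> \<le> x \<longrightarrow>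
    (\<forall>q. (x, q) \<in> path_image \<gamma> \<longleftrightarrow> x \<le> 1 \<and> q = b + (1 - x) *\<^sub>R m)"
proof -
  obtain s0 v where s0: "0 \<le> s0" "s0 < 1" "\<And>s. s \<in> {s0..1} \<Longrightarrow> \<gamma> s = \<gamma> 1 + (s - 1) *\<^sub>R v"
    using pl_on_affine_end[OF pl] by blast
  have "fst (\<gamma> s0) = 1 + (s0 - 1) * fst v" using s0(3)[of s0] s0(1,2) e by simp
  then have "(1 - s0) * fst v > 0" using lt[OF s0(1,2)] by (simp add: algebra_simps)
  then have v: "fst v > 0" using s0(2) by (simp add: zero_less_mult_iff)
  have "continuous_on {0..s0} (\<lambda>s. fst (\<gamma> s))"
    using continuous_on_subset[OF pl_on_imp_continuous_on[OF pl]] s0 by (intro continuous_on_fst) auto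
  \<comment> \<open>The rest of the strand, up to the parameter \<open>s0\<close>, stays to the left of a level \<open>\<mu> < 1\<close>.\<close>
  then obtain s1 where s1: "s1 \<in> {0..s0}" "\<And>s. s \<in> {0..s0} \<Longrightarrow> fst (\<gamma> s) \<le> fst (\<gamma> s1)"
    using continuous_attains_sup[of "{0..s0}" "\<lambda>s. fst (\<gamma> s)"] s0 by auto
  define \<mu> where "\<mu> = fst (\<gamma> s1)"
  have \<mu>: "\<mu> < 1" using lt[of s1] s1 s0 by (simp add: \<mu>_def)
  have \<mu>0: "1 - (1 - s0) * fst v \<le> \<mu>"
    using s1(2)[of s0] s0(1) \<open>fst (\<gamma> s0) = 1 + (s0 - 1) * fst v\<close> by (simp add: \<mu>_def algebra_simps)
  define m where "m = (- 1 / fst v) *\<^sub>R snd v"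
  have pt: "\<gamma> s = (x, b + (1 - x) *\<^sub>R m)" if "s \<in> {s0..1}" "x = 1 + (s - 1) * fst v" for s x
    using s0(3)[OF that(1)] that(2) v e by (simp add: m_def prod_eq_iff, simp add: algebra_simps)
  have "(x, q) \<in> path_image \<gamma> \<longleftrightarrow> x \<le> 1 \<and> q = b + (1 - x) *\<^sub>R m" if x: "1 - (1 - \<mu>) / 2 \<le> x" for x q
  proof
    assume "(x, q) \<in> path_image \<gamma>"
    then obtain s where s: "s \<in> {0..1}" "\<gamma> s = (x, q)" by (auto simp: path_image_def)
    have "x > \<mu>" using x \<mu> by (simp add: field_simps)
    then have "s \<notin> {0..s0}" using s1(2)[of s] s(2) by (auto simp: \<mu>_def)
    then have s': "s \<in> {s0..1}" using s(1) by auto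
    have "x = 1 + (s - 1) * fst v" using s0(3)[OF s'] s(2) e by (simp add: prod_eq_iff)
    moreover have "(s - 1) * fst v \<le> 0" using s(1) v by (simp add: mult_nonpos_nonneg)
    ultimately show "x \<le> 1 \<and> q = b + (1 - x) *\<^sub>R m" using pt[OF s'] s(2) by auto
  next
    assume q: "x \<le> 1 \<and> q = b + (1 - x) *\<^sub>R m"
    define s where "s = 1 - (1 - x) / fst v"
    have "1 - x \<le> (1 - s0) * fst v" using x \<mu> \<mu>0 by (simp add: field_simps)
    then have "(1 - x) / fst v \<le> 1 - s0" using v by (simp add: pos_divide_le_eq)
    moreover have "0 \<le> (1 - x) / fst v" using q v by simp
    ultimately have s: "s \<in> {s0..1}" by (simp add: s_def)
    moreover have "x = 1 + (s - 1) * fst v" using v by (simp add: s_def)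
    ultimately have "\<gamma> s = (x, q)" using pt[of s x] q by simp
    moreover have "s \<in> {0..1}" using s s0(1) by auto
    ultimately show "(x, q) \<in> path_image \<gamma>" unfolding path_image_def by (metis imageI)
  qed
  then show ?thesis using \<mu> by (intro exI[of _ m] exI[of _ "(1 - \<mu>) / 2"]) auto
qed

lemma string_link_right_end:
  assumes "T \<in> string_links n"
  obtains \<sigma> m \<eta> where "\<sigma> permutes {1..n}" "\<eta> > 0"
    "\<And>x q. 1 - \<eta> \<le> x \<Longrightarrow> (x, q) \<in> T \<longleftrightarrow> x \<le> 1 \<and> (\<exists>j\<in>{1..n}. q = base n (\<sigma> j) + (1 - x) *\<^sub>R m j)"
proof -
  obtain \<sigma> \<gamma> where g: "oriented_strands n \<sigma> \<gamma>" "T = strand_union n \<gamma>" using assms by (rule string_linkE)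
  note D = oriented_strandsD[OF g(1)]
  have "\<exists>m::real \<times> real. \<exists>\<eta>>0. \<forall>x. 1 - \<eta> \<le> x \<longrightarrow>
    (\<forall>q. (x, q) \<in> path_image (\<gamma> j) \<longleftrightarrow> x \<le> 1 \<and> q = base n (\<sigma> j) + (1 - x) *\<^sub>R m)" if j: "j \<in> {1..n}" for j
  proof (rule strand_right_end[OF D(4,6)[OF j]])
    fix s :: real assume s: "0 \<le> s" "s < 1"
    then consider "s = 0" | "0 < s" by force
    then show "fst (\<gamma> j s) < 1"
      using D(5)[OF j] D(7)[OF j _ s(2)] by cases (auto simp: mem_interior_tangle_ball)
  qed
  then obtain m \<eta> where m: "\<And>j. j \<in> {1..n} \<Longrightarrow> (\<eta> j > (0::real)) \<and> (\<forall>x. 1 - \<eta> j \<le> x \<longrightarrow>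
    (\<forall>q. (x, q) \<in> path_image (\<gamma> j) \<longleftrightarrow> x \<le> 1 \<and> q = base n (\<sigma> j) + (1 - x) *\<^sub>R m j))"
    by metis
  define \<eta>0 where "\<eta>0 = Min (insert 1 (\<eta> ` {1..n}))"
  have \<eta>0: "\<eta>0 > 0" using m by (auto simp: \<eta>0_def)
  have le: "\<eta>0 \<le> \<eta> j" if "j \<in> {1..n}" for j unfolding \<eta>0_def using that by (intro Min_le) auto
  have "(x, q) \<in> T \<longleftrightarrow> x \<le> 1 \<and> (\<exists>j\<in>{1..n}. q = base n (\<sigma> j) + (1 - x) *\<^sub>R m j)" if x: "1 - \<eta>0 \<le> x" for x q
  proof -
    have "(x, q) \<in> path_image (\<gamma> j) \<longleftrightarrow> x \<le> 1 \<and> q = base n (\<sigma> j) + (1 - x) *\<^sub>R m j" if "j \<in> {1..n}" for j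
    proof -
      have "1 - \<eta> j \<le> x" using le[OF that] x by linarith
      then show ?thesis using m[OF that] by blast
    qed
    then show ?thesis unfolding g(2) strand_union_def by auto
  qed
  then show thesis using that D(1) \<eta>0 by blast
qed

text \<open>
  \<open>T\<close> consists of straight horizontal strands in the region \<open>x \<ge> 1 - \<eta>\<close>.
\<close>

definition straight_right :: "nat \<Rightarrow> real \<Rightarrow> point set \<Rightarrow> bool" where
  "straight_right n \<eta> T \<longleftrightarrow> (\<forall>x q. 1 - \<eta> \<le> x \<longrightarrow> ((x, q) \<in> T \<longleftrightarrow> x \<le> 1 \<and> q \<in> base n ` {1..n}))"

text \<open>
  Near the right face the strands are segments \<open>b j + (1 - x) m j\<close>. They are moved, as in
  \<open>move_strands\<close>, so as to be constant for \<open>x \<ge> 1 - \<eta> / 2\<close>.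
\<close>

lemma straighten_right:
  assumes T: "T \<in> string_links n"
  shows "\<exists>h k \<eta>. rel_homeo h k \<and> 0 < \<eta> \<and> \<eta> < 1 \<and> straight_right n \<eta> (h ` T)"
proof -
  obtain \<sigma> m \<eta>0 where s: "\<sigma> permutes {1..n}" and \<eta>0: "\<eta>0 > 0"
    and loc: "\<And>x q. 1 - \<eta>0 \<le> x \<Longrightarrow> (x, q) \<in> T \<longleftrightarrow> x \<le> 1 \<and> (\<exists>j\<in>{1..n}. q = base n (\<sigma> j) + (1 - x) *\<^sub>R m j)"
    using string_link_right_end[OF T] by metis
  define b where "b = base n \<circ> \<sigma>"
  have b: "b \<in> config {1..n}" unfolding b_def by (rule config_permute[OF s base_config])
  have bim: "b ` {1..n} = base n ` {1..n}"
    unfolding b_def image_comp[symmetric] permutes_image[OF s] ..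
  obtain E where E: "E > 0" "roomy {1..n} E b"
    using compact_roomy[of "{1..n}" "{0::real}" "\<lambda>_. b"] b by auto
  define M where "M = 1 + (\<Sum>j\<in>{1..n}. l1 (m j))"
  have M: "l1 (m j) \<le> M" if "j \<in> {1..n}" for j
    unfolding M_def using member_le_sum[of j "{1..n}" "\<lambda>j. l1 (m j)"] that by simp
  have "M > 0" unfolding M_def by (simp add: add_pos_nonneg sum_nonneg)
  define e where "e = E / 8"
  define \<eta> where "\<eta> = min (min \<eta>0 (e / M)) (1 / 2)"
  have e: "e > 0" using E(1) by (simp add: e_def)
  have \<eta>: "0 < \<eta>" "\<eta> \<le> \<eta>0" "\<eta> \<le> 1/2" "\<eta> * M \<le> e"
  proof -
    show "0 < \<eta>" using \<eta>0 e \<open>M > 0\<close> by (simp add: \<eta>_def)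
    show "\<eta> \<le> \<eta>0" by (simp add: \<eta>_def)
    show "\<eta> \<le> 1/2" unfolding \<eta>_def by (rule min.cobounded2)
    have "\<eta> \<le> e / M" by (simp add: \<eta>_def)
    then show "\<eta> * M \<le> e" using \<open>M > 0\<close> by (simp add: pos_le_divide_eq)
  qed
  \<comment> \<open>The paths \<open>f\<close> and \<open>g\<close> agree for \<open>x \<le> 1 - \<eta>\<close>, where they need not follow the strands of \<open>T\<close>.
    For \<open>x \<ge> 1 - \<eta>\<close> the path \<open>f\<close> follows them, and for \<open>x \<ge> 1 - \<eta> / 2\<close> the path \<open>g\<close> is constant.\<close>
  define u where "u = (\<lambda>x::real. min (1 - x) \<eta>)"
  define w where "w = (\<lambda>x::real. min \<eta> (max 0 (2 - \<eta> - 2 * x)))"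
  define f where "f = (\<lambda>x j. b j + u x *\<^sub>R m j)"
  define g where "g = (\<lambda>x j. b j + w x *\<^sub>R m j)"
  have u: "0 \<le> u x" "u x \<le> \<eta>" "0 \<le> w x" "w x \<le> \<eta>" if "x \<in> {0..1}" for x
    using that \<eta>(1) by (auto simp: u_def w_def)
  have small: "l1 (t *\<^sub>R m j) \<le> e" if "\<bar>t\<bar> \<le> \<eta>" "j \<in> {1..n}" for t j
  proof -
    have "l1 (t *\<^sub>R m j) = \<bar>t\<bar> * l1 (m j)" by (rule l1_scaleR)
    also have "\<dots> \<le> \<eta> * M" using that M[OF that(2)] \<eta>(1) by (intro mult_mono) auto
    finally show ?thesis using \<eta>(4) by linarith
  qed
  have fb: "l1 (f x j - b j) \<le> e" if "x \<in> {0..1}" "j \<in> {1..n}" for x j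
    using small[of "u x" j] u[OF that(1)] that(2) by (simp add: f_def)
  have id: "pl_on {0..1} (\<lambda>x::real. x)" by (rule pl_on_ident[OF polytope_interval_real])
  have plu: "pl_on {0..1} u" unfolding u_def by (intro pl_on_min pl_on_diff pl_on_const[OF id] id)
  have plw: "pl_on {0..1} w" unfolding w_def
    by (intro pl_on_min pl_on_max pl_on_diff pl_on_mult pl_on_const[OF id] id)
  have "\<exists>h k. level_homeo h k \<and> (\<forall>x\<in>{0..1}. \<forall>i\<in>{1..n}. h (x, f x i) = (x, g x i))"
  proof (rule move_strands[OF _ e])
    fix x j assume x: "x \<in> {0..1::real}" and j: "j \<in> {1..n}"
    have "l1 (g x j - f x j) = l1 ((w x - u x) *\<^sub>R m j)" by (simp add: f_def g_def algebra_simps)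
    also have "\<dots> \<le> e" using u[OF x] j by (intro small) auto
    finally show "l1 (g x j - f x j) \<le> e" .
  next
    fix x j r assume x: "x \<in> {0..1::real}" and j: "j \<in> {1..n}" and r: "l1 (r - f x j) < 5 * e"
    have "l1 (r - b j) \<le> l1 (r - f x j) + l1 (f x j - b j)" by (rule l1_triangle)
    then have "l1 (r - b j) < E" using r fb[OF x j] e by (simp add: e_def)
    then show "r \<in> open_square" using E(2) j unfolding roomy_def by blast
  next
    fix x i j assume x: "x \<in> {0..1::real}" and ij: "i \<in> {1..n}" "j \<in> {1..n}" "i \<noteq> j"
    have "E \<le> l1 (b i - b j)" using E(2) ij unfolding roomy_def by blast
    also have "\<dots> \<le> l1 (b i - f x i) + l1 (f x i - b j)" by (rule l1_triangle)
    also have "l1 (f x i - b j) \<le> l1 (f x i - f x j) + l1 (f x j - b j)" by (rule l1_triangle)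
    finally show "5 * e \<le> l1 (f x i - f x j)"
      using fb[OF x ij(1)] fb[OF x ij(2)] l1_minus_commute[of "b i" "f x i"] e by (simp add: e_def)
  next
    fix j
    show "pl_on {0..1} (\<lambda>x. f x j)" "pl_on {0..1} (\<lambda>x. g x j)"
      unfolding f_def g_def by (intro pl_on_add pl_on_scaleR_left plu plw pl_on_const[OF id])+
    show "f 0 j = g 0 j" "f 1 j = g 1 j" using \<eta> by (simp_all add: f_def g_def u_def w_def min_def max_def)
  qed simp
  then obtain h k where hk: "level_homeo h k" "\<And>x i. x \<in> {0..1} \<Longrightarrow> i \<in> {1..n} \<Longrightarrow> h (x, f x i) = (x, g x i)"
    by blast
  have rel: "rel_homeo h k" using hk(1) by (simp add: level_homeo_def)
  have key: "h (x, b j + (1 - x) *\<^sub>R m j) = (x, b j)" if "1 - \<eta> / 2 \<le> x" "x \<le> 1" "j \<in> {1..n}" for x j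
  proof -
    have "f x j = b j + (1 - x) *\<^sub>R m j" "g x j = b j"
      using that(1) \<eta> by (simp_all add: f_def g_def u_def w_def min_def max_def)
    then show ?thesis using hk(2)[of x j] that \<eta> by auto
  qed
  have locT: "(x, q) \<in> T \<longleftrightarrow> x \<le> 1 \<and> (\<exists>j\<in>{1..n}. q = b j + (1 - x) *\<^sub>R m j)" if "1 - \<eta> / 2 \<le> x" for x q
    using loc[of x q] that \<eta> by (simp add: b_def)
  have "straight_right n (\<eta> / 2) (h ` T)"
    unfolding straight_right_def
  proof (intro allI impI iffI)
    fix x q assume x: "1 - \<eta> / 2 \<le> x" and "(x, q) \<in> h ` T"
    then obtain p where p: "p \<in> T" "h p = (x, q)" by auto
    have fp: "fst p = x"
      using hk(1) p string_link_subset(1)[OF T p(1)] unfolding level_homeo_def by (metis fst_conv)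
    then have "(x, snd p) \<in> T" using p(1) by auto
    then obtain j where j: "x \<le> 1" "j \<in> {1..n}" "snd p = b j + (1 - x) *\<^sub>R m j" using locT[OF x] by blast
    have "p = (x, b j + (1 - x) *\<^sub>R m j)" using fp j(3) by (simp add: prod_eq_iff)
    then have "q = b j" using key[OF x j(1,2)] p(2) by simp
    then show "x \<le> 1 \<and> q \<in> base n ` {1..n}" using j(1,2) bim by blast
  next
    fix x q assume x: "1 - \<eta> / 2 \<le> x" and q: "x \<le> 1 \<and> q \<in> base n ` {1..n}"
    then obtain j where j: "j \<in> {1..n}" "q = b j" using bim by blast
    then have "(x, b j + (1 - x) *\<^sub>R m j) \<in> T" using locT[OF x] q by blast
    then show "(x, q) \<in> h ` T" using key[OF x _ j(1)] q j(2) by (metis imageI)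
  qed
  then show ?thesis using rel \<eta> by (intro exI[of _ h] exI[of _ k] exI[of _ "\<eta> / 2"]) auto
qed

lemma mem_identity_braid: "(x, q) \<in> identity_braid n \<longleftrightarrow> x \<in> {0..1} \<and> q \<in> base n ` {1..n}"
  by (auto simp: identity_braid_def base_def)

lemma identity_in_string_links: "identity_braid n \<in> string_links n"
  using identity_in_braids braids_subset_string_links by blast

text \<open>
  If the strands of \<open>T\<close> are straight for \<open>x \<ge> 1 - \<eta>\<close>, then \<open>T\<close> and its product with the identity differ
  by a reparametrization of \<open>x\<close> only, which stretches \<open>[0, (1 - \<eta>) / 2]\<close> to \<open>[0, 1 - \<eta>]\<close>.
\<close>

lemma straight_stack_identity:
  assumes T: "T \<in> string_links n" and st: "straight_right n \<eta> T" and \<eta>: "0 < \<eta>" "\<eta> < 1"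
  shows "(stack T (identity_braid n), T) \<in> string_link_equivalence n"
proof -
  let ?S = "stack T (identity_braid n)"
  have S: "?S \<in> string_links n" by (rule stack_string_links[OF T identity_in_string_links])
  obtain d where d: "d > 0" "\<And>p. p \<in> ?S \<Longrightarrow> d \<le> depth (snd p)" using string_link_depth[OF S] by blast
  \<comment> \<open>The slope of the affine map from \<open>[(1 - \<eta>) / 2, 1]\<close> onto \<open>[1 - \<eta>, 1]\<close>.\<close>
  define c where "c = 2 * \<eta> / (1 + \<eta>)"
  have c: "0 < c" "c < 1" using \<eta> by (simp_all add: c_def field_simps)
  have cc: "c * (1 + \<eta>) = 2 * \<eta>" using \<eta> by (simp add: c_def)
  have crossing: "(2 - c) * ((1 - \<eta>) / 2) = 1 - c" using cc by (simp add: field_simps)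
  define \<phi> :: "real \<Rightarrow> real" where "\<phi> = (\<lambda>x. min (2 * x) (1 - c * (1 - x)))"
  have \<phi>1: "\<phi> x = 2 * x" if "x \<le> (1 - \<eta>) / 2" for x
  proof -
    have "(2 - c) * x \<le> (2 - c) * ((1 - \<eta>) / 2)" using that c by (intro mult_left_mono) auto
    then have "2 * x \<le> 1 - c * (1 - x)" unfolding crossing by (simp add: algebra_simps)
    then show ?thesis by (simp add: \<phi>_def)
  qed
  have \<phi>2: "\<phi> x = 1 - c * (1 - x)" if "(1 - \<eta>) / 2 \<le> x" for x
  proof -
    have "(2 - c) * ((1 - \<eta>) / 2) \<le> (2 - c) * x" using that c by (intro mult_left_mono) auto
    then have "1 - c * (1 - x) \<le> 2 * x" unfolding crossing by (simp add: algebra_simps)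
    then show ?thesis by (simp add: \<phi>_def)
  qed
  have \<phi>3: "1 - \<eta> \<le> \<phi> x \<and> \<phi> x \<le> 1" if "(1 - \<eta>) / 2 \<le> x" "x \<le> 1" for x
  proof -
    have "c * (1 - x) \<le> c * ((1 + \<eta>) / 2)" using that c by (intro mult_left_mono) (auto simp: field_simps)
    then have "c * (1 - x) \<le> \<eta>" using cc by simp
    moreover have "0 \<le> c * (1 - x)" using that c by simp
    ultimately show ?thesis using \<phi>2[OF that(1)] by simp
  qed
  have id: "pl_on {0..1} (\<lambda>x::real. x)" by (rule pl_on_ident[OF polytope_interval_real])
  have "\<exists>h k. rel_homeo h k \<and> (\<forall>x\<in>{0..1}. \<forall>q. d \<le> depth q \<longrightarrow> h (x, q) = (\<phi> x, q))"
  proof (rule reparametrize_level[OF _ _ _ _ _ d(1)])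
    show "pl_on {0..1} \<phi>" unfolding \<phi>_def by (intro pl_on_min pl_on_diff pl_on_mult pl_on_const[OF id] id)
    show "strict_mono_on {0..1} \<phi>"
    proof (rule strict_mono_onI)
      fix r s :: real assume "r < s"
      then have "2 * r < 2 * s" "1 - c * (1 - r) < 1 - c * (1 - s)" using c by simp_all
      then show "\<phi> r < \<phi> s" unfolding \<phi>_def by linarith
    qed
    show "x \<le> \<phi> x" if "x \<in> {0..1}" for x
    proof -
      have "c * (1 - x) \<le> 1 * (1 - x)" using that c by (intro mult_right_mono) auto
      then show ?thesis using that by (simp add: \<phi>_def)
    qed
  qed (use c in \<open>auto simp: \<phi>_def\<close>)
  then obtain h k where hk: "rel_homeo h k"
    "\<And>x q. x \<in> {0..1} \<Longrightarrow> d \<le> depth q \<Longrightarrow> h (x, q) = (\<phi> x, q)" by blast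
  have hS: "h (x, q) = (\<phi> x, q)" if "(x, q) \<in> ?S" for x q
    using hk(2)[of x q] d(2)[OF that] string_link_subset(1)[OF S that] by (simp add: mem_tangle_ball)
  have T01: "x \<in> {0..1}" if "(x, q) \<in> T" for x q using string_link_subset(1)[OF T that] by (simp add: mem_tangle_ball)
  have stT: "(x, q) \<in> T \<longleftrightarrow> q \<in> base n ` {1..n}" if "1 - \<eta> \<le> x" "x \<le> 1" for x q
    using st that unfolding straight_right_def by blast
  have memS: "(x, q) \<in> ?S \<longleftrightarrow> (x \<le> 1/2 \<and> (2 * x, q) \<in> T) \<or> (1/2 \<le> x \<and> x \<le> 1 \<and> q \<in> base n ` {1..n})" for x q
  proof
    assume "(x, q) \<in> ?S"
    then consider a where "(a, q) \<in> T" "x = a / 2" | a where "(a, q) \<in> identity_braid n" "x = (a + 1) / 2"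
      unfolding stack_halves by auto
    then show "(x \<le> 1/2 \<and> (2 * x, q) \<in> T) \<or> (1/2 \<le> x \<and> x \<le> 1 \<and> q \<in> base n ` {1..n})"
    proof cases
      case (1 a)
      have e: "2 * x = a" using 1(2) by simp
      have "(2 * x, q) \<in> T" unfolding e by (rule 1(1))
      then show ?thesis using T01[of "2 * x" q] by auto
    qed (auto simp: mem_identity_braid)
  next
    assume "(x \<le> 1/2 \<and> (2 * x, q) \<in> T) \<or> (1/2 \<le> x \<and> x \<le> 1 \<and> q \<in> base n ` {1..n})"
    then show "(x, q) \<in> ?S"
    proof
      assume "x \<le> 1/2 \<and> (2 * x, q) \<in> T"
      then show ?thesis unfolding stack_halves by (intro UnI1 image_eqI[of _ _ "(2 * x, q)"]) auto
    next
      assume "1/2 \<le> x \<and> x \<le> 1 \<and> q \<in> base n ` {1..n}"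
      then show ?thesis unfolding stack_halves
        by (intro UnI2 image_eqI[of _ _ "(2 * x - 1, q)"]) (auto simp: mem_identity_braid)
    qed
  qed
  have base: "q \<in> base n ` {1..n}" if "(x, q) \<in> ?S" "(1 - \<eta>) / 2 \<le> x" for x q
    using that stT[of "2 * x" q] by (auto simp: memS)
  have "h ` ?S = T"
  proof
    show "h ` ?S \<subseteq> T"
    proof
      fix p assume "p \<in> h ` ?S"
      then obtain x q where xq: "(x, q) \<in> ?S" "p = h (x, q)" by auto
      then have p: "p = (\<phi> x, q)" using hS by simp
      show "p \<in> T"
      proof (cases "(1 - \<eta>) / 2 \<le> x")
        case True
        have "x \<le> 1" using string_link_subset(1)[OF S xq(1)] by (simp add: mem_tangle_ball)
        then show ?thesis unfolding p using stT \<phi>3[OF True] base[OF xq(1) True] by blast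
      next
        case False
        then have "x < 1/2" using \<eta> by (simp add: field_simps)
        then have "(2 * x, q) \<in> T" using xq(1) by (auto simp: memS)
        then show ?thesis unfolding p using \<phi>1[of x] False by simp
      qed
    qed
    show "T \<subseteq> h ` ?S"
    proof
      fix p assume "p \<in> T"
      then obtain x q where xq: "(x, q) \<in> T" "p = (x, q)" by (cases p) auto
      show "p \<in> h ` ?S"
      proof (cases "x \<le> 1 - \<eta>")
        case True
        then have "x / 2 \<le> (1 - \<eta>) / 2" "x / 2 \<le> 1 / 2" using \<eta> by simp_all
        then have "(x / 2, q) \<in> ?S" "\<phi> (x / 2) = x" using xq(1) \<phi>1[of "x / 2"] by (simp_all add: memS)
        then show ?thesis using hS xq(2) by (metis imageI)
      next
        case False
        then have x: "1 - \<eta> \<le> x" "x \<le> 1" using T01[OF xq(1)] by auto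
        then have q: "q \<in> base n ` {1..n}" using stT xq(1) by blast
        define y where "y = 1 - (1 - x) / c"
        have "(1 - x) / c \<le> \<eta> / c" using x c by (intro divide_right_mono) auto
        also have "\<eta> / c = (1 + \<eta>) / 2" using \<eta> by (simp add: c_def)
        finally have y: "(1 - \<eta>) / 2 \<le> y" by (simp add: y_def field_simps)
        have y1: "y \<le> 1" using x c by (simp add: y_def)
        have "\<phi> y = x" using \<phi>2[OF y] c by (simp add: y_def)
        moreover have "(y, q) \<in> ?S"
          using stT[of "2 * y" q] y y1 q by (auto simp: memS)
        ultimately show ?thesis using hS xq(2) by (metis imageI)
      qed
    qed
  qed
  then show ?thesis using rel_homeo_equivalence[OF hk(1) S] by simp
qed

lemma stack_identity_equivalence:
  assumes T: "T \<in> string_links n"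
  shows "(stack T (identity_braid n), T) \<in> string_link_equivalence n"
proof -
  note r = equiv_string_link_equivalence[of n]
  have refl: "(identity_braid n, identity_braid n) \<in> string_link_equivalence n"
    using r identity_in_string_links by (auto simp: equiv_def refl_on_def)
  obtain h k \<eta> where h: "rel_homeo h k" "0 < \<eta>" "\<eta> < 1" "straight_right n \<eta> (h ` T)"
    using straighten_right[OF T] by blast
  have 1: "(T, h ` T) \<in> string_link_equivalence n" by (rule rel_homeo_equivalence[OF h(1) T])
  have 2: "(stack (h ` T) (identity_braid n), h ` T) \<in> string_link_equivalence n"
    by (rule straight_stack_identity[OF rel_homeo_string_link[OF h(1) T] h(4,2,3)])
  have 3: "(stack T (identity_braid n), stack (h ` T) (identity_braid n)) \<in> string_link_equivalence n"
    by (rule stack_equivalence[OF 1 refl])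
  have "trans (string_link_equivalence n)" "sym (string_link_equivalence n)" using r by (auto simp: equiv_def)
  then show ?thesis using 1 2 3 by (meson symD transD)
qed

text \<open>
  The reflection in the level \<open>x = 1/2\<close> exchanges the factors of a product, which reduces the left
  unit law to the right one.
\<close>

definition reflect :: "point \<Rightarrow> point" where
  "reflect p = (1 - fst p, snd p)"

lemma reflect_reflect [simp]: "reflect (reflect p) = p"
  by (simp add: reflect_def)

lemma reflect_tangle_ball: "reflect p \<in> tangle_ball \<longleftrightarrow> p \<in> tangle_ball"
  by (auto simp: reflect_def tangle_ball_def mem_Times_iff)

lemma reflect_frontier: "reflect p \<in> frontier tangle_ball \<longleftrightarrow> p \<in> frontier tangle_ball"
  using reflect_tangle_ball[of p]
  by (cases p) (auto simp: reflect_def mem_frontier_tangle_ball)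

lemma pl_on_reflect: "pl_on S f \<Longrightarrow> pl_on S (\<lambda>x. reflect (f x))"
  unfolding reflect_def by (intro pl_on_Pair pl_on_diff pl_on_fst pl_on_snd; (rule pl_on_const)?; assumption)

lemma inj_reflect: "inj reflect"
  by (rule inj_on_inverseI[of _ reflect]) simp

lemma reflect_image_reflect [simp]: "reflect ` reflect ` A = A"
  by (simp add: image_image)

lemma rel_homeo_reflect:
  assumes h: "rel_homeo h k" shows "\<exists>k'. rel_homeo (\<lambda>p. reflect (h (reflect p))) k'"
proof
  have id: "pl_on tangle_ball (\<lambda>p. p)" by (rule pl_on_ident[OF polytope_tangle_ball])
  show "rel_homeo (\<lambda>p. reflect (h (reflect p))) (inv_into tangle_ball (\<lambda>p. reflect (h (reflect p))))"
  proof (rule rel_homeoI)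
    show "pl_on tangle_ball (\<lambda>p. reflect (h (reflect p)))"
      by (rule pl_on_reflect[OF pl_on_compose[OF pl_on_reflect[OF id] rel_homeo_pl[OF h]]])
        (simp add: reflect_tangle_ball)
    show "(\<lambda>p. reflect (h (reflect p))) ` tangle_ball \<subseteq> tangle_ball"
    proof (rule image_subsetI)
      show "reflect (h (reflect p)) \<in> tangle_ball" if "p \<in> tangle_ball" for p
        using rel_homeo_mem[OF h, of "reflect p"] that by (simp add: reflect_tangle_ball)
    qed
    show "inj_on (\<lambda>p. reflect (h (reflect p))) tangle_ball"
    proof (rule inj_onI)
      fix p q assume pq: "p \<in> tangle_ball" "q \<in> tangle_ball" and e: "reflect (h (reflect p)) = reflect (h (reflect q))"
      have B: "reflect p \<in> tangle_ball" "reflect q \<in> tangle_ball" using pq by (simp_all only: reflect_tangle_ball)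
      have "h (reflect p) = h (reflect q)" using e by (rule injD[OF inj_reflect])
      then have "reflect p = reflect q" using B by (rule inj_onD[OF rel_homeo_inj_on[OF h]])
      then show "p = q" by (rule injD[OF inj_reflect])
    qed
    show "reflect (h (reflect p)) = p" if "p \<in> frontier tangle_ball" for p
      using rel_homeo_frontier[OF h, of "reflect p"] that by (simp add: reflect_frontier)
  qed
qed

lemma reflect_string_link:
  assumes "T \<in> string_links n" shows "reflect ` T \<in> string_links n"
proof -
  obtain \<gamma> where sl: "string_link_strands n \<gamma>" and T: "T = strand_union n \<gamma>"
    using assms by (auto simp: string_links_def)
  then have ts: "tangle_strands n \<gamma>" by (simp add: string_link_strands_def)
  have un: "strand_union n (\<lambda>i. reflect \<circ> \<gamma> i) = reflect ` strand_union n \<gamma>"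
    unfolding strand_union_def path_image_compose by blast
  have ends: "reflect ` endpoints n = endpoints n"
    by (force simp: endpoints_eq reflect_def image_iff)
  have frim: "reflect ` frontier tangle_ball = frontier tangle_ball"
  proof
    show "reflect ` frontier tangle_ball \<subseteq> frontier tangle_ball" by (auto simp: reflect_frontier)
    show "frontier tangle_ball \<subseteq> reflect ` frontier tangle_ball"
      by (metis image_eqI reflect_frontier reflect_reflect subsetI)
  qed
  have "tangle_strands n (\<lambda>i. reflect \<circ> \<gamma> i)"
    unfolding tangle_strands_def un
  proof (intro conjI ballI)
    fix i assume i: "i \<in> {1..n}"
    have a: "arc (\<gamma> i)" "pl_on {0..1} (\<gamma> i)" using ts i unfolding tangle_strands_def by blast+
    show pl: "pl_on {0..1} (reflect \<circ> \<gamma> i)" unfolding comp_def by (rule pl_on_reflect[OF a(2)])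
    have "inj_on (\<gamma> i) {0..1}" using a(1) by (simp add: arc_def)
    then have "inj_on (reflect \<circ> \<gamma> i) {0..1}"
      by (rule comp_inj_on) (rule inj_on_subset[OF inj_reflect subset_UNIV])
    then show "arc (reflect \<circ> \<gamma> i)"
      using pl_on_imp_continuous_on[OF pl] unfolding arc_def path_def by simp
  next
    show "disjoint_family_on (\<lambda>i. path_image (reflect \<circ> \<gamma> i)) {1..n}"
      unfolding disjoint_family_on_def path_image_compose image_Int[OF inj_reflect, symmetric]
    proof (intro ballI impI)
      fix i j assume "i \<in> {1..n}" "j \<in> {1..n}" "i \<noteq> j"
      then have "path_image (\<gamma> i) \<inter> path_image (\<gamma> j) = {}"
        using ts unfolding tangle_strands_def disjoint_family_on_def by blast
      then show "reflect ` (path_image (\<gamma> i) \<inter> path_image (\<gamma> j)) = {}" by simp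
    qed
    have "(\<Union>i\<in>{1..n}. {pathstart (reflect \<circ> \<gamma> i), pathfinish (reflect \<circ> \<gamma> i)}) =
        reflect ` (\<Union>i\<in>{1..n}. {pathstart (\<gamma> i), pathfinish (\<gamma> i)})"
      by (simp add: image_UN pathstart_compose pathfinish_compose)
    also have "\<dots> = endpoints n" using ts ends unfolding tangle_strands_def by simp
    finally show "(\<Union>i\<in>{1..n}. {pathstart (reflect \<circ> \<gamma> i), pathfinish (reflect \<circ> \<gamma> i)}) = endpoints n" .
    show "reflect ` strand_union n \<gamma> \<subseteq> tangle_ball"
    proof (rule image_subsetI)
      fix p assume "p \<in> strand_union n \<gamma>"
      then have "p \<in> tangle_ball" using ts unfolding tangle_strands_def by blast
      then show "reflect p \<in> tangle_ball" by (simp add: reflect_tangle_ball)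
    qed
    have "reflect ` strand_union n \<gamma> \<inter> frontier tangle_ball = reflect ` (strand_union n \<gamma> \<inter> frontier tangle_ball)"
      unfolding image_Int[OF inj_reflect] frim ..
    also have "\<dots> = endpoints n" using ts ends unfolding tangle_strands_def by simp
    finally show "reflect ` strand_union n \<gamma> \<inter> frontier tangle_ball = endpoints n" .
  qed
  moreover have "pathstart (reflect \<circ> \<gamma> i) \<in> left_face \<and> pathfinish (reflect \<circ> \<gamma> i) \<in> right_face \<or>
      pathstart (reflect \<circ> \<gamma> i) \<in> right_face \<and> pathfinish (reflect \<circ> \<gamma> i) \<in> left_face" if "i \<in> {1..n}" for i
  proof -
    have "pathstart (\<gamma> i) \<in> left_face \<and> pathfinish (\<gamma> i) \<in> right_face \<or>
        pathstart (\<gamma> i) \<in> right_face \<and> pathfinish (\<gamma> i) \<in> left_face"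
      using sl that unfolding string_link_strands_def by blast
    then show ?thesis
      by (auto simp: left_face_def right_face_def pathstart_def pathfinish_def mem_Times_iff reflect_def)
  qed
  ultimately have "string_link_strands n (\<lambda>i. reflect \<circ> \<gamma> i)" unfolding string_link_strands_def by simp
  then have "strand_union n (\<lambda>i. reflect \<circ> \<gamma> i) \<in> string_links n"
    unfolding string_links_def by (intro CollectI exI conjI) (assumption, rule refl)
  then show ?thesis unfolding T un .
qed

lemma reflect_equivalence:
  assumes "(T, T') \<in> string_link_equivalence n"
  shows "(reflect ` T, reflect ` T') \<in> string_link_equivalence n"
proof -
  obtain h k where h: "T \<in> string_links n" "rel_homeo h k" "h ` T = T'"
    using assms unfolding string_link_equivalence_iff by blast
  obtain k' where k': "rel_homeo (\<lambda>p. reflect (h (reflect p))) k'" using rel_homeo_reflect[OF h(2)] by blast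
  have "(\<lambda>p. reflect (h (reflect p))) ` reflect ` T = reflect ` T'"
    unfolding h(3)[symmetric] image_image by simp
  then show ?thesis using rel_homeo_equivalence[OF k' reflect_string_link[OF h(1)]] by simp
qed

lemma reflect_stack: "reflect ` stack A B = stack (reflect ` B) (reflect ` A)"
proof -
  have e: "(\<lambda>p. reflect (fst p / 2, snd p)) = (\<lambda>p. ((fst (reflect p) + 1) / 2, snd (reflect p)))"
    "(\<lambda>p. reflect ((fst p + 1) / 2, snd p)) = (\<lambda>p. (fst (reflect p) / 2, snd (reflect p)))"
    by (auto simp: reflect_def fun_eq_iff field_simps)
  show ?thesis unfolding stack_halves image_Un image_image e by (rule Un_commute)
qed

lemma reflect_identity: "reflect ` identity_braid n = identity_braid n"
proof -
  have "reflect p \<in> identity_braid n" if "p \<in> identity_braid n" for p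
    using that by (cases p) (auto simp: reflect_def mem_identity_braid)
  then have sub: "reflect ` identity_braid n \<subseteq> identity_braid n" by blast
  from image_mono[OF this, of reflect] have "identity_braid n \<subseteq> reflect ` identity_braid n" by simp
  with sub show ?thesis by blast
qed

lemma identity_stack_equivalence:
  assumes T: "T \<in> string_links n"
  shows "(stack (identity_braid n) T, T) \<in> string_link_equivalence n"
  using reflect_equivalence[OF stack_identity_equivalence[OF reflect_string_link[OF T]]]
  by (simp add: reflect_stack reflect_identity)

lemma monoid_string_link_monoid: "Group.monoid (string_link_monoid n)"
  unfolding string_link_monoid_def
  by (rule quotient_monoid_monoid[OF equiv_string_link_equivalence stack_equivalence identity_in_string_links
      stack_string_links stack_assoc_equivalence identity_stack_equivalence stack_identity_equivalence])

section \<open>From braids to string links\<close>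

lemma isotopy_imp_equivalence:
  assumes "(T, T') \<in> braid_isotopy n"
  shows "(T, T') \<in> string_link_equivalence n"
proof -
  from assms obtain f g where fg: "braid_path n f" "braid_path n g"
    "T = braid_graph n f" "T' = braid_graph n g" "homotopic_paths (config {1..n}) f g"
    by (rule isotopy_imp_homotopic)
  have "pl_path {1..n} f" "pl_path {1..n} g" using fg by (simp_all add: braid_path_def)
  then obtain h k where hk: "level_homeo h k" "\<And>x i. x \<in> {0..1} \<Longrightarrow> i \<in> {1..n} \<Longrightarrow> h (x, f x i) = (x, g x i)"
    using homotopic_paths_imp_level_homeo[OF finite_atLeastAtMost fg(5)] by blast
  have "h ` T = T'"
    unfolding fg(3,4) braid_graph_def strand_graph_def image_UN image_image using hk(2) by simp
  moreover have "T \<in> string_links n"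
    using braid_graph_in_braids[OF fg(1)] braids_subset_string_links fg(3) by blast
  ultimately show ?thesis using rel_homeo_equivalence[of h k T n] hk(1) by (simp add: level_homeo_def)
qed

lemma level_homeo_braid_path:
  assumes L: "level_homeo L L'" and f: "braid_path n f"
  obtains g where "braid_path n g" "\<And>x i. x \<in> {0..1} \<Longrightarrow> i \<in> {1..n} \<Longrightarrow> L (x, f x i) = (x, g x i)"
    "g 0 = f 0" "braid_graph n g = L ` braid_graph n f"
proof -
  define g where "g = (\<lambda>x i. if i \<in> {1..n} then snd (L (x, f x i)) else 0)"
  have rel: "rel_homeo L L'" using L by (simp add: level_homeo_def)
  have B: "(x, f x i) \<in> tangle_ball" if "x \<in> {0..1}" "i \<in> {1..n}" for x i
    by (rule tangle_ballI[OF that(1) braid_path_in_square[OF f that]])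
  have g: "g x i = snd (L (x, f x i))" if "i \<in> {1..n}" for x i unfolding g_def using that by (simp only: if_True)
  have g0: "g x i = 0" if "i \<notin> {1..n}" for x i unfolding g_def using that by (simp only: if_False)
  have Lf: "L (x, f x i) = (x, g x i)" if "x \<in> {0..1}" "i \<in> {1..n}" for x i
    using L B[OF that] g[OF that(2)] unfolding level_homeo_def by (metis fst_conv prod.collapse)
  have ends: "g x = f x" if x: "x = 0 \<or> x = 1" for x
  proof
    fix i
    have x01: "x \<in> {0..1}" using x by auto
    show "g x i = f x i"
    proof (cases "i \<in> {1..n}")
      case True
      have "(x, f x i) \<in> frontier tangle_ball" using B[OF x01 True] x by (auto simp: mem_frontier_tangle_ball)
      then show ?thesis using rel_homeo_frontier[OF rel] g[OF True] by simp
    qed (use g0 braid_path_out[OF f x01] in simp)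
  qed
  have id: "pl_on {0..1} (\<lambda>x::real. x)" by (rule pl_on_ident[OF polytope_interval_real])
  have sq: "g x i \<in> open_square" if x: "x \<in> {0..1}" and i: "i \<in> {1..n}" for x i
  proof (rule ccontr)
    assume out: "g x i \<notin> open_square"
    have gB: "(x, g x i) \<in> tangle_ball" using rel_homeo_mem[OF rel B[OF x i]] Lf[OF x i] by simp
    then have "(x, g x i) \<in> frontier tangle_ball" using out by (simp add: mem_frontier_tangle_ball)
    then have "L (x, g x i) = (x, g x i)" by (rule rel_homeo_frontier[OF rel])
    then have "(x, g x i) = (x, f x i)"
      using Lf[OF x i] by (intro inj_onD[OF rel_homeo_inj_on[OF rel] _ gB B[OF x i]]) simp
    then show False using out braid_path_in_square[OF f x i] by simp
  qed
  have "braid_path n g"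
  proof (rule braid_pathI)
    show "pl_path {1..n} g"
      unfolding pl_path_def
    proof
      fix i assume i: "i \<in> {1..n}"
      have "pl_on {0..1} (\<lambda>x. snd (L (x, f x i)))"
        by (rule pl_on_snd[OF pl_on_compose[OF pl_on_Pair[OF id braid_path_pl[OF f i]] rel_homeo_pl[OF rel]]])
          (rule B[OF _ i])
      then show "pl_on {0..1} (\<lambda>x. g x i)" unfolding g[OF i] .
    qed
    fix x :: real assume x: "x \<in> {0..1}"
    show "g x \<in> config {1..n}"
    proof (rule configI)
      show "g x i \<in> open_square" if "i \<in> {1..n}" for i by (rule sq[OF x that])
      show "i = j" if ij: "i \<in> {1..n}" "j \<in> {1..n}" "g x i = g x j" for i j
      proof -
        have "L (x, f x i) = L (x, f x j)" using Lf[OF x ij(1)] Lf[OF x ij(2)] ij(3) by simp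
        then have "(x, f x i) = (x, f x j)"
          by (rule inj_onD[OF rel_homeo_inj_on[OF rel] _ B[OF x ij(1)] B[OF x ij(2)]])
        then show ?thesis using braid_path_neq[OF f x ij(1,2)] by simp
      qed
      show "g x i = 0" if "i \<notin> {1..n}" for i by (rule g0[OF that])
    qed
  next
    show "g 0 ` {1..n} = base n ` {1..n}" "g 1 ` {1..n} = base n ` {1..n}"
      using f ends by (simp_all add: braid_path_def)
  qed
  moreover have "braid_graph n g = L ` braid_graph n f"
    unfolding braid_graph_def strand_graph_def image_UN image_image using Lf by simp
  ultimately show thesis using that[of g] Lf ends by blast
qed

lemma homotopic_paths_convex:
  fixes S :: "'a::real_normed_vector set"
  assumes "convex S" "path p" "path_image p \<subseteq> S" "path q" "path_image q \<subseteq> S"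
    "pathstart p = pathstart q" "pathfinish p = pathfinish q"
  shows "homotopic_paths S p q"
proof -
  have "\<forall>p q. path p \<and> path_image p \<subseteq> S \<and> path q \<and> path_image q \<subseteq> S \<and>
      pathfinish q = pathfinish p \<and> pathstart q = pathstart p \<longrightarrow> homotopic_paths S p q"
    using convex_imp_simply_connected[OF assms(1)] unfolding simply_connected_eq_homotopic_paths by simp
  then show ?thesis using assms(2-) by simp
qed

lemma fst_base_neq: "i \<in> {1..n} \<Longrightarrow> j \<in> {1..n} \<Longrightarrow> i \<noteq> j \<Longrightarrow> fst (base n i) \<noteq> fst (base n j)"
  by (simp add: base_def)

lemma snd_base: "i \<in> {1..n} \<Longrightarrow> snd (base n i) = 1/2"
  by (simp add: base_def)

text \<open>
  Let a homeomorphism \<open>H\<close> relative to the boundary carry the trivial braid to a braid whose first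
  \<open>k\<close> strands are straight. Strand \<open>J = k + 1\<close> of the trivial braid is homotopic, in the complement
  of its first \<open>k\<close> strands, to a path in the boundary, which \<open>H\<close> fixes. So strand \<open>J\<close>
  of the given braid is homotopic to the straight strand in the complement of the straight strands
  \<open>1, \<dots>, k\<close>, and forgetting the coordinate \<open>x\<close> gives a homotopy in the punctured square.
\<close>

lemma next_strand_homotopic:
  assumes H: "rel_homeo H H'" and f: "braid_path n f" and HT: "H ` identity_braid n = braid_graph n f"
    and straight: "\<And>x i. x \<in> {0..1} \<Longrightarrow> i \<in> {1..k} \<Longrightarrow> f x i = base n i"
    and f0: "f 0 = base n" and J: "J = Suc k" "J \<le> n"
  shows "homotopic_paths (open_square - base n ` {1..k}) (\<lambda>x. f x J) (\<lambda>x. base n J)"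
proof -
  have JI: "J \<in> {1..n}" and kn: "{1..k} \<subseteq> {1..n}" using J by auto
  have Jk: "J \<notin> {1..k}" using J by simp
  let ?line = "\<lambda>i. strand_graph (\<lambda>x. base n) i"
  define X where "X = tangle_ball - (\<Union>i\<in>{1..k}. ?line i)"
  have lineB: "?line i \<subseteq> tangle_ball" if "i \<in> {1..n}" for i
    using base_in_square[OF that] by (auto simp: strand_graph_def intro: tangle_ballI)
  have Hcont: "continuous_on tangle_ball H" by (rule pl_on_imp_continuous_on[OF rel_homeo_pl[OF H]])
  have Hline: "H ` ?line i \<subseteq> strand_graph f i" if i: "i \<in> {1..n}" for i
  proof (rule connected_in_strand_graph[OF f i])
    show "connected (H ` ?line i)"
    proof (rule connected_continuous_image)
      show "continuous_on (?line i) H" by (rule continuous_on_subset[OF Hcont lineB[OF i]])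
      show "connected (?line i)" unfolding strand_graph_def
        by (intro connected_continuous_image continuous_intros) simp
    qed
    show "H ` ?line i \<subseteq> braid_graph n f"
    proof -
      have "?line i \<subseteq> identity_braid n" unfolding identity_braid_graph braid_graph_def using i by blast
      then show ?thesis unfolding HT[symmetric] by (rule image_mono)
    qed
    have b: "(0, base n i) \<in> ?line i" "(0, base n i) \<in> strand_graph f i"
      using f0 unfolding strand_graph_def by (auto intro!: image_eqI[of _ _ 0])
    have "(0, base n i) \<in> frontier tangle_ball"
      using base_in_square[OF i] by (auto simp: mem_frontier_tangle_ball intro: tangle_ballI)
    then have "H (0, base n i) = (0, base n i)" by (rule rel_homeo_frontier[OF H])
    then have "(0, base n i) \<in> H ` ?line i" using imageI[OF b(1), of H] by simp
    then show "H ` ?line i \<inter> strand_graph f i \<noteq> {}" using b(2) by blast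
  qed
  \<comment> \<open>\<open>H\<close> maps the first \<open>k\<close> straight strands onto themselves, hence preserves their complement.\<close>
  have HX: "H p \<in> X" if "p \<in> X" for p
  proof (rule ccontr)
    assume "H p \<notin> X"
    have pB: "p \<in> tangle_ball" using that by (simp add: X_def)
    then have "H p \<in> tangle_ball" by (rule rel_homeo_mem[OF H])
    then obtain i where i: "i \<in> {1..k}" "H p \<in> ?line i" using \<open>H p \<notin> X\<close> unfolding X_def by blast
    then have iI: "i \<in> {1..n}" using kn by blast
    have line: "?line i = strand_graph f i" unfolding strand_graph_def using straight[OF _ i(1)] by simp
    then have "H p \<in> braid_graph n f" using i(2) iI unfolding braid_graph_def by blast
    then obtain p' where p': "p' \<in> identity_braid n" "H p' = H p" unfolding HT[symmetric] by (elim imageE) auto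
    then obtain j where j: "j \<in> {1..n}" "p' \<in> ?line j" unfolding identity_braid_graph braid_graph_def by blast
    then have "H p \<in> strand_graph f j" using subsetD[OF Hline[OF j(1)] imageI[OF j(2)]] p'(2) by simp
    then have "j = i" using disjoint_strand_graph[OF f iI j(1)] i(2) line by blast
    have "p' \<in> tangle_ball" using lineB[OF j(1)] j(2) by blast
    then have "p' = p" using inj_onD[OF rel_homeo_inj_on[OF H] p'(2) _ pB] by blast
    then show False using that j(2) i(1) \<open>j = i\<close> unfolding X_def by blast
  qed
  define y where "y = fst (base n J)"
  have bJ: "base n J = (y, 1/2)" using snd_base[OF JI] by (simp add: y_def prod_eq_iff)
  have y: "0 < y" "y < 1" using base_in_square[OF JI] by (auto simp: bJ open_square_def)
  \<comment> \<open>The rectangle above the straight strand \<open>J\<close> avoids the other straight strands, whose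
    \<open>y\<close>-coordinates differ; \<open>\<delta>\<close> runs along its remaining three sides, which lie in the boundary.\<close>
  define R :: "point set" where "R = {0..1} \<times> {y} \<times> {1/2..1}"
  have RX: "R \<subseteq> X"
  proof
    fix p assume p: "p \<in> R"
    have "p \<in> tangle_ball" using p y by (auto simp: R_def tangle_ball_def)
    moreover have "p \<notin> ?line i" if "i \<in> {1..k}" for i
    proof
      assume "p \<in> ?line i"
      then have "snd p = base n i" by (auto simp: strand_graph_def)
      moreover have "fst (snd p) = y" using p by (auto simp: R_def)
      moreover have "i \<in> {1..n}" "J \<noteq> i" using that kn Jk by auto
      ultimately show False using fst_base_neq[OF JI, of i] by (simp add: y_def)
    qed
    ultimately show "p \<in> X" unfolding X_def by blast
  qed
  define s where "s = (\<lambda>u::real. (u, base n J))"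
  define \<delta> :: "real \<Rightarrow> point" where
    "\<delta> = linepath (0, y, 1/2) (0, y, 1) +++ (linepath (0, y, 1) (1, y, 1) +++ linepath (1, y, 1) (1, y, 1/2))"
  have Rconv: "convex R" unfolding R_def by (intro convex_Times) auto
  have \<delta>_im: "path_image \<delta> = closed_segment (0, y, 1/2) (0, y, 1) \<union>
      (closed_segment (0, y, 1) (1, y, 1) \<union> closed_segment (1, y, 1) (1, y, 1/2))"
    unfolding \<delta>_def by (simp add: path_image_join)
  have pts: "(0, y, 1/2) \<in> R" "(0, y, 1) \<in> R" "(1, y, 1) \<in> R" "(1, y, 1/2) \<in> R" by (auto simp: R_def)
  have \<delta>R: "path_image \<delta> \<subseteq> R"
    unfolding \<delta>_im using closed_segment_subset[OF _ _ Rconv] pts by simp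
  have \<delta>_fr: "p \<in> frontier tangle_ball" if "p \<in> path_image \<delta>" for p
  proof -
    have "fst p = 0 \<or> fst p = 1 \<or> snd (snd p) = 1"
      using that unfolding \<delta>_im by (auto simp: closed_segment_def algebra_simps)
    moreover have "p \<in> tangle_ball" using that \<delta>R RX unfolding X_def by blast
    ultimately show ?thesis
      using mem_frontier_tangle_ball[of "fst p" "snd p"] by (auto simp: open_square_def mem_Times_iff)
  qed
  have s_path: "path s" "path_image s \<subseteq> R"
    unfolding s_def path_def path_image_def R_def bJ by (auto intro!: continuous_intros)
  have sd: "homotopic_paths X s \<delta>"
  proof (rule homotopic_paths_subset[OF homotopic_paths_convex[OF Rconv s_path _ \<delta>R] RX])
    show "path \<delta>" by (simp add: \<delta>_def)
    show "pathstart s = pathstart \<delta>" "pathfinish s = pathfinish \<delta>"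
      by (simp_all add: \<delta>_def s_def bJ pathstart_def pathfinish_def linepath_def)
  qed
  have HcX: "continuous_on X H" by (rule continuous_on_subset[OF Hcont]) (auto simp: X_def)
  have "homotopic_paths X (H \<circ> s) (H \<circ> \<delta>)"
    by (rule homotopic_paths_continuous_image[OF sd HcX]) (intro Pi_I HX)
  then have "homotopic_paths X (H \<circ> s) \<delta>"
  proof (rule homotopic_eq_paths)
    show "(H \<circ> \<delta>) t = \<delta> t" if "t \<in> {0..1}" for t
      using rel_homeo_frontier[OF H \<delta>_fr[of "\<delta> t"]] that by (simp add: path_image_def)
  qed simp
  then have hom: "homotopic_paths X (H \<circ> s) s" using homotopic_paths_trans homotopic_paths_sym[OF sd] by blast
  \<comment> \<open>The image of the straight strand \<open>J\<close> runs along strand \<open>J\<close> of the braid, at the level \<open>a u\<close>.\<close>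
  define a where "a = (\<lambda>u. fst (H (s u)))"
  have sline: "s u \<in> ?line J" if "u \<in> {0..1}" for u using that by (auto simp: s_def strand_graph_def)
  have Hs: "H (s u) = (a u, f (a u) J)" "a u \<in> {0..1}" if "u \<in> {0..1}" for u
  proof -
    have "H (s u) \<in> strand_graph f J" using Hline[OF JI] sline[OF that] by blast
    then show "H (s u) = (a u, f (a u) J)" "a u \<in> {0..1}" by (auto simp: strand_graph_def a_def)
  qed
  have sfr: "H (s u) = s u" if "u = 0 \<or> u = 1" for u
  proof (rule rel_homeo_frontier[OF H])
    have "s u \<in> tangle_ball" using lineB[OF JI] sline[of u] that by auto
    then show "s u \<in> frontier tangle_ball" using that by (auto simp: s_def mem_frontier_tangle_ball)
  qed
  have a01: "a 0 = 0" "a 1 = 1" using sfr by (simp_all add: a_def s_def)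
  have acont: "continuous_on {0..1} a"
  proof -
    have "continuous_on {0..1} s" using s_path(1) by (simp add: path_def)
    then have "continuous_on {0..1} (\<lambda>u. H (s u))"
      by (rule continuous_on_compose2[OF Hcont]) (use sline lineB[OF JI] in blast)
    then show ?thesis unfolding a_def by (rule continuous_on_fst)
  qed
  have "braid_graph n f \<in> string_links n"
    using braid_graph_in_braids[OF f] braids_subset_string_links by blast
  then obtain d0 where d0: "d0 > 0" "\<And>p. p \<in> braid_graph n f \<Longrightarrow> d0 \<le> depth (snd p)"
    using string_link_depth by blast
  have fdepth: "d0 \<le> depth (f x i)" if "x \<in> {0..1}" "i \<in> {1..n}" for x i
  proof -
    have "(x, f x i) \<in> braid_graph n f" unfolding braid_graph_def strand_graph_def using that by blast
    from d0(2)[OF this] show ?thesis by simp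
  qed
  \<comment> \<open>The homotopy may touch the sides of the square; clamping the coordinates to \<open>[d, 1 - d]\<close> pushes it
    inside. As \<open>d\<close> is strictly below the depth \<open>d0\<close> of the braid, a point that is pushed never lands
    on a base point.\<close>
  define d where "d = d0 / 2"
  define clamp where "clamp = (\<lambda>t::real. max d (min (1 - d) t))"
  define r where "r = (\<lambda>p::point. (clamp (fst (snd p)), clamp (snd (snd p))))"
  have d: "0 < d" "d < d0" using d0(1) by (simp_all add: d_def)
  have "depth q \<le> 1/2" for q by (auto simp: depth_def min_def)
  then have "d0 \<le> 1/2" using fdepth[OF _ JI, of 0] by (meson atLeastAtMost_iff order_refl order_trans zero_le_one)
  then have d1: "d < 1/2" using d(2) by simp
  have clamp_id: "clamp t = t" if "d \<le> t" "t \<le> 1 - d" for t using that by (simp add: clamp_def)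
  have clamp_eq: "t = w" if "clamp t = w" "d < w" "w < 1 - d" for t w
    using that by (auto simp: clamp_def max_def min_def split: if_splits)
  have clamp_in: "0 < clamp t" "clamp t < 1" for t using d d1 by (auto simp: clamp_def)
  have r_id: "r (x, q) = q" if "d0 \<le> depth q" for x q
    using that d clamp_id by (auto simp: r_def depth_def prod_eq_iff)
  let ?Y = "open_square - base n ` {1..k}"
  have rY: "r p \<in> ?Y" if "p \<in> X" for p
  proof -
    have "r p \<in> open_square" using clamp_in by (simp add: r_def open_square_def)
    moreover have "r p \<noteq> base n i" if i: "i \<in> {1..k}" for i
    proof
      assume e: "r p = base n i"
      have "d0 \<le> depth (base n i)" using fdepth[of 0 i] f0 i kn by auto
      then have "snd p = base n i"
        using e d clamp_eq[of "fst (snd p)"] clamp_eq[of "snd (snd p)"] by (auto simp: r_def depth_def prod_eq_iff)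
      moreover have "fst p \<in> {0..1}" using \<open>p \<in> X\<close> by (simp add: X_def tangle_ball_def mem_Times_iff)
      ultimately have "p \<in> ?line i" unfolding strand_graph_def by (intro image_eqI[of _ _ "fst p"]) (simp_all add: prod_eq_iff)
      then show False using \<open>p \<in> X\<close> i unfolding X_def by blast
    qed
    ultimately show ?thesis by blast
  qed
  have rcont: "continuous_on X r" unfolding r_def clamp_def by (intro continuous_intros)
  have "homotopic_paths ?Y (r \<circ> (H \<circ> s)) (r \<circ> s)"
    by (rule homotopic_paths_continuous_image[OF hom rcont]) (intro Pi_I rY)
  then have 1: "homotopic_paths ?Y (\<lambda>u. f (a u) J) (\<lambda>x. base n J)"
  proof (rule homotopic_eq_paths)
    fix u :: real assume u: "u \<in> {0..1}"
    show "(r \<circ> (H \<circ> s)) u = f (a u) J" using Hs[OF u] r_id[OF fdepth[OF Hs(2)[OF u] JI]] by simp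
    show "(r \<circ> s) u = base n J" using r_id[OF fdepth[of 0 J]] JI f0 by (simp add: s_def)
  qed
  have fJ: "path (\<lambda>x. f x J)" using pl_on_imp_continuous_on[OF braid_path_pl[OF f JI]] by (simp add: path_def)
  have fY: "path_image (\<lambda>x. f x J) \<subseteq> ?Y"
  proof -
    have "f x J \<in> ?Y" if x: "x \<in> {0..1}" for x
    proof -
      have "f x J \<noteq> base n i" if i: "i \<in> {1..k}" for i
      proof
        assume "f x J = base n i"
        then have "f x J = f x i" using straight[OF x i] by simp
        then have "J = i" using braid_path_neq[OF f x JI] i kn by blast
        then show False using Jk i by simp
      qed
      then show ?thesis using braid_path_in_square[OF f x JI] by blast
    qed
    then show ?thesis unfolding path_image_def by (rule image_subsetI)
  qed
  have 2: "homotopic_paths ?Y (\<lambda>x. f x J) (\<lambda>u. f (a u) J)"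
    by (rule homotopic_paths_reparametrize[OF fJ fY acont _ a01 refl]) (intro Pi_I Hs(2))
  show ?thesis by (rule homotopic_paths_trans[OF 2 1])
qed

text \<open>
  The homotopy of strand \<open>J\<close>, with the first \<open>k\<close> strands at rest, is extended to a
  level-preserving homeomorphism, which moves the remaining strands along.
\<close>

lemma straighten_next_strand:
  assumes H: "rel_homeo H H'" and f: "braid_path n f" and HT: "H ` identity_braid n = braid_graph n f"
    and straight: "\<And>x i. x \<in> {0..1} \<Longrightarrow> i \<in> {1..k} \<Longrightarrow> f x i = base n i"
    and f0: "f 0 = base n" and J: "J = Suc k" "J \<le> n"
  shows "\<exists>L L'. level_homeo L L' \<and> (\<forall>x\<in>{0..1}. \<forall>i\<in>{1..J}. L (x, f x i) = (x, base n i))"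
proof -
  let ?Y = "open_square - base n ` {1..k}"
  have JI: "J \<in> {1..n}" and kn: "{1..k} \<subseteq> {1..n}" using J by auto
  define \<iota> where "\<iota> = (\<lambda>q i. if i = J then q else if i \<in> {1..k} then base n i else 0)"
  have \<iota>: "\<iota> q J = q" "\<And>i. i \<in> {1..k} \<Longrightarrow> \<iota> q i = base n i" "\<And>i. i \<notin> {1..J} \<Longrightarrow> \<iota> q i = 0" for q
    using J by (auto simp: \<iota>_def)
  have split: "i = J \<or> i \<in> {1..k}" if "i \<in> {1..J}" for i using that J by auto
  have conf: "\<iota> q \<in> config {1..J}" if q: "q \<in> ?Y" for q
  proof (rule configI)
    show "\<iota> q i \<in> open_square" if "i \<in> {1..J}" for i
      using split[OF that]
    proof
      assume "i = J"
      then show ?thesis using q \<iota>(1) by simp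
    next
      assume "i \<in> {1..k}"
      then show ?thesis using base_in_square[of i n] kn \<iota>(2)[of i q] by auto
    qed
    show "i = j" if ij: "i \<in> {1..J}" "j \<in> {1..J}" "\<iota> q i = \<iota> q j" for i j
    proof -
      have ne: "q \<noteq> base n i" if "i \<in> {1..k}" for i using q that by blast
      consider "i = J" "j = J" | "i = J" "j \<in> {1..k}" | "i \<in> {1..k}" "j = J" | "i \<in> {1..k}" "j \<in> {1..k}"
        using split[OF ij(1)] split[OF ij(2)] by blast
      then show ?thesis
      proof cases
        case 2
        then show ?thesis using ij(3) \<iota>(1)[of q] \<iota>(2)[of j q] ne[of j] by simp
      next
        case 3
        then show ?thesis using ij(3) \<iota>(1)[of q] \<iota>(2)[of i q] ne[of i] by simp
      next
        case 4
        then have "base n i = base n j" using ij(3) \<iota>(2)[of i q] \<iota>(2)[of j q] by simp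
        then show ?thesis using 4 kn base_inj[of i n j] by blast
      qed simp
    qed
  qed (rule \<iota>(3))
  have cont: "continuous_on ?Y \<iota>"
  proof (rule continuous_on_coordinatewise_then_product)
    show "continuous_on ?Y (\<lambda>q. \<iota> q i)" for i
      unfolding \<iota>_def by (cases "i = J") auto
  qed
  have "homotopic_paths (config {1..J}) (\<iota> \<circ> (\<lambda>x. f x J)) (\<iota> \<circ> (\<lambda>x. base n J))"
  proof (rule homotopic_paths_continuous_image[OF _ cont])
    show "homotopic_paths ?Y (\<lambda>x. f x J) (\<lambda>x. base n J)"
      by (rule next_strand_homotopic[OF H f HT _ f0 J]) (rule straight)
  qed (intro Pi_I conf)
  then have hom: "homotopic_paths (config {1..J}) (\<lambda>x. \<iota> (f x J)) (\<lambda>x. \<iota> (base n J))" by (simp add: comp_def)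
  have pl: "pl_path {1..J} (\<lambda>x. \<iota> (g x))" if "pl_on {0..1} g" for g
    unfolding pl_path_def
  proof
    fix i assume "i \<in> {1..J}"
    from split[OF this] show "pl_on {0..1} (\<lambda>x. \<iota> (g x) i)"
    proof
      assume i: "i = J"
      show ?thesis unfolding i \<iota>(1) by (rule that)
    next
      assume i: "i \<in> {1..k}"
      show ?thesis unfolding \<iota>(2)[OF i] by (rule pl_on_const[OF that])
    qed
  qed
  have "pl_on {0..1} (\<lambda>x::real. base n J)" by (rule pl_on_const_polytope[OF polytope_interval_real])
  from homotopic_paths_imp_level_homeo[OF finite_atLeastAtMost hom pl[OF braid_path_pl[OF f JI]] pl[OF this]]
  obtain L L' where L: "level_homeo L L'"
    "\<And>x i. x \<in> {0..1} \<Longrightarrow> i \<in> {1..J} \<Longrightarrow> L (x, \<iota> (f x J) i) = (x, \<iota> (base n J) i)" by blast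
  have "L (x, f x i) = (x, base n i)" if "x \<in> {0..1}" "i \<in> {1..J}" for x i
    using split[OF that(2)]
  proof
    assume i: "i = J"
    show ?thesis using L(2)[OF that] unfolding i \<iota>(1) .
  next
    assume i: "i \<in> {1..k}"
    show ?thesis using L(2)[OF that] unfolding \<iota>(2)[OF i] straight[OF that(1) i] .
  qed
  then show ?thesis using L(1) by blast
qed

text \<open>
  Level-preserving homeomorphisms straighten the strands one after the other. When all are
  straight, the Alexander trick shows that the braid is isotopic to the trivial one.
\<close>

lemma trivial_string_link_imp_trivial_braid:
  assumes T: "T \<in> braids n" and triv: "(identity_braid n, T) \<in> string_link_equivalence n"
  shows "(T, identity_braid n) \<in> braid_isotopy n"
proof -
  obtain f where f: "braid_path n f" "f 0 = base n" "T = braid_graph n f" using T by (rule braids_normal_form)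
  obtain H H' where H: "rel_homeo H H'" "H ` identity_braid n = braid_graph n f"
    using triv f(3) unfolding string_link_equivalence_iff by blast
  have "\<exists>L L'. level_homeo L L' \<and> (\<forall>x\<in>{0..1}. \<forall>i\<in>{1..k}. L (x, f x i) = (x, base n i))" if "k \<le> n" for k
    using that
  proof (induction k)
    case 0
    show ?case using level_homeo_ident by auto
  next
    case (Suc k)
    then obtain L L' where L: "level_homeo L L'"
      "\<And>x i. x \<in> {0..1} \<Longrightarrow> i \<in> {1..k} \<Longrightarrow> L (x, f x i) = (x, base n i)" by auto
    obtain g where g: "braid_path n g" "\<And>x i. x \<in> {0..1} \<Longrightarrow> i \<in> {1..n} \<Longrightarrow> L (x, f x i) = (x, g x i)"
      "g 0 = f 0" "braid_graph n g = L ` braid_graph n f"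
      using level_homeo_braid_path[OF L(1) f(1)] by blast
    have "rel_homeo L L'" using L(1) by (simp add: level_homeo_def)
    then have rel: "rel_homeo (\<lambda>p. L (H p)) (\<lambda>p. H' (L' p))" by (rule rel_homeo_compose[OF H(1)])
    have im: "(\<lambda>p. L (H p)) ` identity_braid n = braid_graph n g"
      unfolding g(4) H(2)[symmetric] image_image ..
    have straight: "g x i = base n i" if "x \<in> {0..1}" "i \<in> {1..k}" for x i
    proof -
      have "i \<in> {1..n}" using that Suc.prems by auto
      then show ?thesis using L(2)[OF that] g(2)[OF that(1)] by simp
    qed
    have "g 0 = base n" using g(3) f(2) by simp
    then obtain M M' where M: "level_homeo M M'"
      "\<And>x i. x \<in> {0..1} \<Longrightarrow> i \<in> {1..Suc k} \<Longrightarrow> M (x, g x i) = (x, base n i)"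
      using straighten_next_strand[OF rel g(1) im straight _ refl Suc.prems] by blast
    have "M (L (x, f x i)) = (x, base n i)" if "x \<in> {0..1}" "i \<in> {1..Suc k}" for x i
    proof -
      have "i \<in> {1..n}" using that(2) Suc.prems by auto
      then show ?thesis using g(2)[OF that(1)] M(2)[OF that] by simp
    qed
    then show ?case using level_homeo_compose[OF L(1) M(1)] by blast
  qed
  from this[OF order_refl] obtain L L' where L: "level_homeo L L'"
    "\<And>x i. x \<in> {0..1} \<Longrightarrow> i \<in> {1..n} \<Longrightarrow> L (x, f x i) = (x, base n i)" by blast
  have "homotopic_paths (config {1..n}) f (\<lambda>x. base n)"
    by (rule alexander_trick[OF L(1)]) (use f(1) L(2) in \<open>auto simp: braid_path_def base_def\<close>)
  then show ?thesis
    unfolding f(3) identity_braid_graph by (rule homotopic_imp_isotopy[OF f(1) braid_path_const])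
qed

theorem theorem1p2:
  fixes n :: nat
  assumes "n \<ge> 1"
  shows "equiv (braids n) (braid_isotopy n) \<and>
         equiv (string_links n) (string_link_equivalence n) \<and>
         Group.group (braid_group n) \<and>
         Group.monoid (string_link_monoid n) \<and>
         braids n \<subseteq> string_links n \<and>
         (\<lambda>\<beta>. string_link_equivalence n `` {\<beta>}) respects braid_isotopy n \<and>
         (\<forall>\<beta>\<in>braids n. braid_to_string_link n (braid_isotopy n `` {\<beta>})
                          = string_link_equivalence n `` {\<beta>}) \<and>
         braid_to_string_link n \<in> hom (braid_group n) (string_link_monoid n) \<and>
         braid_to_string_link n \<one>\<^bsub>braid_group n\<^esub> = \<one>\<^bsub>string_link_monoid n\<^esub> \<and>
         inj_on (braid_to_string_link n) (carrier (braid_group n))"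
proof -
  let ?G = "braid_group n" and ?M = "string_link_monoid n" and ?\<Phi> = "braid_to_string_link n"
  let ?r = "braid_isotopy n" and ?s = "string_link_equivalence n"
  note r = equiv_braid_isotopy[of n] and s = equiv_string_link_equivalence[of n]
  have resp: "(\<lambda>\<beta>. ?s `` {\<beta>}) respects ?r"
    unfolding congruent_def using equiv_class_eq[OF s isotopy_imp_equivalence] by auto
  have \<Phi>: "?\<Phi> (?r `` {\<beta>}) = ?s `` {\<beta>}" if "\<beta> \<in> braids n" for \<beta>
    unfolding braid_to_string_link_def by (rule UN_equiv_class[OF r resp that])
  have cG: "carrier ?G = braids n // ?r" and cM: "carrier ?M = string_links n // ?s"
    and oG: "\<one>\<^bsub>?G\<^esub> = ?r `` {identity_braid n}" and oM: "\<one>\<^bsub>?M\<^esub> = ?s `` {identity_braid n}"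
    by (simp_all add: braid_group_def string_link_monoid_def quotient_monoid_def)
  have sl: "\<beta> \<in> string_links n" if "\<beta> \<in> braids n" for \<beta> using that braids_subset_string_links by blast
  have mG: "?r `` {\<alpha>} \<otimes>\<^bsub>?G\<^esub> ?r `` {\<beta>} = ?r `` {stack \<alpha> \<beta>}" if "\<alpha> \<in> braids n" "\<beta> \<in> braids n" for \<alpha> \<beta>
    unfolding braid_group_def by (rule quotient_monoid_mult[OF r stack_isotopy that])
  have mM: "?s `` {\<alpha>} \<otimes>\<^bsub>?M\<^esub> ?s `` {\<beta>} = ?s `` {stack \<alpha> \<beta>}" if "\<alpha> \<in> string_links n" "\<beta> \<in> string_links n" for \<alpha> \<beta>
    unfolding string_link_monoid_def by (rule quotient_monoid_mult[OF s stack_equivalence that])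
  interpret G: Group.group ?G by (rule group_braid_group)
  have repE: "\<exists>\<beta>\<in>braids n. X = ?r `` {\<beta>}" if "X \<in> carrier ?G" for X
    using that unfolding cG quotient_def by blast
  have mult: "?\<Phi> (X \<otimes>\<^bsub>?G\<^esub> Y) = ?\<Phi> X \<otimes>\<^bsub>?M\<^esub> ?\<Phi> Y" if X: "X \<in> carrier ?G" and Y: "Y \<in> carrier ?G" for X Y
  proof -
    obtain \<alpha> \<beta> where ab: "\<alpha> \<in> braids n" "\<beta> \<in> braids n" "X = ?r `` {\<alpha>}" "Y = ?r `` {\<beta>}"
      using repE[OF X] repE[OF Y] by blast
    then show ?thesis using mG[OF ab(1,2)] mM[OF sl[OF ab(1)] sl[OF ab(2)]] \<Phi> stack_braids by simp
  qed
  have hom: "?\<Phi> \<in> hom ?G ?M"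
  proof (rule homI)
    show "?\<Phi> X \<in> carrier ?M" if X: "X \<in> carrier ?G" for X
    proof -
      obtain \<beta> where b: "\<beta> \<in> braids n" "X = ?r `` {\<beta>}" using repE[OF X] by blast
      show ?thesis unfolding cM b(2) \<Phi>[OF b(1)] by (rule quotientI[OF sl[OF b(1)]])
    qed
  qed (rule mult)
  have one: "?\<Phi> \<one>\<^bsub>?G\<^esub> = \<one>\<^bsub>?M\<^esub>" unfolding oG oM by (rule \<Phi>[OF identity_in_braids])
  \<comment> \<open>The domain is a group, so a trivial kernel suffices for injectivity.\<close>
  have kernel: "X = \<one>\<^bsub>?G\<^esub>" if X: "X \<in> carrier ?G" and e: "?\<Phi> X = \<one>\<^bsub>?M\<^esub>" for X
  proof -
    obtain \<beta> where b: "\<beta> \<in> braids n" "X = ?r `` {\<beta>}" using repE[OF X] by blast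
    have "?s `` {identity_braid n} = ?s `` {\<beta>}" using e unfolding b(2) \<Phi>[OF b(1)] oM by (rule sym)
    then have "(identity_braid n, \<beta>) \<in> ?s" by (rule eq_equiv_class[OF _ s sl[OF b(1)]])
    then have "(\<beta>, identity_braid n) \<in> ?r" by (rule trivial_string_link_imp_trivial_braid[OF b(1)])
    then show ?thesis unfolding b(2) oG by (rule equiv_class_eq[OF r])
  qed
  have "inj_on ?\<Phi> (carrier ?G)"
  proof (rule inj_onI)
    fix X Y assume X: "X \<in> carrier ?G" and Y: "Y \<in> carrier ?G" and e: "?\<Phi> X = ?\<Phi> Y"
    let ?Z = "inv\<^bsub>?G\<^esub> Y"
    have Z: "?Z \<in> carrier ?G" using Y by simp
    have "?\<Phi> (X \<otimes>\<^bsub>?G\<^esub> ?Z) = ?\<Phi> (Y \<otimes>\<^bsub>?G\<^esub> ?Z)" unfolding mult[OF X Z] mult[OF Y Z] e ..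
    also have "\<dots> = \<one>\<^bsub>?M\<^esub>" using Y one by simp
    finally have "X \<otimes>\<^bsub>?G\<^esub> ?Z = \<one>\<^bsub>?G\<^esub>" using X Z by (intro kernel) simp_all
    then show "X = Y" using X Y G.inv_equality[of X ?Z] by simp
  qed
  then show ?thesis
    by (intro conjI ballI r s group_braid_group monoid_string_link_monoid braids_subset_string_links
        resp \<Phi> hom one)
qed

end
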